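(* Let $(X,\omega)$ be a compact toric symplectic manifold of dimension $2n$ with $[\tfrac{\omega}{2\pi}]-\tfrac12 c_1(X)\in H^2(X,\mathbb{Z})$, with moment map $\mu:X\to P_X$ normalized as in the context. Let $f\in\mathcal{C}^\infty(X,\mathbb{C})$, let $g\in\mathcal{C}^\infty(X,\mathbb{C})_{<\infty}$ (i.e. $g$ has only finitely many non-zero fibrewise Fourier coefficients), and let $V$ be a relatively compact open subset of the interior $\mathring{P}_X$ of $P_X$. Then there exists $\delta>0$ such that for all $N\in\mathbb{N}\cup\{0\}$ there exists $K>0$ such that $$\left\lVert Q_f^\hbar\circ Q_g^\hbar-Q_{f\star_N g}^\hbar\right\rVert_V\leq K\hbar^{N+1}$$ for all odd $k\in\mathbb{N}$ with $k\ge k_0$ and $\hbar=\tfrac1k<\delta$.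
   Context: **Toric setting.** $(X,\omega)$ is a compact (connected) toric symplectic manifold of dimension $2n$, with toric (effective Hamiltonian) action of $T=\mathbb{R}^n/(2\pi\mathbb{Z})^n$ and moment map $\mu:X\to\mathfrak{t}^*\cong\mathbb{R}^n$. $P_X=\mu(X)$ is the moment polytope, $\mathring{P}_X$ its interior, $\mathring{X}=\mu^{-1}(\mathring{P}_X)$. $\Sigma^{(1)}$ denotes the set of rays of the normal fan, i.e. the set of facets $F$ of $P_X$; $\nu_F$ is the primitive integral inward normal of $F$, and $P_X=\{x:\ l_F(x):=\langle x,\nu_F\rangle+\lambda_F\ge 0\ \text{for all } F\in\Sigma^{(1)}\}$ with $\lambda_F\in\mathbb{R}$. **Coordinates.** Fix action-angle coordinates $(x,\theta)$ on $\mathring{X}\cong\mathring{P}_X\times T$, so $\mu(x,\theta)=x$ and $\omega=\sum_i dx^i\wedge d\theta^i$. For a vertex $v$ of $P_X$ with adjacent facets $F_{v,1},\dots,F_{v,n}$ (in a fixed order), put $x_v=A_vx+\lambda_v$, $\theta_v={}^{t}A_v^{-1}\theta$, where $A_v\in \mathrm{GL}(n,\mathbb{Z})$ has rows $\nu_{F_{v,1}},\dots,\nu_{F_{v,n}}$ and $\lambda_v=(\lambda_{F_{v,1}},\dots,\lambda_{F_{v,n}})$. Let $U_v$ be the preimage under $\mu$ of the union of the relative interiors of all faces of $P_X$ containing $v$ (including $\{v\}$ and $P_X$). The coordinates are chosen so that $a_v^i=\sqrt{x_v^i}\cos\theta_v^i$, $b_v^i=\sqrt{x_v^i}\sin\theta_v^i$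 extend to smooth non-singular coordinates on $U_v$ for every vertex $v$. Write $U_\circ=\mathring{X}$. **Fibrewise Fourier coefficients.** The identification $\mathring{P}_X\times T\cong\mathring{X}$ extends to a continuous map $\mathrm{Bl}_X:P_X\times T\to X$ over $P_X$ (given near a vertex by $(x_v,\theta_v)\mapsto(a_v,b_v)$). For $f\in\mathcal{C}^\infty(X,\mathbb{C})$ and $p\in\mathbb{Z}^n$, $\widehat f_p(x)=\frac{1}{(2\pi)^n}\int_T(\mathrm{Bl}_X^*f)(x,\theta)e^{-\sqrt{-1}p\cdot\theta}d^n\theta$ for $x\in P_X$ (the same formula, without $\mathrm{Bl}_X$, on $\mathring{P}_X$ for $f\in\mathcal{C}^\infty(\mathring{X},\mathbb{C})$). $\mathcal{C}^\infty(X,\mathbb{C})_{\le l}$ is the set of $f\in \mathcal{C}^\infty(X,\mathbb{C})$ with $\widehat f_p\equiv0$ whenever $\max_i|p_i|>l$, and $\mathcal{C}^\infty(X,\mathbb{C})_{<\infty}=\bigcup_{l\ge0}\mathcal{C}^\infty(X,\mathbb{C})_{\le l}$. **Truncated star product.** For $f,g\in\mathcal{C}^\infty(X,\mathbb{C})$ and $N\ge0$, $f\star_Ng=\sum_{r=0}^N\hbar^rC_r(f,g)\in\mathcal{C}^\infty(\mathring{X},\mathbb{C})$, where on $\mathring{X}$ $$C_r(f,g)=\frac{1}{(\sqrt{-1})^r}\sum_{|I|=r}\frac{1}{I!}\frac{\partial^rf}{\partial x^I}\frac{\partial^rg}{\partial\theta^I}.$$ **Standing assumptions.** $[\frac{\omega}{2\pi}]-\frac12c_1(X)\in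 H^2(X,\mathbb{Z})$, and the moment map is normalized so that $\lambda_F\in\mathbb{Z}+\frac12$ for all $F$. Fix $k_0\in\mathbb{N}$ such that $k[\frac{\omega}{2\pi}]-\frac12c_1(X)$ is a positive class (for a $T$-invariant complex structure on $X$ determined by a symplectic potential) for all $k\ge k_0$. Throughout $k\in\mathbb{N}$ is odd, $k\ge k_0$, and $\hbar=\frac1k$. **Line bundle.** Let $\lambda_F^{L_+^k}=k\lambda_F-\frac12\in\mathbb{Z}$, and $\lambda_v^{L_+^k}=(\lambda^{L_+^k}_{F_{v,1}},\dots,\lambda^{L_+^k}_{F_{v,n}})$. $L_+^k$ is the Hermitian line bundle on $X$ with unitary frames $\mathbf{1}_\circ$ over $U_\circ$ and $\mathbf{1}_v$ over $U_v$ related by $\mathbf{1}_v=e^{-\sqrt{-1}\lambda_v^{L_+^k}\cdot\theta_v}\mathbf{1}_\circ$ on $U_\circ\cap U_v$ (the frames $\mathbf{1}_v,\mathbf{1}_{v'}$ for two vertices being related by the resulting transition functions). Put $P_{L_+^k}=\{x:\langle x,\nu_F\rangle+\lambda_F^{L_+^k}\ge0\ \forall F\in\Sigma^{(1)}\}$ and $\Lambda_\hbar=P_{L_+^k}\cap\mathbb{Z}^n$, which is contained in the interior of $kP_X$. For $\tau$ a section over $\mathring{X}$ (or $X$) write $\tau|_{\mathring{X}}=\tau_\circ\mathbf{1}_\circ$. **Quantum Hilbert space.** Distributional sections of $L_+^k$ over an open set $U$ are elements $s$ of the dual $\Gamma(U,\overline{L}_+^k)'$, with $\langle s,\tau\rangle:=s(\overline\tau)$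 for $\tau\in\Gamma(U,L_+^k)$. For $m\in\Lambda_\hbar$ let $\delta_\hbar^m$ be defined by $\langle\delta_\hbar^m,\tau\rangle=\frac1{(2\pi)^n}\int_Te^{\sqrt{-1}m\cdot\theta}\,\overline{\tau_\circ}(\hbar m,\theta)\,d^n\theta$. The space $\mathcal{H}^\hbar$ of half-form corrected quantum states (sections polarized along the torus fibres, tensored with the formal half-form $\sqrt{|d^nx|}$) is $\bigoplus_{m\in\Lambda_\hbar}\mathbb{C}\,\delta_\hbar^m\sqrt{|d^nx|}$, with the inner product for which $\sigma_\hbar^m:=(4\pi)^{n/4}\delta_\hbar^m\sqrt{|d^nx|}$, $m\in\Lambda_\hbar$, is an orthonormal basis. **Toeplitz operators.** The pairing between $\Gamma(\mathring{X},\overline{L}_+^k)'\sqrt{|d^nx|}$ and $\Gamma(\mathring{X},L_+^k)\sqrt{|d^n\theta|}$ is $\langle s\sqrt{|d^nx|},\tau\sqrt{|d^n\theta|}\rangle=(2k)^{-n/2}\langle s,\tau\rangle$. For $m\in\mathbb{Z}^n$ let $\check\sigma_\hbar^m=\frac{k^{n/2}}{\pi^{n/4}}e^{\sqrt{-1}m\cdot\theta}\mathbf{1}_\circ\sqrt{|d^n\theta|}$. Define $\Pi^\hbar:\Gamma(\mathring{X},\overline{L}_+^k)'\sqrt{|d^nx|}\to\mathcal{H}^\hbar$ by $\Pi^\hbar s=\sum_{m\in\Lambda_\hbar}\langle s,\check\sigma_\hbar^m\rangle\sigma_\hbar^m$. For $f\in\mathcal{C}^\infty(X,\mathbb{C})$,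 or more generally $f\in\mathcal{C}^\infty(\mathring{X},\mathbb{C})$, the Toeplitz operator is $Q_f^\hbar:\mathcal{H}^\hbar\to\mathcal{H}^\hbar$, $Q_f^\hbar s=\Pi^\hbar(fs)$, where $\langle f s,\tau\rangle = s(f\overline\tau)$; it depends only on $f|_{\mathring{X}}$. **Localized norm.** For an open subset $V$ of $P_X$, $\mathcal{H}_V^\hbar\subset\mathcal{H}^\hbar$ is the subspace of states supported on $\mu^{-1}(V)$, i.e. the span of $\sigma_\hbar^m$ with $m\in(kV)\cap\Lambda_\hbar$. For an operator $A$ on $\mathcal{H}^\hbar$, $\lVert A\rVert_V$ is the operator norm of $A|_{\mathcal{H}_V^\hbar}:\mathcal{H}_V^\hbar\to\mathcal{H}^\hbar$ with respect to the inner product norms. *)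

theory Defs
  imports "HOL-Analysis.Analysis" "HOL-Homology.Homology"
begin

section \<open>Smooth maps and smooth manifolds\<close>

text \<open>Used for open \<^term>\<open>S\<close> in a Euclidean space only.\<close>

primrec Ck_on :: "nat \<Rightarrow> 'a::real_normed_vector set \<Rightarrow> ('a \<Rightarrow> 'b::real_normed_vector) \<Rightarrow> bool" where
  "Ck_on 0 S f \<longleftrightarrow> continuous_on S f"
| "Ck_on (Suc r) S f \<longleftrightarrow> (\<forall>x\<in>S. f differentiable (at x)) \<and>
      (\<forall>v. Ck_on r S (\<lambda>x. frechet_derivative f (at x) v))"

definition smooth_on :: "'a::real_normed_vector set \<Rightarrow> ('a \<Rightarrow> 'b::real_normed_vector) \<Rightarrow> bool" where
  "smooth_on S f \<longleftrightarrow> (\<forall>r. Ck_on r S f)"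

text \<open>A chart is a pair (domain, coordinate map). A manifold is the whole type \<open>'x\<close> together
  with an atlas.\<close>

type_synonym ('x, 'e) chart = "'x set \<times> ('x \<Rightarrow> 'e)"

definition chart_inv :: "('x, 'e) chart \<Rightarrow> 'e \<Rightarrow> 'x" where
  "chart_inv c = inv_into (fst c) (snd c)"

definition chart_image :: "('x, 'e) chart \<Rightarrow> 'e set" where
  "chart_image c = snd c ` fst c"

definition is_chart :: "('x::topological_space, 'e::euclidean_space) chart \<Rightarrow> bool" where
  "is_chart c \<longleftrightarrow> open (fst c) \<and> open (chart_image c) \<and>
     homeomorphism (fst c) (chart_image c) (snd c) (chart_inv c)"

definition transition :: "('x, 'e) chart \<Rightarrow> ('x, 'e) chart \<Rightarrow> 'e \<Rightarrow> 'e" where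
  "transition c d = snd d \<circ> chart_inv c"

definition compatible_charts ::
    "('x, 'e::euclidean_space) chart \<Rightarrow> ('x, 'e) chart \<Rightarrow> bool" where
  "compatible_charts c d \<longleftrightarrow>
     smooth_on (snd c ` (fst c \<inter> fst d)) (transition c d) \<and>
     smooth_on (snd d ` (fst c \<inter> fst d)) (transition d c)"

definition smooth_atlas :: "('x::topological_space, 'e::euclidean_space) chart set \<Rightarrow> bool" where
  "smooth_atlas A \<longleftrightarrow> (\<forall>c\<in>A. is_chart c) \<and> (\<Union>c\<in>A. fst c) = UNIV \<and>
     (\<forall>c\<in>A. \<forall>d\<in>A. compatible_charts c d)"

text \<open>Membership in the maximal atlas, i.e. being a smooth coordinate system.\<close>

definition smooth_chart ::
    "('x::topological_space, 'e::euclidean_space) chart set \<Rightarrow> ('x, 'e) chart \<Rightarrow> bool" where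
  "smooth_chart A c \<longleftrightarrow> is_chart c \<and> (\<forall>d\<in>A. compatible_charts c d)"

definition smooth_fun ::
    "('x, 'e::euclidean_space) chart set \<Rightarrow> 'x set \<Rightarrow> ('x \<Rightarrow> 'b::real_normed_vector) \<Rightarrow> bool" where
  "smooth_fun A W f \<longleftrightarrow> (\<forall>c\<in>A. smooth_on (snd c ` (fst c \<inter> W)) (f \<circ> chart_inv c))"


section \<open>Differential forms, connections, and the first Chern class\<close>

text \<open>Tensor fields are given by their components in every chart of the atlas, as functions of
  a chart, a point of its image, and tangent vectors in these coordinates.\<close>

definition one_form ::
    "('x, 'e::euclidean_space) chart set \<Rightarrow> (('x, 'e) chart \<Rightarrow> 'e \<Rightarrow> 'e \<Rightarrow> real) \<Rightarrow> bool" where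
  "one_form A \<alpha> \<longleftrightarrow>
     (\<forall>c\<in>A. \<forall>y\<in>chart_image c. linear (\<alpha> c y)) \<and>
     (\<forall>c\<in>A. \<forall>u. smooth_on (chart_image c) (\<lambda>y. \<alpha> c y u)) \<and>
     (\<forall>c\<in>A. \<forall>d\<in>A. \<forall>y\<in>snd c ` (fst c \<inter> fst d). \<forall>u.
        \<alpha> c y u = \<alpha> d (transition c d y) (frechet_derivative (transition c d) (at y) u))"

definition two_form ::
    "('x, 'e::euclidean_space) chart set \<Rightarrow> (('x, 'e) chart \<Rightarrow> 'e \<Rightarrow> 'e \<Rightarrow> 'e \<Rightarrow> real) \<Rightarrow> bool" where
  "two_form A \<eta> \<longleftrightarrow>
     (\<forall>c\<in>A. \<forall>y\<in>chart_image c. bilinear (\<eta> c y) \<and> (\<forall>u. \<eta> c y u u = 0)) \<and>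
     (\<forall>c\<in>A. \<forall>u v. smooth_on (chart_image c) (\<lambda>y. \<eta> c y u v)) \<and>
     (\<forall>c\<in>A. \<forall>d\<in>A. \<forall>y\<in>snd c ` (fst c \<inter> fst d). \<forall>u v.
        \<eta> c y u v = \<eta> d (transition c d y)
          (frechet_derivative (transition c d) (at y) u)
          (frechet_derivative (transition c d) (at y) v))"

definition ext_deriv1 ::
    "(('x, 'e::euclidean_space) chart \<Rightarrow> 'e \<Rightarrow> 'e \<Rightarrow> real) \<Rightarrow> ('x, 'e) chart \<Rightarrow> 'e \<Rightarrow> 'e \<Rightarrow> 'e \<Rightarrow> real" where
  "ext_deriv1 \<alpha> c y u v =
     frechet_derivative (\<lambda>z. \<alpha> c z v) (at y) u - frechet_derivative (\<lambda>z. \<alpha> c z u) (at y) v"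

definition closed_form ::
    "('x, 'e::euclidean_space) chart set \<Rightarrow> (('x, 'e) chart \<Rightarrow> 'e \<Rightarrow> 'e \<Rightarrow> 'e \<Rightarrow> real) \<Rightarrow> bool" where
  "closed_form A \<eta> \<longleftrightarrow> two_form A \<eta> \<and>
     (\<forall>c\<in>A. \<forall>y\<in>chart_image c. \<forall>u v w.
        frechet_derivative (\<lambda>z. \<eta> c z v w) (at y) u +
        frechet_derivative (\<lambda>z. \<eta> c z w u) (at y) v +
        frechet_derivative (\<lambda>z. \<eta> c z u v) (at y) w = 0)"

definition cohomologous ::
    "('x, 'e::euclidean_space) chart set \<Rightarrow> (('x, 'e) chart \<Rightarrow> 'e \<Rightarrow> 'e \<Rightarrow> 'e \<Rightarrow> real) \<Rightarrow>
     (('x, 'e) chart \<Rightarrow> 'e \<Rightarrow> 'e \<Rightarrow> 'e \<Rightarrow> real) \<Rightarrow> bool" where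
  "cohomologous A \<eta> \<kappa> \<longleftrightarrow>
     (\<exists>\<alpha>. one_form A \<alpha> \<and>
        (\<forall>c\<in>A. \<forall>y\<in>chart_image c. \<forall>u v. \<eta> c y u v - \<kappa> c y u v = ext_deriv1 \<alpha> c y u v))"

definition symplectic_form ::
    "('x, 'e::euclidean_space) chart set \<Rightarrow> (('x, 'e) chart \<Rightarrow> 'e \<Rightarrow> 'e \<Rightarrow> 'e \<Rightarrow> real) \<Rightarrow> bool" where
  "symplectic_form A \<omega> \<longleftrightarrow> closed_form A \<omega> \<and>
     (\<forall>c\<in>A. \<forall>y\<in>chart_image c. \<forall>u. u \<noteq> 0 \<longrightarrow> (\<exists>v. \<omega> c y u v \<noteq> 0))"

definition almost_complex ::
    "('x, 'e::euclidean_space) chart set \<Rightarrow> (('x, 'e) chart \<Rightarrow> 'e \<Rightarrow> 'e \<Rightarrow> 'e) \<Rightarrow> bool" where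
  "almost_complex A J \<longleftrightarrow>
     (\<forall>c\<in>A. \<forall>y\<in>chart_image c. linear (J c y) \<and> (\<forall>u. J c y (J c y u) = - u)) \<and>
     (\<forall>c\<in>A. \<forall>u. smooth_on (chart_image c) (\<lambda>y. J c y u)) \<and>
     (\<forall>c\<in>A. \<forall>d\<in>A. \<forall>y\<in>snd c ` (fst c \<inter> fst d). \<forall>u.
        frechet_derivative (transition c d) (at y) (J c y u) =
        J d (transition c d y) (frechet_derivative (transition c d) (at y) u))"

definition positive_11 ::
    "('x, 'e::euclidean_space) chart set \<Rightarrow> (('x, 'e) chart \<Rightarrow> 'e \<Rightarrow> 'e \<Rightarrow> 'e) \<Rightarrow>
     (('x, 'e) chart \<Rightarrow> 'e \<Rightarrow> 'e \<Rightarrow> 'e \<Rightarrow> real) \<Rightarrow> bool" where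
  "positive_11 A J \<eta> \<longleftrightarrow>
     (\<forall>c\<in>A. \<forall>y\<in>chart_image c.
        (\<forall>u v. \<eta> c y (J c y u) (J c y v) = \<eta> c y u v) \<and>
        (\<forall>u. u \<noteq> 0 \<longrightarrow> \<eta> c y u (J c y u) > 0))"

text \<open>\<open>\<nabla>\<^sub>u v = D\<^sub>u v + \<Gamma>(u, v)\<close> in coordinates; the transformation law is the usual one for
  Christoffel symbols.\<close>

definition affine_connection ::
    "('x, 'e::euclidean_space) chart set \<Rightarrow> (('x, 'e) chart \<Rightarrow> 'e \<Rightarrow> 'e \<Rightarrow> 'e \<Rightarrow> 'e) \<Rightarrow> bool" where
  "affine_connection A \<Gamma> \<longleftrightarrow>
     (\<forall>c\<in>A. \<forall>y\<in>chart_image c. bilinear (\<Gamma> c y)) \<and>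
     (\<forall>c\<in>A. \<forall>u v. smooth_on (chart_image c) (\<lambda>y. \<Gamma> c y u v)) \<and>
     (\<forall>c\<in>A. \<forall>d\<in>A. \<forall>y\<in>snd c ` (fst c \<inter> fst d). \<forall>u v.
        frechet_derivative (transition c d) (at y) (\<Gamma> c y u v) =
        frechet_derivative (\<lambda>z. frechet_derivative (transition c d) (at z) v) (at y) u +
        \<Gamma> d (transition c d y)
          (frechet_derivative (transition c d) (at y) u)
          (frechet_derivative (transition c d) (at y) v))"

definition parallel_complex ::
    "('x, 'e::euclidean_space) chart set \<Rightarrow> (('x, 'e) chart \<Rightarrow> 'e \<Rightarrow> 'e \<Rightarrow> 'e \<Rightarrow> 'e) \<Rightarrow>
     (('x, 'e) chart \<Rightarrow> 'e \<Rightarrow> 'e \<Rightarrow> 'e) \<Rightarrow> bool" where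
  "parallel_complex A \<Gamma> J \<longleftrightarrow>
     (\<forall>c\<in>A. \<forall>y\<in>chart_image c. \<forall>u v.
        frechet_derivative (\<lambda>z. J c z v) (at y) u + \<Gamma> c y u (J c y v) - J c y (\<Gamma> c y u v) = 0)"

definition curvature ::
    "(('x, 'e::euclidean_space) chart \<Rightarrow> 'e \<Rightarrow> 'e \<Rightarrow> 'e \<Rightarrow> 'e) \<Rightarrow> ('x, 'e) chart \<Rightarrow> 'e \<Rightarrow> 'e \<Rightarrow> 'e \<Rightarrow> 'e \<Rightarrow> 'e" where
  "curvature \<Gamma> c y u v w =
     frechet_derivative (\<lambda>z. \<Gamma> c z v w) (at y) u - frechet_derivative (\<lambda>z. \<Gamma> c z u w) (at y) v
     + \<Gamma> c y u (\<Gamma> c y v w) - \<Gamma> c y v (\<Gamma> c y u w)"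

text \<open>The Chern-Weil form of \<open>(TX, J)\<close>: for a complex linear endomorphism \<open>R\<close> of \<open>(TX, J)\<close> one has
  \<open>2 tr\<^sub>C R = tr\<^sub>R R - i tr\<^sub>R (J R)\<close>, so \<open>Re (i/2\<pi> tr\<^sub>C R) = 1/4\<pi> tr\<^sub>R (J R)\<close>. If \<open>\<nabla>J = 0\<close>, this closed
  form represents \<open>c\<^sub>1(TX, J)\<close> in de Rham cohomology.\<close>

definition chern_form ::
    "(('x, 'e::euclidean_space) chart \<Rightarrow> 'e \<Rightarrow> 'e \<Rightarrow> 'e) \<Rightarrow> (('x, 'e) chart \<Rightarrow> 'e \<Rightarrow> 'e \<Rightarrow> 'e \<Rightarrow> 'e) \<Rightarrow>
     ('x, 'e) chart \<Rightarrow> 'e \<Rightarrow> 'e \<Rightarrow> 'e \<Rightarrow> real" where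
  "chern_form J \<Gamma> c y u v = (\<Sum>b\<in>Basis. J c y (curvature \<Gamma> c y u v b) \<bullet> b) / (4 * pi)"

text \<open>A closed 2-form represents a class in the image of \<open>H\<^sup>2(X, Z)\<close> in \<open>H\<^sup>2(X, R)\<close> iff its integral
  over every smooth singular 2-cycle with integer coefficients is an integer.\<close>

definition triangle :: "(real \<times> real) set" where
  "triangle = {(s, t). 0 \<le> s \<and> 0 \<le> t \<and> s + t \<le> 1}"

definition barycentric :: "real \<times> real \<Rightarrow> nat \<Rightarrow> real" where
  "barycentric = (\<lambda>(s, t) i. if i = 0 then 1 - s - t else if i = 1 then s else if i = 2 then t else 0)"

definition smooth_2simplex ::
    "('x, 'e::euclidean_space) chart set \<Rightarrow> ((nat \<Rightarrow> real) \<Rightarrow> 'x) \<Rightarrow> bool" where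
  "smooth_2simplex A \<sigma> \<longleftrightarrow>
     (\<forall>p\<in>triangle. \<exists>c\<in>A. \<exists>N h. open N \<and> p \<in> N \<and> smooth_on N h \<and>
        (\<forall>q\<in>N \<inter> triangle. \<sigma> (barycentric q) \<in> fst c \<and> snd c (\<sigma> (barycentric q)) = h q))"

definition simplex_integral ::
    "('x, 'e::euclidean_space) chart set \<Rightarrow> (('x, 'e) chart \<Rightarrow> 'e \<Rightarrow> 'e \<Rightarrow> 'e \<Rightarrow> real) \<Rightarrow>
     ((nat \<Rightarrow> real) \<Rightarrow> 'x) \<Rightarrow> real" where
  "simplex_integral A \<eta> \<sigma> = integral (interior triangle) (\<lambda>p.
     let c = (SOME c. c \<in> A \<and> \<sigma> (barycentric p) \<in> fst c);
         h = snd c \<circ> \<sigma> \<circ> barycentric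
     in \<eta> c (h p) (frechet_derivative h (at p) (1, 0)) (frechet_derivative h (at p) (0, 1)))"

definition integral_class ::
    "('x::topological_space, 'e::euclidean_space) chart set \<Rightarrow>
     (('x, 'e) chart \<Rightarrow> 'e \<Rightarrow> 'e \<Rightarrow> 'e \<Rightarrow> real) \<Rightarrow> bool" where
  "integral_class A \<eta> \<longleftrightarrow> closed_form A \<eta> \<and>
     (\<forall>z. singular_chain 2 (euclidean :: 'x topology) z \<and> chain_boundary 2 z = 0 \<and>
          (\<forall>\<sigma>\<in>Poly_Mapping.keys z. smooth_2simplex A \<sigma>) \<longrightarrow>
        (\<Sum>\<sigma>\<in>Poly_Mapping.keys z. real_of_int (Poly_Mapping.lookup z \<sigma>) * simplex_integral A \<eta> \<sigma>) \<in> \<int>)"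


section \<open>Toric symplectic manifolds\<close>

type_synonym 'n coords = "(real^'n) \<times> (real^'n)"

text \<open>\<^item> \<open>action\<close> is the action of \<open>T = R\<^sup>n / (2\<pi>Z)\<^sup>n\<close>, lifted to \<open>R\<^sup>n\<close>;
  \<^item> \<open>Bl\<close> is the map \<open>P\<^sub>X \<times> T \<rightarrow> X\<close>, again lifted in the second argument, whose restriction to
    \<open>interior P\<^sub>X \<times> T\<close> gives the fixed action-angle coordinates; its values off \<open>P\<^sub>X\<close> are irrelevant;
  \<^item> \<open>normal F\<close> and \<open>lam F\<close> are \<open>\<nu>\<^sub>F\<close> and \<open>\<lambda>\<^sub>F\<close>, and \<open>adj v i\<close> is the i-th facet at the vertex \<open>v\<close>.\<close>

record ('x, 'n) toric_data =
  atlas :: "('x, 'n::finite coords) chart set"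
  symp :: "('x, 'n coords) chart \<Rightarrow> 'n coords \<Rightarrow> 'n coords \<Rightarrow> 'n coords \<Rightarrow> real"
  action :: "real^'n \<Rightarrow> 'x \<Rightarrow> 'x"
  moment :: "'x \<Rightarrow> real^'n"
  Bl :: "'n coords \<Rightarrow> 'x"
  normal :: "(real^'n) set \<Rightarrow> int^'n"
  lam :: "(real^'n) set \<Rightarrow> real"
  adj :: "real^'n \<Rightarrow> 'n \<Rightarrow> (real^'n) set"

definition rvec :: "int^'n \<Rightarrow> real^'n" where
  "rvec p = (\<chi> i. real_of_int (p $ i))"

definition torus_lattice :: "(real^'n) set" where
  "torus_lattice = {(2 * pi) *\<^sub>R rvec z | z. True}"

definition polytope_of :: "('x, 'n::finite) toric_data \<Rightarrow> (real^'n) set" where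
  "polytope_of M = range (moment M)"

definition facets :: "('x, 'n::finite) toric_data \<Rightarrow> (real^'n) set set" where
  "facets M = {F. F facet_of polytope_of M}"

definition vertices :: "('x, 'n::finite) toric_data \<Rightarrow> (real^'n) set" where
  "vertices M = {v. v extreme_point_of polytope_of M}"

definition vertex_star :: "('x, 'n::finite) toric_data \<Rightarrow> real^'n \<Rightarrow> (real^'n) set" where
  "vertex_star M v = (\<Union>F\<in>{F. F face_of polytope_of M \<and> v \<in> F}. rel_interior F)"

definition open_part :: "('x, 'n::finite) toric_data \<Rightarrow> 'x set" where
  "open_part M = moment M -` interior (polytope_of M)"

definition vertex_nbhd :: "('x, 'n::finite) toric_data \<Rightarrow> real^'n \<Rightarrow> 'x set" where
  "vertex_nbhd M v = moment M -` vertex_star M v"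

definition vertex_matrix_int :: "('x, 'n::finite) toric_data \<Rightarrow> real^'n \<Rightarrow> int^'n^'n" where
  "vertex_matrix_int M v = (\<chi> i. normal M (adj M v i))"

definition vertex_matrix :: "('x, 'n::finite) toric_data \<Rightarrow> real^'n \<Rightarrow> real^'n^'n" where
  "vertex_matrix M v = (\<chi> i. rvec (normal M (adj M v i)))"

definition vertex_x :: "('x, 'n::finite) toric_data \<Rightarrow> real^'n \<Rightarrow> real^'n \<Rightarrow> real^'n" where
  "vertex_x M v x = vertex_matrix M v *v x + (\<chi> i. lam M (adj M v i))"

definition vertex_theta :: "('x, 'n::finite) toric_data \<Rightarrow> real^'n \<Rightarrow> real^'n \<Rightarrow> real^'n" where
  "vertex_theta M v \<theta> = transpose (matrix_inv (vertex_matrix M v)) *v \<theta>"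

definition moment_polytope_data :: "('x, 'n::finite) toric_data \<Rightarrow> bool" where
  "moment_polytope_data M \<longleftrightarrow>
     polytope (polytope_of M) \<and>
     (\<forall>F\<in>facets M. Gcd (range (\<lambda>i. normal M F $ i)) = 1 \<and>
        F = {x \<in> polytope_of M. x \<bullet> rvec (normal M F) + lam M F = 0}) \<and>
     polytope_of M = {x. \<forall>F\<in>facets M. x \<bullet> rvec (normal M F) + lam M F \<ge> 0} \<and>
     (\<forall>v\<in>vertices M. bij_betw (adj M v) UNIV {F \<in> facets M. v \<in> F} \<and>
        invertible (vertex_matrix_int M v))"

definition torus_action :: "('x::topological_space, 'n::finite) toric_data \<Rightarrow> bool" where
  "torus_action M \<longleftrightarrow>
     (\<forall>q. action M 0 q = q) \<and>
     (\<forall>s t q. action M (s + t) q = action M s (action M t q)) \<and>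
     (\<forall>c\<in>atlas M. \<forall>d\<in>atlas M.
        let W = {(t, y). y \<in> chart_image c \<and> action M t (chart_inv c y) \<in> fst d}
        in open W \<and> smooth_on W (\<lambda>(t, y). snd d (action M t (chart_inv c y)))) \<and>
     (\<forall>t. (\<forall>q. action M t q = q) \<longleftrightarrow> t \<in> torus_lattice)"

text \<open>The sign of Hamilton's equation \<open>d\<langle>\<mu>, \<xi>\<rangle> = \<omega>(\<cdot>, \<xi>\<^sub>X)\<close> is the one that goes with
  \<open>\<omega> = \<Sum> dx\<^sup>i \<and> d\<theta>\<^sup>i\<close>, \<open>\<mu> = x\<close>.\<close>

definition moment_map :: "('x, 'n::finite) toric_data \<Rightarrow> bool" where
  "moment_map M \<longleftrightarrow>
     smooth_fun (atlas M) UNIV (moment M) \<and>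
     (\<forall>t q. moment M (action M t q) = moment M q) \<and>
     (\<forall>c\<in>atlas M. \<forall>q\<in>fst c. \<forall>\<xi> u.
        frechet_derivative (\<lambda>y. moment M (chart_inv c y) \<bullet> \<xi>) (at (snd c q)) u =
        symp M c (snd c q) u
          (vector_derivative (\<lambda>s. snd c (action M (s *\<^sub>R \<xi>) q)) (at 0)))"

text \<open>Action-angle coordinates \<open>(x, \<theta>)\<close> on \<open>open_part M\<close>: the map \<open>Bl\<close> restricts to an equivariant
  bijection \<open>interior P\<^sub>X \<times> T \<rightarrow> open_part M\<close> over \<open>P\<^sub>X\<close> whose local inverses are smooth charts, in
  which \<open>\<omega> = \<Sum> dx\<^sup>i \<and> d\<theta>\<^sup>i\<close>.\<close>

definition action_angle :: "('x::topological_space, 'n::finite) toric_data \<Rightarrow> bool" where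
  "action_angle M \<longleftrightarrow>
     Bl M ` (interior (polytope_of M) \<times> UNIV) = open_part M \<and>
     (\<forall>x\<in>interior (polytope_of M). \<forall>\<theta> \<theta>'. Bl M (x, \<theta>) = Bl M (x, \<theta>') \<longleftrightarrow> \<theta>' - \<theta> \<in> torus_lattice) \<and>
     (\<forall>x\<in>interior (polytope_of M). \<forall>\<theta> t. action M t (Bl M (x, \<theta>)) = Bl M (x, \<theta> + t)) \<and>
     (\<forall>z\<in>interior (polytope_of M) \<times> UNIV. \<exists>W. open W \<and> z \<in> W \<and>
        W \<subseteq> interior (polytope_of M) \<times> UNIV \<and> inj_on (Bl M) W \<and>
        smooth_chart (atlas M) (Bl M ` W, inv_into W (Bl M))) \<and>
     (\<forall>c\<in>atlas M. \<forall>z\<in>interior (polytope_of M) \<times> UNIV. Bl M z \<in> fst c \<longrightarrow>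
        (\<forall>u w. symp M c (snd c (Bl M z))
             (frechet_derivative (snd c \<circ> Bl M) (at z) u)
             (frechet_derivative (snd c \<circ> Bl M) (at z) w) = fst u \<bullet> snd w - fst w \<bullet> snd u))"

text \<open>\<open>Bl\<close> is continuous over all of \<open>P\<^sub>X\<close>, and near each vertex \<open>v\<close> the functions
  \<open>a\<^sub>v = \<surd>x\<^sub>v cos \<theta>\<^sub>v\<close>, \<open>b\<^sub>v = \<surd>x\<^sub>v sin \<theta>\<^sub>v\<close> extend to smooth coordinates on the whole of \<open>U\<^sub>v\<close>.\<close>

definition boundary_coordinates :: "('x::topological_space, 'n::finite) toric_data \<Rightarrow> bool" where
  "boundary_coordinates M \<longleftrightarrow>
     continuous_on (polytope_of M \<times> UNIV) (Bl M) \<and>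
     (\<forall>x\<in>polytope_of M. \<forall>\<theta>. moment M (Bl M (x, \<theta>)) = x) \<and>
     (\<forall>x\<in>polytope_of M. \<forall>\<theta>. \<forall>t\<in>torus_lattice. Bl M (x, \<theta> + t) = Bl M (x, \<theta>)) \<and>
     (\<forall>v\<in>vertices M. \<exists>\<zeta>. smooth_chart (atlas M) (vertex_nbhd M v, \<zeta>) \<and>
        (\<forall>x\<in>vertex_star M v. \<forall>\<theta>. \<zeta> (Bl M (x, \<theta>)) =
           ((\<chi> i. sqrt (vertex_x M v x $ i) * cos (vertex_theta M v \<theta> $ i)),
            (\<chi> i. sqrt (vertex_x M v x $ i) * sin (vertex_theta M v \<theta> $ i)))))"

definition toric_manifold :: "('x::t2_space, 'n::finite) toric_data \<Rightarrow> bool" where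
  "toric_manifold M \<longleftrightarrow>
     compact (UNIV :: 'x set) \<and> connected (UNIV :: 'x set) \<and>
     smooth_atlas (atlas M) \<and> symplectic_form (atlas M) (symp M) \<and>
     torus_action M \<and> moment_map M \<and> moment_polytope_data M \<and>
     action_angle M \<and> boundary_coordinates M"


section \<open>Standing assumptions\<close>

text \<open>\<open>[\<omega>/2\<pi>] - c\<^sub>1(X)/2 \<in> H\<^sup>2(X, Z)\<close>, where \<open>c\<^sub>1(X)\<close> is computed from any \<open>\<omega>\<close>-compatible almost
  complex structure.\<close>

definition half_form_integrality :: "('x::topological_space, 'n::finite) toric_data \<Rightarrow> bool" where
  "half_form_integrality M \<longleftrightarrow>
     (\<exists>J \<Gamma>. almost_complex (atlas M) J \<and> positive_11 (atlas M) J (symp M) \<and>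
        affine_connection (atlas M) \<Gamma> \<and> parallel_complex (atlas M) \<Gamma> J \<and>
        integral_class (atlas M)
          (\<lambda>c y u v. symp M c y u v / (2 * pi) - chern_form J \<Gamma> c y u v / 2))"

definition moment_normalized :: "('x, 'n::finite) toric_data \<Rightarrow> bool" where
  "moment_normalized M \<longleftrightarrow> (\<forall>F\<in>facets M. lam M F - 1 / 2 \<in> \<int>)"

definition hessian :: "(real^'n \<Rightarrow> real) \<Rightarrow> real^'n \<Rightarrow> real^'n^'n" where
  "hessian \<phi> x =
     (\<chi> i j. frechet_derivative (\<lambda>y. frechet_derivative \<phi> (at y) (axis j 1)) (at x) (axis i 1))"

text \<open>The complex structure with holomorphic coordinates \<open>d\<phi>/dx + i\<theta>\<close> on \<open>open_part M\<close>, that is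
  \<open>J(u, w) = (-G\<^sup>-\<^sup>1 w, G u)\<close> with \<open>G = Hess \<phi>\<close>, is required to extend smoothly to \<open>X\<close>. As
  \<open>open_part M\<close> is dense, the extension is unique, integrable and \<open>T\<close>-invariant.\<close>

definition toric_complex_structure ::
    "('x, 'n::finite) toric_data \<Rightarrow> (('x, 'n coords) chart \<Rightarrow> 'n coords \<Rightarrow> 'n coords \<Rightarrow> 'n coords) \<Rightarrow> bool" where
  "toric_complex_structure M J \<longleftrightarrow>
     almost_complex (atlas M) J \<and>
     (\<exists>\<phi>. smooth_on (interior (polytope_of M)) \<phi> \<and>
        (\<forall>x\<in>interior (polytope_of M). \<forall>u. u \<noteq> 0 \<longrightarrow> u \<bullet> (hessian \<phi> x *v u) > 0) \<and>
        (\<forall>c\<in>atlas M. \<forall>x\<in>interior (polytope_of M). \<forall>\<theta>. Bl M (x, \<theta>) \<in> fst c \<longrightarrow>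
           (\<forall>u w. J c (snd c (Bl M (x, \<theta>)))
                 (frechet_derivative (snd c \<circ> Bl M) (at (x, \<theta>)) (u, w)) =
               frechet_derivative (snd c \<circ> Bl M) (at (x, \<theta>))
                 (- (matrix_inv (hessian \<phi> x) *v w), hessian \<phi> x *v u))))"

text \<open>\<open>k[\<omega>/2\<pi>] - c\<^sub>1(X)/2\<close> contains a positive (1,1)-form.\<close>

definition positive_class_at ::
    "('x, 'n::finite) toric_data \<Rightarrow> (('x, 'n coords) chart \<Rightarrow> 'n coords \<Rightarrow> 'n coords \<Rightarrow> 'n coords) \<Rightarrow>
     nat \<Rightarrow> bool" where
  "positive_class_at M J k \<longleftrightarrow>
     (\<exists>\<Gamma> \<kappa>. affine_connection (atlas M) \<Gamma> \<and> parallel_complex (atlas M) \<Gamma> J \<and>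
        closed_form (atlas M) \<kappa> \<and> positive_11 (atlas M) J \<kappa> \<and>
        cohomologous (atlas M) \<kappa>
          (\<lambda>c y u v. real k * symp M c y u v / (2 * pi) - chern_form J \<Gamma> c y u v / 2))"

definition positive_from :: "('x, 'n::finite) toric_data \<Rightarrow> nat \<Rightarrow> bool" where
  "positive_from M k0 \<longleftrightarrow>
     (\<exists>J. toric_complex_structure M J \<and> (\<forall>k\<ge>k0. positive_class_at M J k))"


section \<open>Fibrewise Fourier coefficients and the truncated star product\<close>

definition fourier_coeff ::
    "('x, 'n::finite) toric_data \<Rightarrow> ('x \<Rightarrow> complex) \<Rightarrow> int^'n \<Rightarrow> real^'n \<Rightarrow> complex" where
  "fourier_coeff M f p x =
     (1 / (2 * pi) ^ CARD('n)) *
     integral (cbox 0 (\<chi> i. 2 * pi)) (\<lambda>\<theta>. f (Bl M (x, \<theta>)) * exp (- \<i> * of_real (rvec p \<bullet> \<theta>)))"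

definition smooth_le :: "('x, 'n::finite) toric_data \<Rightarrow> nat \<Rightarrow> ('x \<Rightarrow> complex) set" where
  "smooth_le M l = {f. smooth_fun (atlas M) UNIV f \<and>
     (\<forall>p. (MAX i. \<bar>p $ i\<bar>) > int l \<longrightarrow> (\<forall>x\<in>polytope_of M. fourier_coeff M f p x = 0))}"

definition smooth_finite :: "('x, 'n::finite) toric_data \<Rightarrow> ('x \<Rightarrow> complex) set" where
  "smooth_finite M = (\<Union>l. smooth_le M l)"

definition angle :: "('x, 'n::finite) toric_data \<Rightarrow> 'x \<Rightarrow> real^'n" where
  "angle M q = (SOME \<theta>. Bl M (moment M q, \<theta>) = q)"

text \<open>\<open>\<partial>\<^sup>I\<close> along the directions \<open>e i\<close>. The derivatives are taken in an arbitrary fixed order of the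
  indices, which is immaterial for smooth functions.\<close>

definition multi_partial ::
    "('n::finite \<Rightarrow> 'e::real_normed_vector) \<Rightarrow> ('n \<Rightarrow> nat) \<Rightarrow> ('e \<Rightarrow> complex) \<Rightarrow> 'e \<Rightarrow> complex" where
  "multi_partial e I F =
     foldr (\<lambda>i. (\<lambda>H z. frechet_derivative H (at z) (e i)) ^^ I i)
       (SOME is. distinct is \<and> set is = UNIV) F"

text \<open>Functions on \<open>open_part M\<close> are functions on \<open>'x\<close> whose values elsewhere are irrelevant.\<close>

definition star_coeff ::
    "('x, 'n::finite) toric_data \<Rightarrow> nat \<Rightarrow> ('x \<Rightarrow> complex) \<Rightarrow> ('x \<Rightarrow> complex) \<Rightarrow> 'x \<Rightarrow> complex" where
  "star_coeff M r f g q =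
     (1 / \<i> ^ r) * (\<Sum>I\<in>{I :: 'n \<Rightarrow> nat. (\<Sum>i\<in>UNIV. I i) = r}.
        (1 / (\<Prod>i\<in>UNIV. fact (I i))) *
        multi_partial (\<lambda>i. (axis i 1, 0)) I (f \<circ> Bl M) (moment M q, angle M q) *
        multi_partial (\<lambda>i. (0, axis i 1)) I (g \<circ> Bl M) (moment M q, angle M q))"

definition star_product ::
    "('x, 'n::finite) toric_data \<Rightarrow> real \<Rightarrow> nat \<Rightarrow> ('x \<Rightarrow> complex) \<Rightarrow> ('x \<Rightarrow> complex) \<Rightarrow> 'x \<Rightarrow> complex" where
  "star_product M h N f g q = (\<Sum>r\<le>N. of_real h ^ r * star_coeff M r f g q)"


section \<open>The line bundle and its sections\<close>

definition lamL :: "('x, 'n::finite) toric_data \<Rightarrow> nat \<Rightarrow> (real^'n) set \<Rightarrow> real" where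
  "lamL M k F = real k * lam M F - 1 / 2"

text \<open>\<open>\<lambda>\<^sub>v \<cdot> \<theta>\<^sub>v\<close>, so that the unitary frames satisfy \<open>1\<^sub>v = exp(-i vertex_phase) 1\<^sub>\<circ>\<close>.\<close>

definition vertex_phase ::
    "('x, 'n::finite) toric_data \<Rightarrow> nat \<Rightarrow> real^'n \<Rightarrow> real^'n \<Rightarrow> real" where
  "vertex_phase M k v \<theta> = (\<chi> i. lamL M k (adj M v i)) \<bullet> vertex_theta M v \<theta>"

text \<open>Frames are indexed by \<^term>\<open>None\<close> (the frame over \<open>open_part M\<close>) and by \<^term>\<open>Some v\<close> for vertices
  \<open>v\<close>. A section over \<open>U\<close> is the family of its coefficients in these frames, extended by zero. The
  relations between the frames of two vertices follow from those below, as \<open>open_part M\<close> is dense.\<close>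

type_synonym ('x, 'n) lsection = "(real^'n) option \<Rightarrow> 'x \<Rightarrow> complex"

definition frame_domain :: "('x, 'n::finite) toric_data \<Rightarrow> (real^'n) option \<Rightarrow> 'x set" where
  "frame_domain M a =
     (case a of None \<Rightarrow> open_part M | Some v \<Rightarrow> if v \<in> vertices M then vertex_nbhd M v else {})"

definition sections_L ::
    "('x, 'n::finite) toric_data \<Rightarrow> nat \<Rightarrow> 'x set \<Rightarrow> ('x, 'n) lsection set" where
  "sections_L M k U = {\<tau>.
     (\<forall>a. smooth_fun (atlas M) (U \<inter> frame_domain M a) (\<tau> a) \<and>
          (\<forall>q. q \<notin> U \<inter> frame_domain M a \<longrightarrow> \<tau> a q = 0)) \<and>
     (\<forall>v\<in>vertices M. \<forall>x\<in>interior (polytope_of M). \<forall>\<theta>. Bl M (x, \<theta>) \<in> U \<longrightarrow>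
        \<tau> None (Bl M (x, \<theta>)) = cis (- vertex_phase M k v \<theta>) * \<tau> (Some v) (Bl M (x, \<theta>)))}"

definition conj_section :: "('x, 'n) lsection \<Rightarrow> ('x, 'n::finite) lsection" where
  "conj_section \<tau> = (\<lambda>a q. cnj (\<tau> a q))"

definition sections_Lbar ::
    "('x, 'n::finite) toric_data \<Rightarrow> nat \<Rightarrow> 'x set \<Rightarrow> ('x, 'n) lsection set" where
  "sections_Lbar M k U = conj_section ` sections_L M k U"

text \<open>The section \<open>h 1\<^sub>\<circ>\<close> over \<open>open_part M\<close>.\<close>

definition frame_section ::
    "('x, 'n::finite) toric_data \<Rightarrow> nat \<Rightarrow> ('x \<Rightarrow> complex) \<Rightarrow> ('x, 'n) lsection" where
  "frame_section M k h = (\<lambda>a q. if q \<in> open_part M \<inter> frame_domain M a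
     then (case a of None \<Rightarrow> h q | Some v \<Rightarrow> cis (vertex_phase M k v (angle M q)) * h q) else 0)"


section \<open>Quantum states and Toeplitz operators\<close>

text \<open>Distributional sections over \<open>open_part M\<close> are functionals on
  \<^term>\<open>sections_Lbar M k (open_part M)\<close>, set to zero off this space. The formal half-forms
  \<open>\<surd>|d\<^sup>nx|\<close>, \<open>\<surd>|d\<^sup>n\<theta>|\<close> are not represented; they only contribute the factor in \<open>hf_pairing\<close>.\<close>

type_synonym ('x, 'n) distribution = "('x, 'n) lsection \<Rightarrow> complex"

definition hf_pairing :: "nat \<Rightarrow> ('x, 'n) distribution \<Rightarrow> ('x, 'n::finite) lsection \<Rightarrow> complex" where
  "hf_pairing k s \<tau> = of_real ((2 * real k) powr (- real CARD('n) / 2)) * s (conj_section \<tau>)"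

definition delta ::
    "('x, 'n::finite) toric_data \<Rightarrow> nat \<Rightarrow> int^'n \<Rightarrow> ('x, 'n) distribution" where
  "delta M k m \<rho> = (if \<rho> \<in> sections_Lbar M k (open_part M)
     then (1 / (2 * pi) ^ CARD('n)) *
       integral (cbox 0 (\<chi> i. 2 * pi))
         (\<lambda>\<theta>. exp (\<i> * of_real (rvec m \<bullet> \<theta>)) * \<rho> None (Bl M ((1 / real k) *\<^sub>R rvec m, \<theta>)))
     else 0)"

definition Lambda :: "('x, 'n::finite) toric_data \<Rightarrow> nat \<Rightarrow> (int^'n) set" where
  "Lambda M k = {m. \<forall>F\<in>facets M. rvec m \<bullet> rvec (normal M F) + lamL M k F \<ge> 0}"

definition sigma ::
    "('x, 'n::finite) toric_data \<Rightarrow> nat \<Rightarrow> int^'n \<Rightarrow> ('x, 'n) distribution" where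
  "sigma M k m \<rho> = of_real ((4 * pi) powr (real CARD('n) / 4)) * delta M k m \<rho>"

definition sigma_check ::
    "('x, 'n::finite) toric_data \<Rightarrow> nat \<Rightarrow> int^'n \<Rightarrow> ('x, 'n) lsection" where
  "sigma_check M k m = frame_section M k (\<lambda>q.
     of_real (real k powr (real CARD('n) / 2) / pi powr (real CARD('n) / 4)) *
     exp (\<i> * of_real (rvec m \<bullet> angle M q)))"

text \<open>The span of the \<open>sigma m\<close> with \<open>m\<close> in a set of lattice points; the quantum Hilbert space is
  \<open>states_on M k (Lambda M k)\<close>.\<close>

definition states_on ::
    "('x, 'n::finite) toric_data \<Rightarrow> nat \<Rightarrow> (int^'n) set \<Rightarrow> ('x, 'n) distribution set" where
  "states_on M k S = {\<lambda>\<rho>. \<Sum>m\<in>S. b m * sigma M k m \<rho> | b. True}"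

definition local_space ::
    "('x, 'n::finite) toric_data \<Rightarrow> nat \<Rightarrow> (real^'n) set \<Rightarrow> ('x, 'n) distribution set" where
  "local_space M k V = states_on M k {m \<in> Lambda M k. rvec m \<in> (\<lambda>x. real k *\<^sub>R x) ` V}"

text \<open>The norm for which the \<open>sigma m\<close>, \<open>m \<in> Lambda\<close>, are orthonormal.\<close>

definition sigma_coord ::
    "('x, 'n::finite) toric_data \<Rightarrow> nat \<Rightarrow> ('x, 'n) distribution \<Rightarrow> int^'n \<Rightarrow> complex" where
  "sigma_coord M k s = (THE b. (\<forall>m. m \<notin> Lambda M k \<longrightarrow> b m = 0) \<and>
     s = (\<lambda>\<rho>. \<Sum>m\<in>Lambda M k. b m * sigma M k m \<rho>))"

definition state_norm :: "('x, 'n::finite) toric_data \<Rightarrow> nat \<Rightarrow> ('x, 'n) distribution \<Rightarrow> real" where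
  "state_norm M k s = sqrt (\<Sum>m\<in>Lambda M k. (cmod (sigma_coord M k s m))\<^sup>2)"

definition projection ::
    "('x, 'n::finite) toric_data \<Rightarrow> nat \<Rightarrow> ('x, 'n) distribution \<Rightarrow> ('x, 'n) distribution" where
  "projection M k s = (\<lambda>\<rho>. \<Sum>m\<in>Lambda M k. hf_pairing k s (sigma_check M k m) * sigma M k m \<rho>)"

definition fun_times ::
    "('x, 'n::finite) toric_data \<Rightarrow> nat \<Rightarrow> ('x \<Rightarrow> complex) \<Rightarrow> ('x, 'n) distribution \<Rightarrow> ('x, 'n) distribution" where
  "fun_times M k f s = (\<lambda>\<rho>. if \<rho> \<in> sections_Lbar M k (open_part M)
     then s (\<lambda>a q. f q * \<rho> a q) else 0)"

definition toeplitz ::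
    "('x, 'n::finite) toric_data \<Rightarrow> nat \<Rightarrow> ('x \<Rightarrow> complex) \<Rightarrow> ('x, 'n) distribution \<Rightarrow> ('x, 'n) distribution" where
  "toeplitz M k f s = projection M k (fun_times M k f s)"

definition local_opnorm ::
    "('x, 'n::finite) toric_data \<Rightarrow> nat \<Rightarrow> (real^'n) set \<Rightarrow>
     (('x, 'n) distribution \<Rightarrow> ('x, 'n) distribution) \<Rightarrow> real" where
  "local_opnorm M k V A =
     Sup {state_norm M k (A s) | s. s \<in> local_space M k V \<and> state_norm M k s \<le> 1}"

end

theory Submission
  imports Defs
begin

text \<open>In action-angle coordinates \<open>\<delta>\<^sup>m\<close> lives on the torus fibre over \<open>\<hbar>m\<close>, and on it multiplication by
  \<open>f\<close> is convolution with the fibrewise Fourier coefficients of \<open>f\<close>. The normalizing constants of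
  the two half-form pairings cancel, so that
  \<open>Q\<^sub>f \<sigma>\<^sup>m = \<Sum>\<^sub>m\<^sub>' f\<^sub>m\<^sub>'\<^sub>-\<^sub>m(\<hbar>m) \<sigma>\<^sup>m\<^sup>'\<close> exactly, without any asymptotics (\<open>toeplitz_sum\<close>). This uses
  that the functions to be paired are sections of the line bundle, hence that smoothness on the
  manifold and smoothness in the coordinates agree over the open orbit (\<open>torus_smooth_pullback\<close>,
  \<open>smooth_fun_open_part\<close>), and that the frames over the vertices are well defined, which is where
  the parity of \<open>k\<close> enters (\<open>lamL_integer\<close>).

  Composing two such matrices evaluates the coefficients of \<open>f\<close> at \<open>\<hbar>m + \<hbar>p\<close>, where \<open>p\<close> is a
  mode of \<open>g\<close>: the entry at \<open>(m', m)\<close> with \<open>m' - m = s\<close> is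
  \<open>\<Sum>\<^sub>p g\<^sub>p(x) f\<^sub>s\<^sub>-\<^sub>p(x + \<hbar>p)\<close> at \<open>x = \<hbar>m\<close>. Expanding the
  second factor in powers of \<open>\<hbar>p\<close> produces \<open>\<hbar>\<^sup>|\<^sup>I\<^sup>|p\<^sup>I/I! (\<partial>\<^sub>x\<^sup>If)\<^sub>s\<^sub>-\<^sub>p\<close>, and since \<open>\<partial>\<^sub>\<theta>\<^sup>I\<close> acts on the mode \<open>p\<close>
  as \<open>(\<i>p)\<^sup>I\<close>, the Taylor polynomial of order \<open>N\<close> is the Fourier coefficient of \<open>f \<star>\<^sub>N g\<close>
  (\<open>slice_coeff_star\<close>). Here \<open>g\<close> has to be the sum of its finitely many modes, which is the
  uniqueness theorem for Fourier coefficients (\<open>torus_coeff_eq_0_imp_eq_0\<close>, \<open>trig_expansion\<close>). What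
  remains is the Taylor remainder, of order \<open>\<hbar>\<^sup>N\<^sup>+\<^sup>1\<close> (\<open>star_remainder_bound\<close>).

  A bound for single entries does not yet bound the operator norm uniformly in \<open>k\<close>, because the
  number of lattice points grows like \<open>k\<^sup>n\<close>. But the remainder is itself a Fourier coefficient of a
  derivative of \<open>f\<close>, and these decay in \<open>s\<close> at least as fast as a summable weight, uniformly over compact
  subsets of the open polytope (\<open>torus_coeff_decay\<close>). The entries are therefore dominated by a
  summable convolution kernel times \<open>\<hbar>\<^sup>N\<^sup>+\<^sup>1\<close>, and the Schur test gives the estimate
  (\<open>schur_test\<close>, \<open>toeplitz_composition_bound\<close>). The threshold \<open>\<delta>\<close> only has to keep \<open>\<hbar>(m + p)\<close> in
  such a compact set, and away from the boundary far enough for \<open>m + p\<close> to be in \<open>\<Lambda>\<^sub>\<hbar>\<close>; this does not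
  involve \<open>N\<close>.\<close>

section \<open>Calculus of smooth maps on open sets\<close>

text \<open>Allows charts to be changed from point to point; both continuity and the existence of
  derivatives are local.\<close>

lemma Ck_on_locally:
  assumes "\<And>x. x \<in> S \<Longrightarrow> \<exists>U. open U \<and> x \<in> U \<and> Ck_on r U f"
  shows "Ck_on r S f"
  using assms
proof (induction r arbitrary: f)
  case 0
  have "continuous (at x) f" if "x \<in> S" for x
    using 0[OF that] by (auto simp: continuous_on_eq_continuous_at)
  then show ?case by (simp add: continuous_at_imp_continuous_on)
next
  case (Suc r)
  have "f differentiable (at x)" if "x \<in> S" for x
    using Suc.prems[OF that] by auto
  moreover have "Ck_on r S (\<lambda>x. frechet_derivative f (at x) v)" for v
  proof (rule Suc.IH)
    fix x assume "x \<in> S"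
    from Suc.prems[OF this] show "\<exists>U. open U \<and> x \<in> U \<and> Ck_on r U (\<lambda>x. frechet_derivative f (at x) v)"
      by auto
  qed
  ultimately show ?case by simp
qed

lemma Ck_on_cong:
  assumes "open S" "\<And>x. x \<in> S \<Longrightarrow> f x = g x" "Ck_on r S f"
  shows "Ck_on r S g"
  using assms(2,3)
proof (induction r arbitrary: f g)
  case 0
  then show ?case using continuous_on_cong by fastforce
next
  case (Suc r)
  have d: "(g has_derivative frechet_derivative f (at x)) (at x)" if "x \<in> S" for x
    using Suc.prems that assms(1)
    by (metis Ck_on.simps(2) frechet_derivative_works has_derivative_transform_within_open)
  have e: "frechet_derivative f (at x) = frechet_derivative g (at x)" if "x \<in> S" for x
    using d[OF that] by (rule frechet_derivative_at)
  have "Ck_on r S (\<lambda>x. frechet_derivative g (at x) v)" for v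
    by (rule Suc.IH[of "\<lambda>x. frechet_derivative f (at x) v"]) (use Suc.prems e in auto)
  then show ?case using d by (auto simp: differentiable_def)
qed

lemma Ck_on_Suc_imp: "Ck_on (Suc r) S f \<Longrightarrow> Ck_on r S f"
proof (induction r arbitrary: f)
  case 0
  then show ?case
    by (auto intro!: continuous_at_imp_continuous_on differentiable_imp_continuous_within)
next
  case (Suc r)
  then have "f differentiable (at x)" if "x \<in> S" for x using that by simp
  moreover have "Ck_on r S (\<lambda>x. frechet_derivative f (at x) v)" for v
    by (rule Suc.IH) (use Suc.prems in simp)
  ultimately show ?case by simp
qed

text \<open>In this form the regularity of a combination of maps follows by induction on \<open>r\<close> from the
  formula for its derivative, without a rewriting of the term for the Frechet derivative.\<close>

lemma Ck_on_SucI: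
  assumes "open S" "\<And>x. x \<in> S \<Longrightarrow> (f has_derivative f' x) (at x)"
    and "\<And>v. Ck_on r S (\<lambda>x. f' x v)"
  shows "Ck_on (Suc r) S f"
proof -
  have e: "f' x = frechet_derivative f (at x)" if "x \<in> S" for x
    using assms(2)[OF that] by (rule frechet_derivative_at)
  have "Ck_on r S (\<lambda>x. frechet_derivative f (at x) v)" for v
    by (rule Ck_on_cong[OF assms(1) _ assms(3)[of v]]) (simp add: e)
  then show ?thesis using assms(2) by (auto simp: differentiable_def)
qed

lemma Ck_on_has_derivative:
  "Ck_on (Suc r) S f \<Longrightarrow> x \<in> S \<Longrightarrow> (f has_derivative frechet_derivative f (at x)) (at x)"
  using frechet_derivative_works by auto

lemma Ck_on_const: "open S \<Longrightarrow> Ck_on r S (\<lambda>x. c)"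
  by (induction r arbitrary: c) (simp_all add: frechet_derivative_const)

lemma Ck_on_add:
  assumes "open S" "Ck_on r S f" "Ck_on r S g"
  shows "Ck_on r S (\<lambda>x. f x + g x)"
  using assms(2,3)
proof (induction r arbitrary: f g)
  case 0
  then show ?case by (auto intro: continuous_intros)
next
  case (Suc r)
  show ?case
    by (rule Ck_on_SucI[OF assms(1), where f' = "\<lambda>x v. frechet_derivative f (at x) v + frechet_derivative g (at x) v"])
       (use Suc in \<open>auto intro!: has_derivative_add Ck_on_has_derivative\<close>)
qed

lemma Ck_on_sum:
  assumes "open S" "\<And>i. i \<in> A \<Longrightarrow> Ck_on r S (f i)"
  shows "Ck_on r S (\<lambda>x. \<Sum>i\<in>A. f i x)"
  using assms(2)
  by (induction A rule: infinite_finite_induct) (auto intro: Ck_on_const Ck_on_add assms(1))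

lemma Ck_on_bilinear:
  assumes "open S" "bounded_bilinear P" "Ck_on r S f" "Ck_on r S g"
  shows "Ck_on r S (\<lambda>x. P (f x) (g x))"
  using assms(3,4)
proof (induction r arbitrary: f g)
  case 0
  then show ?case using assms(2) by (auto intro: bounded_bilinear.continuous_on)
next
  case (Suc r)
  show ?case
  proof (rule Ck_on_SucI[OF assms(1)])
    show "((\<lambda>x. P (f x) (g x)) has_derivative
        (\<lambda>v. P (f x) (frechet_derivative g (at x) v) + P (frechet_derivative f (at x) v) (g x))) (at x)"
      if "x \<in> S" for x
      by (rule bounded_bilinear.FDERIV[OF assms(2) Ck_on_has_derivative[OF Suc.prems(1) that]
            Ck_on_has_derivative[OF Suc.prems(2) that]])
    show "Ck_on r S (\<lambda>x. P (f x) (frechet_derivative g (at x) v) + P (frechet_derivative f (at x) v) (g x))" for v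
      using Suc.prems Suc.prems[THEN Ck_on_Suc_imp] by (intro Ck_on_add[OF assms(1)] Suc.IH) auto
  qed
qed

lemma Ck_on_bounded_linear:
  assumes "open S" "bounded_linear L" "Ck_on r S f"
  shows "Ck_on r S (\<lambda>x. L (f x))"
  using assms(3)
proof (induction r arbitrary: f)
  case 0
  then show ?case using assms(2) by (auto intro: bounded_linear.continuous_on)
next
  case (Suc r)
  show ?case
    by (rule Ck_on_SucI[OF assms(1), where f' = "\<lambda>x v. L (frechet_derivative f (at x) v)"])
       (use Suc in \<open>auto intro!: bounded_linear.has_derivative[OF assms(2)] Ck_on_has_derivative\<close>)
qed

text \<open>The chain rule writes the derivative of a composition through the partial derivatives of the
  outer map, which are again compositions of lower regularity.\<close>

lemma Ck_on_compose:
  fixes f :: "'e::euclidean_space \<Rightarrow> 'b::real_normed_vector"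
  assumes "open S" "Ck_on r T f" "Ck_on r S \<phi>" "\<phi> ` S \<subseteq> T"
  shows "Ck_on r S (\<lambda>x. f (\<phi> x))"
  using assms(2,3)
proof (induction r arbitrary: f)
  case 0
  then show ?case using assms(4) by (auto intro: continuous_on_compose2)
next
  case (Suc r)
  let ?f' = "\<lambda>x v. frechet_derivative f (at (\<phi> x)) (frechet_derivative \<phi> (at x) v)"
  show ?case
  proof (rule Ck_on_SucI[OF assms(1)])
    show "((\<lambda>x. f (\<phi> x)) has_derivative ?f' x) (at x)" if "x \<in> S" for x
      using diff_chain_at[OF Ck_on_has_derivative[OF Suc.prems(2) that]
          Ck_on_has_derivative[OF Suc.prems(1), of "\<phi> x"]] assms(4) that
      by (auto simp: o_def)
    fix v
    let ?g = "\<lambda>x. \<Sum>b\<in>Basis. (frechet_derivative \<phi> (at x) v \<bullet> b) *\<^sub>R frechet_derivative f (at (\<phi> x)) b"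
    have smooth: "Ck_on r S ?g"
    proof (intro Ck_on_sum Ck_on_bilinear[OF _ bounded_bilinear_scaleR]
        Ck_on_bounded_linear[OF _ bounded_linear_inner_left] assms(1))
      show "Ck_on r S (\<lambda>x. frechet_derivative \<phi> (at x) v)" using Suc.prems by simp
      show "Ck_on r S (\<lambda>x. frechet_derivative f (at (\<phi> x)) b)" for b
        by (rule Suc.IH) (use Suc.prems Ck_on_Suc_imp in auto)
    qed
    have eq: "?g x = ?f' x v" if "x \<in> S" for x
    proof -
      have "linear (frechet_derivative f (at (\<phi> x)))"
        using Suc.prems assms(4) that by (intro linear_frechet_derivative) auto
      then have "frechet_derivative f (at (\<phi> x)) (\<Sum>b\<in>Basis. (w \<bullet> b) *\<^sub>R b)
          = (\<Sum>b\<in>Basis. (w \<bullet> b) *\<^sub>R frechet_derivative f (at (\<phi> x)) b)" for w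
        by (simp add: linear_sum linear_scale)
      from this[of "frechet_derivative \<phi> (at x) v"] show ?thesis
        unfolding euclidean_representation by simp
    qed
    show "Ck_on r S (\<lambda>x. ?f' x v)"
      by (rule Ck_on_cong[OF assms(1) eq smooth])
  qed
qed

lemma Ck_on_exp:
  fixes L :: "'a::real_normed_vector \<Rightarrow> complex"
  assumes "open S" "bounded_linear L"
  shows "Ck_on r S (\<lambda>x. c * exp (L x))"
proof (induction r arbitrary: c)
  case 0
  have "continuous_on S L" using assms(2) by (rule linear_continuous_on)
  then show ?case unfolding Ck_on.simps by (intro continuous_on_mult_left continuous_on_exp)
next
  case (Suc r)
  show ?case
  proof (rule Ck_on_SucI[OF assms(1)])
    show "((\<lambda>x. c * exp (L x)) has_derivative (\<lambda>v. (c * L v) * exp (L x))) (at x)" for x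
    proof -
      have "(exp has_derivative (\<lambda>w. w * exp (L x))) (at (L x))"
        using DERIV_exp[of "L x"] by (simp add: has_field_derivative_def mult_commute_abs)
      from has_derivative_compose[OF bounded_linear_imp_has_derivative[OF assms(2), of "at x"] this]
      show ?thesis using has_derivative_mult_right by (fastforce simp: mult.assoc)
    qed
    show "Ck_on r S (\<lambda>x. (c * L v) * exp (L x))" for v by (rule Suc.IH)
  qed
qed

lemma smooth_on_cong: "open S \<Longrightarrow> (\<And>x. x \<in> S \<Longrightarrow> f x = g x) \<Longrightarrow> smooth_on S f \<Longrightarrow> smooth_on S g"
  unfolding smooth_on_def using Ck_on_cong by blast

lemma smooth_on_locally:
  "(\<And>x. x \<in> S \<Longrightarrow> \<exists>U. open U \<and> x \<in> U \<and> smooth_on U f) \<Longrightarrow> smooth_on S f"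
  unfolding smooth_on_def by (metis Ck_on_locally)

lemma smooth_on_const: "open S \<Longrightarrow> smooth_on S (\<lambda>x. c)"
  by (simp add: smooth_on_def Ck_on_const)

lemma smooth_on_add: "open S \<Longrightarrow> smooth_on S f \<Longrightarrow> smooth_on S g \<Longrightarrow> smooth_on S (\<lambda>x. f x + g x)"
  by (simp add: smooth_on_def Ck_on_add)

lemma smooth_on_sum: "open S \<Longrightarrow> (\<And>i. i \<in> A \<Longrightarrow> smooth_on S (f i)) \<Longrightarrow> smooth_on S (\<lambda>x. \<Sum>i\<in>A. f i x)"
  by (simp add: smooth_on_def Ck_on_sum)

lemma smooth_on_mult:
  fixes f g :: "'a::real_normed_vector \<Rightarrow> complex"
  shows "open S \<Longrightarrow> smooth_on S f \<Longrightarrow> smooth_on S g \<Longrightarrow> smooth_on S (\<lambda>x. f x * g x)"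
  by (simp add: smooth_on_def Ck_on_bilinear[OF _ bounded_bilinear_mult])

lemma smooth_on_minus:
  fixes f g :: "'a::real_normed_vector \<Rightarrow> complex"
  assumes "open S" "smooth_on S f" "smooth_on S g"
  shows "smooth_on S (\<lambda>x. f x - g x)"
  using smooth_on_add[OF assms(1,2) smooth_on_mult[OF assms(1) smooth_on_const[OF assms(1), of "-1"] assms(3)]]
  by simp

lemma smooth_on_cnj: "open S \<Longrightarrow> smooth_on S f \<Longrightarrow> smooth_on S (\<lambda>x. cnj (f x))"
  by (simp add: smooth_on_def Ck_on_bounded_linear[OF _ bounded_linear_cnj])

lemma smooth_on_compose:
  fixes f :: "'e::euclidean_space \<Rightarrow> 'b::real_normed_vector"
  shows "open S \<Longrightarrow> smooth_on T f \<Longrightarrow> smooth_on S \<phi> \<Longrightarrow> \<phi> ` S \<subseteq> T \<Longrightarrow> smooth_on S (\<lambda>x. f (\<phi> x))"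
  unfolding smooth_on_def using Ck_on_compose by blast

lemma smooth_on_exp:
  fixes L :: "'a::real_normed_vector \<Rightarrow> complex"
  shows "open S \<Longrightarrow> bounded_linear L \<Longrightarrow> smooth_on S (\<lambda>x. exp (L x))"
  using Ck_on_exp[of S L _ 1] by (simp add: smooth_on_def)

lemma smooth_on_frechet_derivative:
  assumes "smooth_on S f"
  shows "smooth_on S (\<lambda>x. frechet_derivative f (at x) v)"
  unfolding smooth_on_def
proof
  fix r show "Ck_on r S (\<lambda>x. frechet_derivative f (at x) v)"
    using assms[unfolded smooth_on_def, rule_format, of "Suc r"] by simp
qed

lemma smooth_on_has_derivative:
  "smooth_on S f \<Longrightarrow> x \<in> S \<Longrightarrow> (f has_derivative frechet_derivative f (at x)) (at x)"
  unfolding smooth_on_def using Ck_on_has_derivative by blast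

lemma smooth_on_imp_continuous_on: "smooth_on S f \<Longrightarrow> continuous_on S f"
  unfolding smooth_on_def by (metis Ck_on.simps(1))

section \<open>Fourier coefficients on the torus\<close>

definition torus_box :: "(real^'n) set" where
  "torus_box = cbox 0 (\<chi> i. 2 * pi)"

definition character :: "int^'n \<Rightarrow> real^'n \<Rightarrow> complex" where
  "character p \<theta> = exp (\<i> * of_real (rvec p \<bullet> \<theta>))"

definition torus_coeff :: "(real^'n \<Rightarrow> complex) \<Rightarrow> int^'n \<Rightarrow> complex" where
  "torus_coeff u p =
     (1 / (2 * pi) ^ CARD('n)) * integral torus_box (\<lambda>\<theta>. u \<theta> * character (- p) \<theta>)"

definition periodic :: "(real^'n \<Rightarrow> complex) \<Rightarrow> bool" where
  "periodic u \<longleftrightarrow> (\<forall>\<theta>. \<forall>t\<in>torus_lattice. u (\<theta> + t) = u \<theta>)"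

lemma rvec_add: "rvec (p + q) = rvec p + rvec q"
  and rvec_uminus: "rvec (- p) = - rvec p"
  and rvec_0 [simp]: "rvec 0 = 0"
  by (simp_all add: rvec_def vec_eq_iff)

lemma rvec_nth [simp]: "rvec p $ i = of_int (p $ i)"
  by (simp add: rvec_def)

lemma rvec_inner: "rvec p \<bullet> \<theta> = (\<Sum>i\<in>UNIV. of_int (p $ i) * \<theta> $ i)"
  by (simp add: inner_vec_def)

lemma norm_character [simp]: "cmod (character p \<theta>) = 1"
  by (simp add: character_def)

lemma character_add: "character (p + q) \<theta> = character p \<theta> * character q \<theta>"
  by (simp add: character_def rvec_add inner_add_left distrib_left exp_add)

lemma character_0 [simp]: "character 0 \<theta> = 1"
  by (simp add: character_def)

lemma continuous_on_character: "continuous_on S (character p)"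
  unfolding character_def by (intro continuous_intros)

lemma periodic_character: "periodic (character (p :: int^'n))"
  unfolding periodic_def
proof (intro allI ballI)
  fix \<theta> t :: "real^'n" assume "t \<in> torus_lattice"
  then obtain z where t: "t = (2 * pi) *\<^sub>R rvec z" by (auto simp: torus_lattice_def)
  define N where "N = (\<Sum>i\<in>UNIV. p $ i * z $ i)"
  have "rvec p \<bullet> t = 2 * pi * of_int N"
    by (simp add: t N_def rvec_inner sum_distrib_left)
  then have "exp (\<i> * of_real (rvec p \<bullet> t)) = cis (2 * pi * of_int N)"
    by (simp only: cis_conv_exp)
  also have "\<dots> = 1" by (rule cis_multiple_2pi) simp
  finally show "character p (\<theta> + t) = character p \<theta>"
    by (simp add: character_def inner_add_right distrib_left exp_add)
qed

lemma periodic_mult: "periodic u \<Longrightarrow> periodic v \<Longrightarrow> periodic (\<lambda>\<theta>. u \<theta> * v \<theta>)"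
  by (simp add: periodic_def)

lemma axis_in_torus_lattice: "(2 * pi) *\<^sub>R axis i 1 \<in> torus_lattice"
  unfolding torus_lattice_def
  by (auto intro!: exI[of _ "axis i 1"] simp: vec_eq_iff axis_def)

lemma integrable_on_torus_box:
  "continuous_on torus_box u \<Longrightarrow> (u :: real^'n \<Rightarrow> complex) integrable_on torus_box"
  unfolding torus_box_def by (rule integrable_continuous)

lemma zero_in_torus_box: "0 \<in> torus_box"
  by (simp add: torus_box_def mem_box_cart)

lemma content_torus_box: "measure lborel (torus_box :: (real^'n) set) = (2 * pi) ^ CARD('n)"
  using zero_in_torus_box content_cbox_cart[of "0 :: real^'n" "\<chi> i. 2 * pi"]
  by (auto simp: torus_box_def)

text \<open>Sliding the period box along a coordinate axis moves a slab by one period.\<close>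

lemma integral_torus_box_shift:
  fixes u :: "real^'n \<Rightarrow> complex"
  assumes u: "continuous_on UNIV u" "periodic u" and t: "0 \<le> t" "t \<le> 2 * pi"
  shows "integral torus_box (\<lambda>\<theta>. u (\<theta> + t *\<^sub>R axis i 1)) = integral torus_box u"
proof -
  let ?e = "axis i 1 :: real^'n"
  define one :: "real^'n" where "one = (\<chi> j. 2 * pi)"
  define B :: "real^'n" where "B = (\<chi> j. if j = i then t else 2 * pi)"
  have ie: "x \<bullet> ?e = x $ i" for x by (simp add: inner_axis)
  have eB: "?e \<in> Basis" by (simp add: axis_in_Basis_iff)
  have int: "u integrable_on cbox a b" for a b
    using u(1) by (intro integrable_continuous) (auto intro: continuous_on_subset)
  have split_le: "cbox a b \<inter> {x. x \<bullet> ?e \<le> c} = cbox a (\<chi> j. if j = i then min (b $ i) c else b $ j)"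
    and split_ge: "cbox a b \<inter> {x. x \<bullet> ?e \<ge> c} = cbox (\<chi> j. if j = i then max (a $ i) c else a $ j) b" for a b c
    using interval_split_cart[where a=a and b=b and k=i and c=c] by (simp_all add: ie interval_cbox_cart)
  have s1: "cbox (t *\<^sub>R ?e) (one + t *\<^sub>R ?e) \<inter> {x. x \<bullet> ?e \<le> 2 * pi} = cbox (t *\<^sub>R ?e) one"
    unfolding split_le using t by (intro arg_cong2[of _ _ _ _ cbox]) (auto simp: vec_eq_iff one_def axis_def)
  have s2: "cbox (t *\<^sub>R ?e) (one + t *\<^sub>R ?e) \<inter> {x. x \<bullet> ?e \<ge> 2 * pi}
      = cbox ((2 * pi) *\<^sub>R ?e) (B + (2 * pi) *\<^sub>R ?e)"
    unfolding split_ge using t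
    by (intro arg_cong2[of _ _ _ _ cbox]) (auto simp: vec_eq_iff one_def axis_def B_def)
  have s3: "cbox 0 one \<inter> {x. x \<bullet> ?e \<le> t} = cbox 0 B"
    unfolding split_le using t by (intro arg_cong2[of _ _ _ _ cbox]) (auto simp: vec_eq_iff one_def B_def)
  have s4: "cbox 0 one \<inter> {x. x \<bullet> ?e \<ge> t} = cbox (t *\<^sub>R ?e) one"
    unfolding split_ge using t by (intro arg_cong2[of _ _ _ _ cbox]) (auto simp: vec_eq_iff axis_def)
  have "integral torus_box (\<lambda>\<theta>. u (\<theta> + t *\<^sub>R ?e)) = integral (cbox (t *\<^sub>R ?e) (one + t *\<^sub>R ?e)) u"
    using integral_shift_cbox[of "t *\<^sub>R ?e" "t *\<^sub>R ?e" "one + t *\<^sub>R ?e" u]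
    by (simp add: torus_box_def one_def)
  also have "\<dots> = integral (cbox (t *\<^sub>R ?e) one) u
      + integral (cbox ((2 * pi) *\<^sub>R ?e) (B + (2 * pi) *\<^sub>R ?e)) u"
    by (subst integral_split[OF int eB, of _ _ "2 * pi"]) (simp only: s1 s2)
  also have "integral (cbox ((2 * pi) *\<^sub>R ?e) (B + (2 * pi) *\<^sub>R ?e)) u
      = integral (cbox 0 B) (\<lambda>\<theta>. u (\<theta> + (2 * pi) *\<^sub>R ?e))"
    using integral_shift_cbox[of "(2 * pi) *\<^sub>R ?e" "(2 * pi) *\<^sub>R ?e" "B + (2 * pi) *\<^sub>R ?e" u] by simp
  also have "(\<lambda>\<theta>. u (\<theta> + (2 * pi) *\<^sub>R ?e)) = u"
    using u(2) axis_in_torus_lattice[of i] by (simp add: periodic_def)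
  also have "integral (cbox (t *\<^sub>R ?e) one) u + integral (cbox 0 B) u = integral (cbox 0 one) u"
    by (subst integral_split[OF int eB, of 0 one t]) (simp only: s3 s4 add.commute)
  finally show ?thesis by (simp add: torus_box_def one_def)
qed

text \<open>The integrals of the translates of \<open>u\<close> are constant, so their derivative, which is the
  integral of the derivative, vanishes.\<close>

lemma integral_torus_box_deriv:
  fixes u u' :: "real^'n \<Rightarrow> complex"
  assumes u: "continuous_on UNIV u" "periodic u" and u': "continuous_on UNIV u'"
    and deriv: "\<And>\<theta>. ((\<lambda>t. u (\<theta> + t *\<^sub>R axis i 1)) has_vector_derivative u' \<theta>) (at 0)"
  shows "integral torus_box u' = 0"
proof -
  let ?e = "axis i 1 :: real^'n"
  let ?U = "{0..2 * pi}"
  let ?I = "\<lambda>t::real. integral torus_box (\<lambda>\<theta>. u (\<theta> + t *\<^sub>R ?e))"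
  have d: "((\<lambda>t. u (\<theta> + t *\<^sub>R ?e)) has_vector_derivative u' (\<theta> + s *\<^sub>R ?e)) (at s within ?U)" for \<theta> s
  proof -
    have "((\<lambda>t. u ((\<theta> + s *\<^sub>R ?e) + t *\<^sub>R ?e)) \<circ> (\<lambda>t. t - s) has_vector_derivative
        1 *\<^sub>R u' (\<theta> + s *\<^sub>R ?e)) (at s)"
      by (rule vector_diff_chain_at) (use deriv in \<open>auto intro!: derivative_eq_intros\<close>)
    moreover have "(\<lambda>t. u ((\<theta> + s *\<^sub>R ?e) + t *\<^sub>R ?e)) \<circ> (\<lambda>t. t - s) = (\<lambda>t. u (\<theta> + t *\<^sub>R ?e))"
      by (simp add: fun_eq_iff algebra_simps)
    ultimately show ?thesis by (simp add: has_vector_derivative_at_within)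
  qed
  have "(?I has_vector_derivative integral torus_box (\<lambda>\<theta>. u' (\<theta> + 0 *\<^sub>R ?e))) (at 0 within ?U)"
    unfolding torus_box_def
  proof (rule leibniz_rule_vector_derivative)
    show "(\<lambda>\<theta>. u (\<theta> + t *\<^sub>R ?e)) integrable_on cbox 0 (\<chi> i. 2 * pi)" for t
      by (intro integrable_continuous continuous_on_compose2[OF u(1)] continuous_intros) auto
    show "continuous_on (?U \<times> cbox 0 (\<chi> i. 2 * pi)) (\<lambda>(t, \<theta>). u' (\<theta> + t *\<^sub>R ?e))"
      unfolding case_prod_beta by (intro continuous_on_compose2[OF u'] continuous_intros) auto
  qed (use d in auto)
  moreover have "(?I has_vector_derivative 0) (at 0 within ?U)"
  proof (rule has_vector_derivative_transform_within[OF has_vector_derivative_const zero_less_one])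
    show "integral torus_box u = ?I t" if "t \<in> ?U" for t
      using integral_torus_box_shift[OF u, of t i] that by auto
  qed auto
  moreover have "at (0::real) within ?U \<noteq> bot"
    by (simp add: at_within_Icc_at_right)
  ultimately show ?thesis by (auto dest: vector_derivative_unique_within)
qed

lemma character_has_vector_derivative:
  "((\<lambda>t. character p (\<theta> + t *\<^sub>R axis i 1)) has_vector_derivative
     \<i> * of_int (p $ i) * character p \<theta>) (at 0)"
proof -
  let ?F = "\<lambda>z. exp (\<i> * of_real (rvec p \<bullet> \<theta>) + z * (\<i> * of_int (p $ i)))"
  have "(?F has_field_derivative \<i> * of_int (p $ i) * character p \<theta>) (at (of_real 0))"
    by (rule derivative_eq_intros refl | simp add: character_def mult_ac)+
  then have "((\<lambda>t. ?F (of_real t)) has_vector_derivative \<i> * of_int (p $ i) * character p \<theta>) (at 0)"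
    by (rule has_vector_derivative_real_field)
  then show ?thesis
    by (simp add: character_def inner_add_right inner_axis algebra_simps)
qed

lemma torus_coeff_deriv:
  fixes u u' :: "real^'n \<Rightarrow> complex"
  assumes u: "continuous_on UNIV u" "periodic u" and u': "continuous_on UNIV u'"
    and deriv: "\<And>\<theta>. ((\<lambda>t. u (\<theta> + t *\<^sub>R axis i 1)) has_vector_derivative u' \<theta>) (at 0)"
  shows "torus_coeff u' p = \<i> * of_int (p $ i) * torus_coeff u p"
proof -
  let ?c = "character (- p)"
  have 1: "((\<lambda>t. u (\<theta> + t *\<^sub>R axis i 1) * ?c (\<theta> + t *\<^sub>R axis i 1)) has_vector_derivative
       u' \<theta> * ?c \<theta> - \<i> * of_int (p $ i) * (u \<theta> * ?c \<theta>)) (at 0)" for \<theta>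
    using has_vector_derivative_mult[OF deriv[of \<theta>] character_has_vector_derivative[of "- p" \<theta> i]]
    by (simp add: algebra_simps)
  have i1: "(\<lambda>\<theta>. u' \<theta> * ?c \<theta>) integrable_on torus_box" "(\<lambda>\<theta>. u \<theta> * ?c \<theta>) integrable_on torus_box"
    by (intro integrable_on_torus_box continuous_on_mult continuous_on_character
        continuous_on_subset[OF u'] continuous_on_subset[OF u(1)] subset_UNIV)+
  have "integral torus_box (\<lambda>\<theta>. u' \<theta> * ?c \<theta> - \<i> * of_int (p $ i) * (u \<theta> * ?c \<theta>)) = 0"
    by (rule integral_torus_box_deriv[OF _ _ _ 1])
      (intro continuous_intros continuous_on_character u u' periodic_mult periodic_character)+
  then have "integral torus_box (\<lambda>\<theta>. u' \<theta> * ?c \<theta>)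
      = \<i> * of_int (p $ i) * integral torus_box (\<lambda>\<theta>. u \<theta> * ?c \<theta>)"
    using i1 by (simp add: integral_diff integrable_on_mult_right)
  then show ?thesis by (simp add: torus_coeff_def)
qed

lemma torus_coeff_character: "torus_coeff (character m) p = (if m = p then 1 else 0)"
proof (cases "m = p")
  case True
  have "(\<lambda>\<theta>. character p \<theta> * character (- p) \<theta>) = (\<lambda>_. 1)"
    by (simp add: fun_eq_iff flip: character_add)
  moreover have "integral (torus_box :: (real^'n) set) (\<lambda>_. 1 :: complex) = of_real ((2 * pi) ^ CARD('n))"
    unfolding content_torus_box[symmetric] torus_box_def by (simp add: scaleR_conv_of_real)
  ultimately show ?thesis using True by (simp add: torus_coeff_def)
next
  case False
  then obtain i where i: "m $ i \<noteq> p $ i" by (auto simp: vec_eq_iff)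
  let ?u' = "\<lambda>\<theta>. \<i> * of_int (m $ i) * character m \<theta>"
  have "torus_coeff ?u' p = \<i> * of_int (p $ i) * torus_coeff (character m) p"
    by (rule torus_coeff_deriv)
       (intro continuous_intros continuous_on_character periodic_character character_has_vector_derivative)+
  moreover have "torus_coeff ?u' p = \<i> * of_int (m $ i) * torus_coeff (character m) p"
    by (simp add: torus_coeff_def mult.assoc)
  ultimately show ?thesis using i False by auto
qed

lemma torus_coeff_trig_sum:
  fixes u :: "real^'n \<Rightarrow> complex"
  assumes "continuous_on UNIV u" "finite A"
  shows "torus_coeff (\<lambda>\<theta>. \<Sum>p\<in>A. c p * character p \<theta> * u \<theta>) q = (\<Sum>p\<in>A. c p * torus_coeff u (q - p))"
proof -
  have int: "(\<lambda>\<theta>. u \<theta> * character (- (q - p)) \<theta>) integrable_on torus_box" for p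
    by (intro integrable_on_torus_box continuous_on_mult continuous_on_character
        continuous_on_subset[OF assms(1)] subset_UNIV)
  have "integral torus_box (\<lambda>\<theta>. (\<Sum>p\<in>A. c p * character p \<theta> * u \<theta>) * character (- q) \<theta>)
      = integral torus_box (\<lambda>\<theta>. \<Sum>p\<in>A. c p * (u \<theta> * character (- (q - p)) \<theta>))"
    using character_add[of p "- q" for p] by (simp add: sum_distrib_right sum_distrib_left mult_ac)
  also have "\<dots> = (\<Sum>p\<in>A. c p * integral torus_box (\<lambda>\<theta>. u \<theta> * character (- (q - p)) \<theta>))"
    using int by (subst integral_sum) (auto simp: assms(2) integrable_on_mult_right)
  finally show ?thesis by (simp add: torus_coeff_def sum_distrib_left mult_ac)
qed

lemma torus_coeff_sum:
  fixes u :: "'i \<Rightarrow> real^'n \<Rightarrow> complex"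
  assumes "finite A" "\<And>i. i \<in> A \<Longrightarrow> continuous_on UNIV (u i)"
  shows "torus_coeff (\<lambda>\<theta>. \<Sum>i\<in>A. c i * u i \<theta>) q = (\<Sum>i\<in>A. c i * torus_coeff (u i) q)"
proof -
  have int: "(\<lambda>\<theta>. u i \<theta> * character (- q) \<theta>) integrable_on torus_box" if "i \<in> A" for i
    using assms(2)[OF that]
    by (intro integrable_on_torus_box continuous_on_mult continuous_on_character)
       (auto intro: continuous_on_subset)
  have "integral torus_box (\<lambda>\<theta>. (\<Sum>i\<in>A. c i * u i \<theta>) * character (- q) \<theta>)
      = integral torus_box (\<lambda>\<theta>. \<Sum>i\<in>A. c i * (u i \<theta> * character (- q) \<theta>))"
    by (simp add: sum_distrib_left sum_distrib_right mult_ac)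
  also have "\<dots> = (\<Sum>i\<in>A. c i * integral torus_box (\<lambda>\<theta>. u i \<theta> * character (- q) \<theta>))"
    using int by (subst integral_sum) (auto simp: assms(1) integrable_on_mult_right)
  finally show ?thesis by (simp add: torus_coeff_def sum_distrib_left mult_ac)
qed

lemma torus_coeff_diff:
  fixes u v :: "real^'n \<Rightarrow> complex"
  assumes "continuous_on UNIV u" "continuous_on UNIV v"
  shows "torus_coeff (\<lambda>\<theta>. u \<theta> - v \<theta>) q = torus_coeff u q - torus_coeff v q"
  using torus_coeff_sum[of UNIV "\<lambda>b. if b then u else v" "\<lambda>b. if b then 1 else - 1" q] assms
  by (simp add: UNIV_bool)

lemma norm_torus_coeff_le:
  fixes u :: "real^'n \<Rightarrow> complex"
  assumes "continuous_on torus_box u" "\<And>\<theta>. \<theta> \<in> torus_box \<Longrightarrow> cmod (u \<theta>) \<le> C"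
  shows "cmod (torus_coeff u p) \<le> C"
proof -
  have "0 \<le> C" using assms(2)[OF zero_in_torus_box] norm_ge_zero order_trans by blast
  then have "cmod (integral torus_box (\<lambda>\<theta>. u \<theta> * character (- p) \<theta>)) \<le> C * measure lborel (torus_box :: (real^'n) set)"
    unfolding torus_box_def
    by (rule integrable_bound)
       (use assms in \<open>auto simp: norm_mult torus_box_def[symmetric]
          intro!: integrable_on_torus_box continuous_on_mult continuous_on_character\<close>)
  then show ?thesis
    by (simp add: torus_coeff_def norm_mult norm_divide norm_power content_torus_box field_simps)
qed

section \<open>Uniqueness of Fourier coefficients\<close>

lemma mult_cos_character:
  "of_real (cos (\<theta> $ i - c)) * character p \<theta>
    = (cis (- c) / 2) * character (p + axis i 1) \<theta> + (cis c / 2) * character (p - axis i 1) \<theta>"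
proof -
  have "rvec (axis i 1) = axis i 1" by (simp add: rvec_def axis_def vec_eq_iff)
  then have "rvec (axis i 1) \<bullet> \<theta> = \<theta> $ i" by (simp add: inner_axis')
  then have ch: "character (axis i 1) \<theta> = cis (\<theta> $ i)" "character (- axis i 1) \<theta> = cis (- (\<theta> $ i))"
    by (simp_all add: character_def rvec_uminus cis_conv_exp)
  have "of_real (cos (\<theta> $ i - c)) = (cis (\<theta> $ i - c) + cis (c - \<theta> $ i)) / 2"
    by (simp add: complex_eq_iff cos_diff sin_diff)
  also have "cis (\<theta> $ i - c) = cis (- c) * cis (\<theta> $ i)" by (simp add: cis_mult)
  also have "cis (c - \<theta> $ i) = cis c * cis (- (\<theta> $ i))" by (simp add: cis_mult)
  finally have c: "of_real (cos (\<theta> $ i - c)) = (cis (- c) * cis (\<theta> $ i) + cis c * cis (- (\<theta> $ i))) / 2" .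
  show ?thesis
    unfolding c
    using character_add[of p "axis i 1" \<theta>] character_add[of p "- axis i 1" \<theta>]
    by (simp add: ch algebra_simps)
qed

text \<open>The trigonometric polynomial \<open>T = (n + \<Sum> cos(\<theta>\<^sub>i - c\<^sub>i)) / (2n - \<eta>)\<close> exceeds 1 only near \<open>c\<close>.
  Its powers concentrate at \<open>c\<close>, while their integrals against \<open>u\<close> all vanish; hence \<open>u c\<close> cannot
  be positive. For \<open>c\<close> in the open box no other point of the closed box is congruent to \<open>c\<close>, so
  \<open>T\<close> attains its maximum over the closed box at \<open>c\<close> only.\<close>

lemma vanishing_coeffs_imp_nonpos:
  fixes u :: "real^'n \<Rightarrow> real"
  assumes u: "continuous_on torus_box u"
    and zero: "\<And>p. integral torus_box (\<lambda>\<theta>. of_real (u \<theta>) * character p \<theta>) = 0"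
    and c: "c \<in> box 0 (\<chi> i. 2 * pi)"
  shows "u c \<le> 0"
proof (rule ccontr)
  assume "\<not> u c \<le> 0"
  define a where "a = u c / 2"
  then have a: "a > 0" "u c > a" using \<open>\<not> u c \<le> 0\<close> by auto
  define n where "n = real CARD('n)"
  have n: "n \<ge> 1" by (simp add: n_def Suc_leI)
  define S where "S \<theta> = (\<Sum>i\<in>UNIV. cos (\<theta> $ i - c $ i))" for \<theta> :: "real^'n"
  have contS: "continuous_on A S" for A unfolding S_def by (intro continuous_intros)
  have Sge: "- n \<le> S \<theta>" for \<theta>
    using sum_mono[of UNIV "\<lambda>_. -1::real" "\<lambda>i. cos (\<theta> $ i - c $ i)"] by (simp add: S_def n_def)
  have Slt: "S \<theta> < n" if "\<theta> \<in> torus_box" "\<theta> \<noteq> c" for \<theta>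
  proof -
    from that(2) obtain i where i: "\<theta> $ i \<noteq> c $ i" by (auto simp: vec_eq_iff)
    have "cos (\<theta> $ i - c $ i) \<noteq> 1"
    proof
      assume "cos (\<theta> $ i - c $ i) = 1"
      then obtain m :: int where m: "\<theta> $ i - c $ i = of_int m * (2 * pi)"
        by (auto simp: cos_one_2pi_int mult.assoc)
      have "0 < c $ i" "c $ i < 2 * pi" "0 \<le> \<theta> $ i" "\<theta> $ i \<le> 2 * pi"
        using c that(1) by (auto simp: mem_box_cart torus_box_def)
      then have "\<bar>of_int m * (2 * pi)\<bar> < 1 * (2 * pi)" using m by linarith
      then have "\<bar>real_of_int m\<bar> < 1" by (simp add: abs_mult)
      then have "m = 0" by linarith
      then show False using m i by simp
    qed
    then have "cos (\<theta> $ i - c $ i) < 1" using cos_le_one le_less by blast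
    then have "S \<theta> < (\<Sum>i\<in>(UNIV::'n set). 1)"
      unfolding S_def by (intro sum_strict_mono_ex1) auto
    then show ?thesis by (simp add: n_def)
  qed
  have cin: "c \<in> torus_box" using c box_subset_cbox by (auto simp: torus_box_def)
  obtain e where e: "e > 0" "\<And>\<theta>. \<theta> \<in> torus_box \<Longrightarrow> dist \<theta> c < e \<Longrightarrow> u \<theta> > a"
  proof -
    from u cin a(2) obtain e where "e > 0" "\<forall>\<theta>\<in>torus_box. dist \<theta> c < e \<longrightarrow> dist (u \<theta>) (u c) < u c - a"
      unfolding continuous_on_iff by (metis diff_gt_0_iff_gt)
    then show ?thesis by (intro that[of e]) (fastforce simp: dist_real_def)+
  qed
  obtain \<eta> where \<eta>: "\<eta> > 0" "\<eta> < 1" "\<And>\<theta>. \<theta> \<in> torus_box \<Longrightarrow> \<not> dist \<theta> c < e \<Longrightarrow> S \<theta> \<le> n - 2 * \<eta>"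
  proof (cases "torus_box - ball c e = {}")
    case True
    show ?thesis by (rule that[of "1/2"]) (use True in \<open>auto simp: dist_commute\<close>)
  next
    case False
    have "compact (torus_box - ball c e)"
      unfolding torus_box_def by (intro compact_diff compact_cbox open_ball)
    from continuous_attains_sup[OF this False contS] obtain m where
      m: "m \<in> torus_box - ball c e" "\<And>\<theta>. \<theta> \<in> torus_box - ball c e \<Longrightarrow> S \<theta> \<le> S m" by blast
    then have "m \<noteq> c" using e(1) by auto
    then have "S m < n" using Slt m(1) by auto
    define h where "h = min (1/2) ((n - S m) / 2)"
    have h: "0 < h" "h < 1" "2 * h \<le> n - S m" using \<open>S m < n\<close> by (auto simp: h_def min_def)
    show ?thesis
    proof (rule that[of h])
      show "S \<theta> \<le> n - 2 * h" if "\<theta> \<in> torus_box" "\<not> dist \<theta> c < e" for \<theta>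
        using m(2)[of \<theta>] that h(3) by (simp add: dist_commute)
    qed (use h in auto)
  qed
  define T where "T \<theta> = (n + S \<theta>) / (2 * n - \<eta>)" for \<theta>
  have den: "2 * n - \<eta> > 0" using n \<eta> by simp
  have contT: "continuous_on A T" for A
    unfolding T_def using den by (intro continuous_intros contS) auto
  have T0: "T \<theta> \<ge> 0" for \<theta> using Sge[of \<theta>] den by (simp add: T_def)
  have T1: "T \<theta> \<le> 1" if "\<theta> \<in> torus_box" "\<not> dist \<theta> c < e" for \<theta>
    using \<eta>(3)[OF that] den \<eta>(1) by (simp add: T_def divide_le_eq)
  have "S c = n" by (simp add: S_def n_def)
  then have Tc: "T c > 1" using den \<eta>(1) by (simp add: T_def less_divide_eq)
  define \<beta> where "\<beta> = (1 + T c) / 2"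
  have \<beta>: "1 < \<beta>" "\<beta> < T c" using Tc by (auto simp: \<beta>_def)
  have "open {\<theta>. \<beta> < T \<theta>}"
    using contT[of UNIV] by (intro open_Collect_less continuous_on_const)
  then have "open (box 0 (\<chi> i. 2 * pi) \<inter> ball c e \<inter> {\<theta>. \<beta> < T \<theta>})" by (intro open_Int) auto
  moreover have "c \<in> box 0 (\<chi> i. 2 * pi) \<inter> ball c e \<inter> {\<theta>. \<beta> < T \<theta>}" using c e \<beta> by auto
  ultimately obtain w1 w2 where w: "cbox w1 w2 \<subseteq> box 0 (\<chi> i. 2 * pi) \<inter> ball c e \<inter> {\<theta>. \<beta> < T \<theta>}"
    "c \<in> box w1 w2"
    by (metis open_contains_cbox)
  let ?W = "cbox w1 w2"
  have Wsub: "?W \<subseteq> torus_box" using w(1) box_subset_cbox by (fastforce simp: torus_box_def)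
  have "box w1 w2 \<noteq> {}" using w(2) by auto
  then have W: "measure lborel ?W > 0" by (simp add: content_pos_lt_eq box_ne_empty)
  have "compact (u ` torus_box)" using u by (intro compact_continuous_image) (auto simp: torus_box_def)
  then obtain B where B: "\<And>\<theta>. \<theta> \<in> torus_box \<Longrightarrow> \<bar>u \<theta>\<bar> \<le> B"
    by (fastforce dest!: compact_imp_bounded simp: bounded_iff)
  have B0: "0 \<le> B" using B[OF cin] by linarith
  \<comment> \<open>Near \<open>c\<close> the integrand is at least \<open>a\<beta>\<^sup>j\<close> on a box of positive volume; away from \<open>c\<close> the factor
    \<open>T\<^sup>j\<close> is at most 1, so that the integrand is bounded independently of \<open>j\<close>.\<close>
  have lower: "a * \<beta> ^ j * (if \<theta> \<in> ?W then 1 else 0) - B \<le> u \<theta> * T \<theta> ^ j" if t: "\<theta> \<in> torus_box" for \<theta> j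
  proof (cases "\<theta> \<in> ?W")
    case True
    then have *: "a \<le> u \<theta>" "\<beta> \<le> T \<theta>" using w(1) e(2)[OF t] by (auto simp: dist_commute subset_iff intro!: less_imp_le)
    have "a * \<beta> ^ j \<le> u \<theta> * T \<theta> ^ j"
      by (rule mult_mono) (use * a \<beta> in \<open>auto intro: power_mono\<close>)
    then show ?thesis using True B0 by simp
  next
    case F: False
    show ?thesis
    proof (cases "dist \<theta> c < e")
      case True
      then have "0 \<le> u \<theta> * T \<theta> ^ j" using e(2)[OF t] a T0 by (auto intro!: mult_nonneg_nonneg)
      then show ?thesis using F B0 by simp
    next
      case False
      have "\<bar>u \<theta> * T \<theta> ^ j\<bar> \<le> B * 1"
        unfolding abs_mult by (rule mult_mono) (use B[OF t] T0 T1[OF t False] B0 in \<open>auto intro: power_le_one\<close>)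
      then show ?thesis using F by simp
    qed
  qed
  have trig: "integral torus_box (\<lambda>\<theta>. of_real (u \<theta>) * of_real (T \<theta>) ^ j * character p \<theta>) = 0" for j p
  proof (induction j arbitrary: p)
    case 0
    show ?case using zero by simp
  next
    case (Suc j)
    let ?w = "\<lambda>\<theta>. of_real (u \<theta>) * of_real (T \<theta>) ^ j :: complex"
    define d where "d = 2 * n - \<eta>"
    have int: "(\<lambda>\<theta>. ?w \<theta> * character p \<theta>) integrable_on torus_box" for p
      by (intro integrable_on_torus_box continuous_intros u contT continuous_on_character)
    have "of_real (u \<theta>) * of_real (T \<theta>) ^ Suc j * character p \<theta>
        = (n / d) * (?w \<theta> * character p \<theta>)
          + (\<Sum>i\<in>UNIV. (cis (- c $ i) / (2 * d)) * (?w \<theta> * character (p + axis i 1) \<theta>)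
            + (cis (c $ i) / (2 * d)) * (?w \<theta> * character (p - axis i 1) \<theta>))" for \<theta>
    proof -
      have "of_real (T \<theta>) * character p \<theta> = (n / d) * character p \<theta>
          + (\<Sum>i\<in>UNIV. (of_real (cos (\<theta> $ i - c $ i)) * character p \<theta>) / d)"
        by (simp add: T_def S_def d_def add_divide_distrib distrib_right sum_divide_distrib sum_distrib_right)
      also have "\<dots> = (n / d) * character p \<theta>
          + (\<Sum>i\<in>UNIV. (cis (- c $ i) / (2 * d)) * character (p + axis i 1) \<theta>
            + (cis (c $ i) / (2 * d)) * character (p - axis i 1) \<theta>)"
        unfolding mult_cos_character by (simp add: add_divide_distrib mult_ac)
      finally have "?w \<theta> * (of_real (T \<theta>) * character p \<theta>) = ?w \<theta> * ((n / d) * character p \<theta>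
          + (\<Sum>i\<in>UNIV. (cis (- c $ i) / (2 * d)) * character (p + axis i 1) \<theta>
            + (cis (c $ i) / (2 * d)) * character (p - axis i 1) \<theta>))" by simp
      then show ?thesis by (simp add: distrib_left sum_distrib_left mult_ac)
    qed
    moreover have H: "((\<lambda>\<theta>. ?w \<theta> * character p \<theta>) has_integral 0) torus_box" for p
      using int[of p] Suc.IH[of p] by (metis has_integral_integrable_integral)
    have "((\<lambda>\<theta>. (n / d) * (?w \<theta> * character p \<theta>)
          + (\<Sum>i\<in>UNIV. (cis (- c $ i) / (2 * d)) * (?w \<theta> * character (p + axis i 1) \<theta>)
            + (cis (c $ i) / (2 * d)) * (?w \<theta> * character (p - axis i 1) \<theta>))) has_integral
         of_real (n / d) * 0 + (\<Sum>i\<in>(UNIV::'n set). (cis (- c $ i) / (2 * d)) * 0 + (cis (c $ i) / (2 * d)) * 0)) torus_box"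
      by (intro has_integral_add has_integral_sum has_integral_mult_right H finite)
    ultimately show ?case by (simp only: integral_unique mult_zero_right add_0_right sum.neutral_const)
  qed
  have le: "a * \<beta> ^ j * measure lborel ?W \<le> B * measure lborel (torus_box :: (real^'n) set)" for j
  proof -
    have h1: "((\<lambda>\<theta>. u \<theta> * T \<theta> ^ j) has_integral 0) torus_box"
    proof -
      have i: "(\<lambda>\<theta>. u \<theta> * T \<theta> ^ j) integrable_on torus_box"
        unfolding torus_box_def
        by (intro integrable_continuous continuous_intros contT) (use u in \<open>simp add: torus_box_def\<close>)
      have "of_real (integral torus_box (\<lambda>\<theta>. u \<theta> * T \<theta> ^ j))
          = integral torus_box (\<lambda>\<theta>. of_real (u \<theta> * T \<theta> ^ j) :: complex)"
        using integral_linear[OF i bounded_linear_of_real, where 'a1 = complex] by (simp add: o_def)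
      also have "\<dots> = 0" using trig[of j 0] by simp
      finally have "integral torus_box (\<lambda>\<theta>. u \<theta> * T \<theta> ^ j) = 0" by simp
      then show ?thesis using integrable_integral[OF i] by simp
    qed
    have h2: "((\<lambda>\<theta>. a * \<beta> ^ j * (if \<theta> \<in> ?W then 1 else 0) - B) has_integral
        a * \<beta> ^ j * measure lborel ?W - measure lborel (torus_box :: (real^'n) set) * B) torus_box"
    proof (intro has_integral_diff has_integral_mult_right)
      show "((\<lambda>\<theta>. if \<theta> \<in> ?W then 1 else 0) has_integral measure lborel ?W) torus_box"
        using has_integral_restrict[OF Wsub, of "\<lambda>_. 1::real"] has_integral_const[of "1::real" w1 w2] by simp
      show "((\<lambda>\<theta>::real^'n. B) has_integral measure lborel (torus_box :: (real^'n) set) * B) torus_box"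
        using has_integral_const[of B "0::real^'n"] by (simp add: torus_box_def)
    qed
    have "a * \<beta> ^ j * measure lborel ?W - measure lborel (torus_box :: (real^'n) set) * B \<le> 0"
      by (rule has_integral_le[OF h2 h1 lower])
    then show ?thesis by (simp add: mult.commute)
  qed
  obtain j where "B * measure lborel (torus_box :: (real^'n) set) / (a * measure lborel ?W) < \<beta> ^ j"
    using real_arch_pow[OF \<beta>(1)] by blast
  then have "B * measure lborel (torus_box :: (real^'n) set) < a * \<beta> ^ j * measure lborel ?W"
    using a W by (simp add: divide_less_eq mult_ac)
  with le[of j] show False by simp
qed

text \<open>The real statement is applied to \<open>Re (z u)\<close> for the four values \<open>z = \<plusminus>1, \<plusminus>\<i>\<close>.\<close>

lemma torus_coeff_eq_0_imp_eq_0: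
  fixes u :: "real^'n \<Rightarrow> complex"
  assumes u: "continuous_on torus_box u" and zero: "\<And>p. torus_coeff u p = 0"
    and \<theta>: "\<theta> \<in> torus_box"
  shows "u \<theta> = 0"
proof -
  let ?B = "box 0 (\<chi> i. 2 * pi) :: (real^'n) set"
  have zero': "integral torus_box (\<lambda>\<theta>. u \<theta> * character p \<theta>) = 0" for p
    using zero[of "- p"] by (simp add: torus_coeff_def)
  have int: "(\<lambda>\<theta>. u \<theta> * character p \<theta>) integrable_on torus_box" for p
    by (intro integrable_on_torus_box continuous_on_mult continuous_on_cnj u continuous_on_character)
  have int': "(\<lambda>\<theta>. cnj (u \<theta>) * character p \<theta>) integrable_on torus_box" for p
    by (intro integrable_on_torus_box continuous_on_mult continuous_on_cnj u continuous_on_character)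
  have conj: "integral torus_box (\<lambda>\<theta>. cnj (u \<theta>) * character p \<theta>) = 0" for p
  proof -
    have "cnj (character (- p) \<theta>) = character p \<theta>" for \<theta>
      by (simp add: character_def exp_cnj rvec_uminus)
    then show ?thesis
      using integral_linear[OF int[of "- p"] bounded_linear_cnj] zero'[of "- p"] by (simp add: o_def)
  qed
  have np: "Re (z * u c) \<le> 0" if "c \<in> ?B" for z c
  proof (rule vanishing_coeffs_imp_nonpos[where u = "\<lambda>\<theta>. Re (z * u \<theta>)", OF _ _ that])
    show "continuous_on torus_box (\<lambda>\<theta>. Re (z * u \<theta>))" by (intro continuous_intros u)
    fix p
    have re: "of_real (Re w) = (w + cnj w) / 2" for w by (simp add: complex_eq_iff)
    have "(\<lambda>\<theta>. of_real (Re (z * u \<theta>)) * character p \<theta>)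
        = (\<lambda>\<theta>. (z / 2) * (u \<theta> * character p \<theta>) + (cnj z / 2) * (cnj (u \<theta>) * character p \<theta>))"
      unfolding re complex_cnj_mult by (simp add: distrib_right add_divide_distrib mult.assoc)
    moreover have "((\<lambda>\<theta>. (z / 2) * (u \<theta> * character p \<theta>) + (cnj z / 2) * (cnj (u \<theta>) * character p \<theta>))
        has_integral (z / 2) * 0 + (cnj z / 2) * 0) torus_box"
      using integrable_integral[OF int[of p]] integrable_integral[OF int'[of p]]
      unfolding zero' conj by (intro has_integral_add has_integral_mult_right)
    ultimately show "integral torus_box (\<lambda>\<theta>. of_real (Re (z * u \<theta>)) * character p \<theta>) = 0"
      by (simp add: integral_unique)
  qed
  have "u c = 0" if "c \<in> ?B" for c
  proof -
    have "Re (u c) \<le> 0" "Re (- u c) \<le> 0" "Re (\<i> * u c) \<le> 0" "Re (- \<i> * u c) \<le> 0"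
      using np[OF that, of 1] np[OF that, of "-1"] np[OF that, of "\<i>"] np[OF that, of "-\<i>"] by auto
    then show ?thesis by (simp add: complex_eq_iff)
  qed
  note zero_inside = this
  have "(\<chi> i. pi) \<in> ?B" by (simp add: mem_box_cart)
  then have "?B \<noteq> {}" by (metis empty_iff)
  then have clo: "closure ?B = torus_box"
    unfolding torus_box_def by (rule closure_box)
  show ?thesis
    by (rule continuous_constant_on_closure[of ?B u 0]) (use u \<theta> clo zero_inside in simp_all)
qed

section \<open>Smooth functions on a domain times the torus\<close>

definition pdiff :: "'e::real_normed_vector \<Rightarrow> ('e \<Rightarrow> complex) \<Rightarrow> 'e \<Rightarrow> complex" where
  "pdiff v G = (\<lambda>z. frechet_derivative G (at z) v)"

definition torus_smooth :: "(real^'n) set \<Rightarrow> ('n::finite coords \<Rightarrow> complex) \<Rightarrow> bool" where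
  "torus_smooth U G \<longleftrightarrow> smooth_on (U \<times> UNIV) G \<and> (\<forall>x\<in>U. periodic (\<lambda>\<theta>. G (x, \<theta>)))"

lemma open_times_UNIV: "open U \<Longrightarrow> open (U \<times> (UNIV :: 'b::topological_space set))"
  by (intro open_Times open_UNIV)

lemma torus_smooth_imp_smooth_on: "torus_smooth U G \<Longrightarrow> smooth_on (U \<times> UNIV) G"
  and torus_smooth_imp_periodic: "torus_smooth U G \<Longrightarrow> x \<in> U \<Longrightarrow> periodic (\<lambda>\<theta>. G (x, \<theta>))"
  by (simp_all add: torus_smooth_def)

lemma torus_smooth_has_derivative:
  "torus_smooth U G \<Longrightarrow> x \<in> U \<Longrightarrow>
     (G has_derivative (\<lambda>v. pdiff v G (x, \<theta>))) (at (x, \<theta>))"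
  unfolding pdiff_def by (rule smooth_on_has_derivative[OF torus_smooth_imp_smooth_on]) auto

lemma torus_smooth_pdiff:
  fixes G :: "'n::finite coords \<Rightarrow> complex"
  assumes "open U" "torus_smooth U G"
  shows "torus_smooth U (pdiff v G)"
  unfolding torus_smooth_def
proof (intro conjI ballI)
  show "smooth_on (U \<times> UNIV) (pdiff v G)"
    unfolding pdiff_def by (rule smooth_on_frechet_derivative[OF torus_smooth_imp_smooth_on[OF assms(2)]])
  fix x assume x: "x \<in> U"
  show "periodic (\<lambda>\<theta>. pdiff v G (x, \<theta>))"
    unfolding periodic_def
  proof (intro allI ballI)
    fix \<theta> t :: "real^'n" assume t: "t \<in> torus_lattice"
    let ?s = "\<lambda>z :: 'n coords. z + (0, t)"
    have "(G has_derivative (\<lambda>v. pdiff v G (x, \<theta> + t))) (at (?s (x, \<theta>)))"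
      using torus_smooth_has_derivative[OF assms(2) x] by simp
    moreover have "(?s has_derivative (\<lambda>v. v)) (at (x, \<theta>))"
      by (auto intro!: derivative_eq_intros)
    ultimately have "((\<lambda>z. G (?s z)) has_derivative (\<lambda>v. pdiff v G (x, \<theta> + t))) (at (x, \<theta>))"
      using has_derivative_compose by blast
    then have "(G has_derivative (\<lambda>v. pdiff v G (x, \<theta> + t))) (at (x, \<theta>))"
    proof (rule has_derivative_transform_within_open[OF _ open_times_UNIV[OF assms(1)]])
      show "(x, \<theta>) \<in> U \<times> UNIV" using x by simp
      show "G (?s z) = G z" if "z \<in> U \<times> UNIV" for z
        using torus_smooth_imp_periodic[OF assms(2), of "fst z"] that t
        by (cases z) (auto simp: periodic_def)
    qed
    then show "pdiff v G (x, \<theta> + t) = pdiff v G (x, \<theta>)"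
      using torus_smooth_has_derivative[OF assms(2) x, of \<theta>] has_derivative_unique by metis
  qed
qed

lemma torus_smooth_pdiff_pow: "open U \<Longrightarrow> torus_smooth U G \<Longrightarrow> torus_smooth U ((pdiff v ^^ a) G)"
  by (induction a) (auto intro: torus_smooth_pdiff)

lemma torus_smooth_foldr_pdiff:
  "open U \<Longrightarrow> torus_smooth U G \<Longrightarrow> torus_smooth U (foldr (\<lambda>i. pdiff (e i) ^^ I i) xs G)"
  by (induction xs) (auto intro: torus_smooth_pdiff_pow)

lemma torus_smooth_const: "open U \<Longrightarrow> torus_smooth U (\<lambda>z. c)"
  by (simp add: torus_smooth_def smooth_on_const open_times_UNIV periodic_def)

lemma torus_smooth_mult:
  "open U \<Longrightarrow> torus_smooth U F \<Longrightarrow> torus_smooth U G \<Longrightarrow> torus_smooth U (\<lambda>z. F z * G z)"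
  by (simp add: torus_smooth_def smooth_on_mult open_times_UNIV periodic_def)

lemma torus_smooth_minus:
  "open U \<Longrightarrow> torus_smooth U F \<Longrightarrow> torus_smooth U G \<Longrightarrow> torus_smooth U (\<lambda>z. F z - G z)"
  by (simp add: torus_smooth_def smooth_on_minus open_times_UNIV periodic_def)

lemma torus_smooth_sum:
  "open U \<Longrightarrow> (\<And>i. i \<in> A \<Longrightarrow> torus_smooth U (F i)) \<Longrightarrow> torus_smooth U (\<lambda>z. \<Sum>i\<in>A. F i z)"
  by (simp add: torus_smooth_def smooth_on_sum open_times_UNIV periodic_def)

lemma torus_smooth_character: "open U \<Longrightarrow> torus_smooth U (\<lambda>z :: 'n::finite coords. character m (snd z))"
  unfolding torus_smooth_def
proof (intro conjI ballI)
  assume U: "open U"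
  have "bounded_linear (\<lambda>z :: 'n::finite coords. \<i> * complex_of_real (rvec m \<bullet> snd z))"
    by (intro bounded_linear_compose[OF bounded_linear_mult_right]
        bounded_linear_compose[OF bounded_linear_of_real]
        bounded_linear_compose[OF bounded_linear_inner_right] bounded_linear_snd)
  then show "smooth_on (U \<times> UNIV) (\<lambda>z :: 'n::finite coords. character m (snd z))"
    unfolding character_def by (intro smooth_on_exp open_times_UNIV U)
qed (simp add: periodic_character)

lemma torus_smooth_cong:
  assumes "open U" "\<And>x \<theta>. x \<in> U \<Longrightarrow> F (x, \<theta>) = G (x, \<theta>)" "torus_smooth U F"
  shows "torus_smooth U G"
proof -
  have "smooth_on (U \<times> UNIV) G"
    by (rule smooth_on_cong[OF open_times_UNIV[OF assms(1)] _ torus_smooth_imp_smooth_on[OF assms(3)]])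
       (auto simp: assms(2))
  then show ?thesis using assms(2,3) by (simp add: torus_smooth_def)
qed

lemma torus_smooth_cnj: "open U \<Longrightarrow> torus_smooth U F \<Longrightarrow> torus_smooth U (\<lambda>z. cnj (F z))"
  by (simp add: torus_smooth_def smooth_on_cnj open_times_UNIV periodic_def)

lemma torus_smooth_slice_continuous:
  assumes "torus_smooth U G" "x \<in> U" shows "continuous_on A (\<lambda>\<theta>. G (x, \<theta>))"
proof -
  have "continuous_on (U \<times> UNIV) G"
    using assms(1) by (intro smooth_on_imp_continuous_on torus_smooth_imp_smooth_on)
  then show ?thesis
    by (rule continuous_on_compose2) (use assms(2) in \<open>auto intro!: continuous_intros\<close>)
qed

lemma pdiff_scaleR:
  assumes "torus_smooth U G" "x \<in> U"
  shows "pdiff (c *\<^sub>R v) G (x, \<theta>) = c *\<^sub>R pdiff v G (x, \<theta>)"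
  using linear_scale[OF has_derivative_linear[OF torus_smooth_has_derivative[OF assms]]] .

lemma torus_smooth_line_derivative:
  assumes "torus_smooth U G" "x + s *\<^sub>R fst v \<in> U"
  shows "((\<lambda>t. G ((x, \<theta>) + t *\<^sub>R v)) has_vector_derivative pdiff v G ((x, \<theta>) + s *\<^sub>R v)) (at s)"
proof -
  have "(G has_derivative (\<lambda>w. pdiff w G ((x, \<theta>) + s *\<^sub>R v))) (at ((x, \<theta>) + s *\<^sub>R v))"
    using torus_smooth_has_derivative[OF assms, of "\<theta> + s *\<^sub>R snd v"] by (cases v) simp
  moreover have "((\<lambda>t. (x, \<theta>) + t *\<^sub>R v) has_derivative (\<lambda>t. t *\<^sub>R v)) (at s)"
    by (auto intro!: derivative_eq_intros)
  ultimately have "((\<lambda>t. G ((x, \<theta>) + t *\<^sub>R v)) has_derivative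
      (\<lambda>t. pdiff (t *\<^sub>R v) G ((x, \<theta>) + s *\<^sub>R v))) (at s)"
    using has_derivative_compose by blast
  then show ?thesis
    using pdiff_scaleR[OF assms, of _ v "\<theta> + s *\<^sub>R snd v"]
    by (cases v) (simp add: has_vector_derivative_def)
qed

text \<open>Integration by parts in an angle has no boundary term, by periodicity; derivatives in the
  directions of the base are taken under the integral sign.\<close>

lemma torus_coeff_pdiff_angle:
  fixes G :: "'n::finite coords \<Rightarrow> complex"
  assumes "open U" "torus_smooth U G" "x \<in> U"
  shows "torus_coeff (\<lambda>\<theta>. pdiff (0, axis i 1) G (x, \<theta>)) q
    = \<i> * of_int (q $ i) * torus_coeff (\<lambda>\<theta>. G (x, \<theta>)) q"
proof (rule torus_coeff_deriv)
  show "((\<lambda>t. G (x, \<theta> + t *\<^sub>R axis i 1)) has_vector_derivative pdiff (0, axis i 1) G (x, \<theta>)) (at 0)" for \<theta>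
    using torus_smooth_line_derivative[OF assms(2), of x 0 "(0, axis i 1)" \<theta>] assms(3) by simp
qed (use assms in \<open>auto intro: torus_smooth_slice_continuous[OF torus_smooth_pdiff]
    torus_smooth_slice_continuous torus_smooth_imp_periodic\<close>)

lemma torus_coeff_has_vector_derivative:
  fixes G :: "'n::finite coords \<Rightarrow> complex"
  assumes U: "open U" "torus_smooth U G" and path: "\<And>s. s \<in> {0..1} \<Longrightarrow> x + s *\<^sub>R w \<in> U"
    and s: "s \<in> {0..1}"
  shows "((\<lambda>s. torus_coeff (\<lambda>\<theta>. G (x + s *\<^sub>R w, \<theta>)) q) has_vector_derivative
     torus_coeff (\<lambda>\<theta>. pdiff (w, 0) G (x + s *\<^sub>R w, \<theta>)) q) (at s within {0..1})"
proof -
  let ?c = "character (- q)"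
  have "continuous_on (U \<times> UNIV) (pdiff (w, 0) G)"
    using torus_smooth_pdiff[OF U] by (intro smooth_on_imp_continuous_on torus_smooth_imp_smooth_on)
  then have "continuous_on ({0..1} \<times> torus_box) (\<lambda>z. pdiff (w, 0) G (x + fst z *\<^sub>R w, snd z))"
    by (rule continuous_on_compose2) (use path in \<open>auto intro!: continuous_intros\<close>)
  moreover have "continuous_on ({0..1} \<times> torus_box) (\<lambda>z :: real \<times> (real^'n). ?c (snd z))"
    by (rule continuous_on_compose2[OF continuous_on_character[of UNIV]])
       (auto intro: continuous_on_snd continuous_on_id)
  ultimately have cont: "continuous_on ({0..1} \<times> torus_box)
      (\<lambda>z. pdiff (w, 0) G (x + fst z *\<^sub>R w, snd z) * ?c (snd z))"
    by (rule continuous_on_mult)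
  have "((\<lambda>s. integral torus_box (\<lambda>\<theta>. G (x + s *\<^sub>R w, \<theta>) * ?c \<theta>)) has_vector_derivative
     integral torus_box (\<lambda>\<theta>. pdiff (w, 0) G (x + s *\<^sub>R w, \<theta>) * ?c \<theta>)) (at s within {0..1})"
    unfolding torus_box_def
  proof (rule leibniz_rule_vector_derivative)
    fix r :: real and \<theta> :: "real^'n" assume r: "r \<in> {0..1}"
    have "((\<lambda>s. G (x + s *\<^sub>R w, \<theta>)) has_vector_derivative pdiff (w, 0) G (x + r *\<^sub>R w, \<theta>)) (at r)"
      using torus_smooth_line_derivative[OF U(2), of x r "(w, 0)" \<theta>] path[OF r] by simp
    from has_vector_derivative_mult[OF this has_vector_derivative_const[of "?c \<theta>"]]
    show "((\<lambda>s. G (x + s *\<^sub>R w, \<theta>) * ?c \<theta>) has_vector_derivative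
        pdiff (w, 0) G (x + r *\<^sub>R w, \<theta>) * ?c \<theta>) (at r within {0..1})"
      by (simp add: has_vector_derivative_at_within)
  next
    fix r :: real assume r: "r \<in> {0..1}"
    show "(\<lambda>\<theta>. G (x + r *\<^sub>R w, \<theta>) * ?c \<theta>) integrable_on cbox 0 (\<chi> i. 2 * pi)"
      unfolding torus_box_def[symmetric]
      by (intro integrable_on_torus_box continuous_on_mult continuous_on_character
          torus_smooth_slice_continuous[OF U(2) path[OF r]])
  next
    show "continuous_on ({0..1} \<times> cbox 0 (\<chi> i. 2 * pi))
        (\<lambda>(s, \<theta>). pdiff (w, 0) G (x + s *\<^sub>R w, \<theta>) * ?c \<theta>)"
      using cont by (simp add: case_prod_beta torus_box_def)
  qed (use s in auto)
  then show ?thesis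
    unfolding torus_coeff_def by (rule has_vector_derivative_mult_right)
qed

section \<open>Decay of Fourier coefficients\<close>

text \<open>The reciprocal is the symbol of the differential operator \<open>\<Prod> (1 - \<partial>\<^sub>i\<^sup>2)\<close> in the angles.\<close>

definition weight :: "int^'n \<Rightarrow> real" where
  "weight q = (\<Prod>i\<in>UNIV. 1 / (1 + (of_int (q $ i))\<^sup>2))"

lemma weight_pos: "weight q > 0"
  unfolding weight_def by (intro prod_pos ballI) (simp add: add_pos_nonneg)

lemma weight_le_1: "weight q \<le> 1"
  unfolding weight_def by (intro prod_le_1 ballI) (simp add: add_pos_nonneg)

lemma finite_bounded_lattice: "finite {m :: int^'n. \<forall>i. \<bar>m $ i\<bar> \<le> c}"
proof -
  have "{m :: int^'n. \<forall>i. \<bar>m $ i\<bar> \<le> c} \<subseteq> vec_lambda ` (UNIV \<rightarrow>\<^sub>E {- c..c})"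
  proof
    fix m :: "int^'n" assume m: "m \<in> {m. \<forall>i. \<bar>m $ i\<bar> \<le> c}"
    have "vec_nth m \<in> UNIV \<rightarrow>\<^sub>E {- c..c}" using m by (auto simp: abs_le_iff minus_le_iff)
    then show "m \<in> vec_lambda ` (UNIV \<rightarrow>\<^sub>E {- c..c})" by (rule rev_image_eqI) simp
  qed
  then show ?thesis by (rule finite_subset) (intro finite_imageI finite_PiE, auto)
qed

text \<open>Over a box of lattice points the sum factors into one-dimensional sums, each of which is
  bounded by the convergent series \<open>\<Sum> 1 / (1 + j\<^sup>2)\<close>.\<close>

lemma weight_sum_bound: "\<exists>W. \<forall>A :: (int^'n) set. finite A \<longrightarrow> sum weight A \<le> W"
proof -
  let ?f = "\<lambda>j::int. 1 / (1 + (of_int j)\<^sup>2) :: real"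
  let ?g = "\<lambda>j::nat. 1 / (1 + (of_nat j)\<^sup>2) :: real"
  have pos: "?f j \<ge> 0" "?g m \<ge> 0" for j m by simp_all
  have "summable ?g"
  proof (rule summable_comparison_test')
    show "summable (\<lambda>j. inverse ((of_nat j)\<^sup>2) :: real)" by (rule inverse_power_summable) simp
    show "norm (?g j) \<le> inverse ((of_nat j)\<^sup>2)" if "1 \<le> j" for j
      using that by (simp add: inverse_eq_divide frac_le)
  qed
  define B where "B = 2 * suminf ?g"
  have B: "sum ?f {- int L..int L} \<le> B" for L
  proof -
    have "{- int L..int L} \<subseteq> int ` {..L} \<union> (\<lambda>j. - int j) ` {..L}"
    proof
      fix j assume "j \<in> {- int L..int L}"
      then show "j \<in> int ` {..L} \<union> (\<lambda>j. - int j) ` {..L}"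
        by (cases "0 \<le> j") (auto simp: image_iff intro: bexI[of _ "nat j"] bexI[of _ "nat (- j)"])
    qed
    then have "sum ?f {- int L..int L} \<le> sum ?f (int ` {..L} \<union> (\<lambda>j. - int j) ` {..L})"
      by (intro sum_mono2) auto
    also have "\<dots> \<le> sum ?f (int ` {..L}) + sum ?f ((\<lambda>j. - int j) ` {..L})"
      by (subst sum_Un) (auto intro: sum_nonneg)
    also have "\<dots> = 2 * sum ?g {..L}"
      by (subst (1 2) sum.reindex) (auto simp: inj_on_def)
    also have "\<dots> \<le> B"
      unfolding B_def using sum_le_suminf[OF \<open>summable ?g\<close>, of "{..L}"] by simp
    finally show ?thesis .
  qed
  have "sum weight A \<le> B ^ CARD('n)" if "finite A" for A :: "(int^'n) set"
  proof -
    define L where "L = (\<Sum>q\<in>A. \<Sum>i\<in>UNIV. nat \<bar>q $ i\<bar>)"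
    have "\<bar>q $ i\<bar> \<le> int L" if "q \<in> A" for q i
    proof -
      have "nat \<bar>q $ i\<bar> \<le> (\<Sum>i\<in>UNIV. nat \<bar>q $ i\<bar>)" by (rule member_le_sum) auto
      also have "\<dots> \<le> L" unfolding L_def using that \<open>finite A\<close> by (intro member_le_sum) auto
      finally show ?thesis by simp
    qed
    then have sub: "A \<subseteq> vec_lambda ` (UNIV \<rightarrow>\<^sub>E {- int L..int L})"
    proof -
      assume le: "\<And>q i. q \<in> A \<Longrightarrow> \<bar>q $ i\<bar> \<le> int L"
      show ?thesis
      proof
        fix q assume "q \<in> A"
        then have "vec_nth q \<in> UNIV \<rightarrow>\<^sub>E {- int L..int L}" using le by (auto simp: abs_le_iff minus_le_iff)
        then show "q \<in> vec_lambda ` (UNIV \<rightarrow>\<^sub>E {- int L..int L})"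
          by (rule rev_image_eqI) simp
      qed
    qed
    have fin: "finite (UNIV \<rightarrow>\<^sub>E {- int L..int L} :: ('n \<Rightarrow> int) set)" by (intro finite_PiE) auto
    have "sum weight A \<le> sum weight (vec_lambda ` (UNIV \<rightarrow>\<^sub>E {- int L..int L}) :: (int^'n) set)"
      using sub fin by (intro sum_mono2) (auto intro: less_imp_le weight_pos)
    also have "\<dots> = (\<Sum>p\<in>(UNIV :: 'n set) \<rightarrow>\<^sub>E {- int L..int L}. \<Prod>i\<in>UNIV. ?f (p i))"
      by (subst sum.reindex) (auto simp: weight_def inj_on_def vec_lambda_inject)
    also have "\<dots> = (\<Prod>i\<in>(UNIV :: 'n set). sum ?f {- int L..int L})"
      by (subst prod_sum_PiE) auto
    also have "\<dots> \<le> B ^ CARD('n)"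
      using B[of L] by (simp add: power_mono sum_nonneg)
    finally show ?thesis .
  qed
  then show ?thesis by blast
qed

text \<open>Applying \<open>1 - \<partial>\<^sub>i\<^sup>2\<close> for every angle \<open>i\<close> multiplies the Fourier coefficients by the inverse
  weight, and yields a function that is bounded over compact sets.\<close>

lemma torus_coeff_decay:
  fixes G :: "'n::finite coords \<Rightarrow> complex"
  assumes U: "open U" "torus_smooth U G" and K: "compact K" "K \<subseteq> U"
  shows "\<exists>C\<ge>0. \<forall>x\<in>K. \<forall>q. cmod (torus_coeff (\<lambda>\<theta>. G (x, \<theta>)) q) \<le> C * weight q"
proof -
  define E where "E i G = (\<lambda>z. G z - pdiff (0, axis i 1) (pdiff (0, axis i 1) G) z)" for i and G :: "'n coords \<Rightarrow> complex"
  have "torus_smooth U (E i H)" if "torus_smooth U H" for i H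
    unfolding E_def
    by (rule torus_smooth_minus[OF U(1) that torus_smooth_pdiff[OF U(1) torus_smooth_pdiff[OF U(1) that]]])
  then have smooth: "torus_smooth U (foldr E xs G)" for xs
    using U(2) by (induction xs) simp_all
  have E: "torus_coeff (\<lambda>\<theta>. E i H (x, \<theta>)) q = (1 + (of_int (q $ i))\<^sup>2) * torus_coeff (\<lambda>\<theta>. H (x, \<theta>)) q"
    if H: "torus_smooth U H" and x: "x \<in> U" for i H x q
  proof -
    let ?D = "pdiff (0, axis i 1)"
    have "torus_coeff (\<lambda>\<theta>. E i H (x, \<theta>)) q
        = torus_coeff (\<lambda>\<theta>. H (x, \<theta>)) q - torus_coeff (\<lambda>\<theta>. ?D (?D H) (x, \<theta>)) q"
      unfolding E_def
      by (rule torus_coeff_diff[OF torus_smooth_slice_continuous[OF H x]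
            torus_smooth_slice_continuous[OF torus_smooth_pdiff[OF U(1) torus_smooth_pdiff[OF U(1) H]] x]])
    moreover have "torus_coeff (\<lambda>\<theta>. ?D (?D H) (x, \<theta>)) q = - ((of_int (q $ i))\<^sup>2) * torus_coeff (\<lambda>\<theta>. H (x, \<theta>)) q"
      unfolding torus_coeff_pdiff_angle[OF U(1) torus_smooth_pdiff[OF U(1) H] x]
        torus_coeff_pdiff_angle[OF U(1) H x]
      by (simp add: power2_eq_square mult_ac)
    ultimately show ?thesis
      by (simp add: distrib_right)
  qed
  have coeff: "torus_coeff (\<lambda>\<theta>. foldr E xs G (x, \<theta>)) q
      = (\<Prod>i\<in>set xs. 1 + (of_int (q $ i))\<^sup>2) * torus_coeff (\<lambda>\<theta>. G (x, \<theta>)) q"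
    if "x \<in> U" "distinct xs" for x q xs
    using that(2)
  proof (induction xs)
    case (Cons i xs)
    then show ?case using E[OF smooth[of xs] that(1), of i q] by (simp add: mult.assoc)
  qed simp
  obtain xs :: "'n list" where xs: "set xs = UNIV" "distinct xs"
    using finite_distinct_list[OF finite_class.finite_UNIV] by blast
  have w: "(\<Prod>i\<in>UNIV. 1 + (of_int (q $ i))\<^sup>2) = complex_of_real (1 / weight q)" for q :: "int^'n"
  proof -
    define a where "a i = 1 + (real_of_int (q $ i))\<^sup>2" for i
    have a: "a i \<noteq> 0" for i unfolding a_def by (smt (verit) zero_le_power2)
    have "weight q * prod a UNIV = (\<Prod>i\<in>UNIV. 1 / a i * a i)"
      unfolding weight_def a_def by (rule prod.distrib[symmetric])
    also have "\<dots> = 1" by (rule prod.neutral) (simp add: a)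
    finally have "1 / weight q = prod a UNIV"
      using weight_pos[of q] by (simp add: field_simps)
    moreover have "(\<Prod>i\<in>UNIV. 1 + (of_int (q $ i))\<^sup>2) = complex_of_real (prod a UNIV)"
      by (simp add: a_def)
    ultimately show ?thesis by simp
  qed
  have "compact (K \<times> torus_box)"
    unfolding torus_box_def by (rule compact_Times[OF K(1) compact_cbox])
  moreover have "continuous_on (K \<times> torus_box) (foldr E xs G)"
    by (rule continuous_on_subset[OF smooth_on_imp_continuous_on[OF torus_smooth_imp_smooth_on[OF smooth]]])
       (use K(2) in auto)
  ultimately have "bounded (foldr E xs G ` (K \<times> torus_box))"
    by (intro compact_imp_bounded compact_continuous_image)
  then obtain C where "\<forall>y\<in>foldr E xs G ` (K \<times> torus_box). cmod y \<le> C"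
    unfolding bounded_iff by blast
  then have C: "cmod (foldr E xs G (x, \<theta>)) \<le> C" if "x \<in> K" "\<theta> \<in> torus_box" for x \<theta>
    using that by blast
  have "cmod (torus_coeff (\<lambda>\<theta>. G (x, \<theta>)) q) \<le> max C 0 * weight q" if x: "x \<in> K" for x q
  proof -
    have "cmod (torus_coeff (\<lambda>\<theta>. foldr E xs G (x, \<theta>)) q) \<le> C"
      using x K(2) by (intro norm_torus_coeff_le torus_smooth_slice_continuous[OF smooth] C) auto
    moreover have "x \<in> U" using x K by auto
    ultimately have "cmod (torus_coeff (\<lambda>\<theta>. G (x, \<theta>)) q) \<le> C * weight q"
      using weight_pos[of q] by (simp add: coeff xs w norm_divide divide_le_eq)
    also have "\<dots> \<le> max C 0 * weight q"
      using weight_pos[of q] by (intro mult_right_mono) auto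
    finally show ?thesis .
  qed
  then show ?thesis by (intro exI[of _ "max C 0"]) auto
qed

section \<open>Taylor expansion of Fourier coefficients\<close>

definition slice_coeff :: "('n::finite coords \<Rightarrow> complex) \<Rightarrow> int^'n \<Rightarrow> real^'n \<Rightarrow> complex" where
  "slice_coeff G q x = torus_coeff (\<lambda>\<theta>. G (x, \<theta>)) q"

lemma slice_coeff_line_derivative:
  fixes G :: "'n::finite coords \<Rightarrow> complex"
  assumes U: "open U" "torus_smooth U G" and path: "\<And>s. s \<in> {0..1} \<Longrightarrow> x + s *\<^sub>R (c *\<^sub>R v) \<in> U"
    and s: "s \<in> {0..1}"
  shows "((\<lambda>s. slice_coeff G q (x + s *\<^sub>R (c *\<^sub>R v))) has_vector_derivative
     of_real c * slice_coeff (pdiff (v, 0) G) q (x + s *\<^sub>R (c *\<^sub>R v))) (at s within {0..1})"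
proof -
  have "pdiff (c *\<^sub>R v, 0) G (x + s *\<^sub>R (c *\<^sub>R v), \<theta>) = c *\<^sub>R pdiff (v, 0) G (x + s *\<^sub>R (c *\<^sub>R v), \<theta>)" for \<theta>
    using pdiff_scaleR[OF U(2) path[OF s], of c "(v, 0)" \<theta>] by simp
  then have "torus_coeff (\<lambda>\<theta>. pdiff (c *\<^sub>R v, 0) G (x + s *\<^sub>R (c *\<^sub>R v), \<theta>)) q
      = of_real c * slice_coeff (pdiff (v, 0) G) q (x + s *\<^sub>R (c *\<^sub>R v))"
    by (simp add: torus_coeff_def slice_coeff_def scaleR_conv_of_real mult.assoc)
  then show ?thesis
    using torus_coeff_has_vector_derivative[OF U path s, of q] by (simp add: slice_coeff_def)
qed

text \<open>The integral form of the remainder contains a Fourier coefficient of a derivative of \<open>G\<close>; this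
  is why the error carries the summable factor \<open>weight q\<close>, with a constant independent of \<open>q\<close>.\<close>

lemma slice_coeff_taylor_line:
  fixes G :: "'n::finite coords \<Rightarrow> complex"
  assumes U: "open U" "torus_smooth U G" and K: "compact K" "K \<subseteq> U"
  shows "\<exists>C\<ge>0. \<forall>q x y. (\<forall>s\<in>{0..1}. x + s *\<^sub>R (y *\<^sub>R v) \<in> K) \<longrightarrow>
     cmod (slice_coeff G q (x + y *\<^sub>R v)
         - (\<Sum>a\<le>N. of_real (y ^ a / fact a) * slice_coeff ((pdiff (v, 0) ^^ a) G) q x))
       \<le> C * weight q * \<bar>y\<bar> ^ Suc N"
proof -
  let ?D = "\<lambda>a. (pdiff (v, 0) ^^ a) G"
  obtain C where C: "C \<ge> 0" "\<And>x q. x \<in> K \<Longrightarrow> cmod (slice_coeff (?D (Suc N)) q x) \<le> C * weight q"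
    using torus_coeff_decay[OF U(1) torus_smooth_pdiff_pow[OF U, of "Suc N" "(v, 0)"] K]
    unfolding slice_coeff_def by blast
  have "cmod (slice_coeff G q (x + y *\<^sub>R v)
         - (\<Sum>a\<le>N. of_real (y ^ a / fact a) * slice_coeff (?D a) q x)) \<le> C * weight q * \<bar>y\<bar> ^ Suc N"
    if path: "\<forall>s\<in>{0..1}. x + s *\<^sub>R (y *\<^sub>R v) \<in> K" for q x y
  proof -
    let ?Df = "\<lambda>a s. of_real (y ^ a) * slice_coeff (?D a) q (x + s *\<^sub>R (y *\<^sub>R v))"
    have deriv: "(?Df a has_vector_derivative ?Df (Suc a) s) (at s within {0..1})" if "s \<in> {0..1}" for a s
    proof -
      have "((\<lambda>s. slice_coeff (?D a) q (x + s *\<^sub>R (y *\<^sub>R v))) has_vector_derivative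
          of_real y * slice_coeff (pdiff (v, 0) (?D a)) q (x + s *\<^sub>R (y *\<^sub>R v))) (at s within {0..1})"
        by (rule slice_coeff_line_derivative[OF U(1) torus_smooth_pdiff_pow[OF U] _ that])
           (use path K(2) in auto)
      from has_vector_derivative_mult_right[OF this, of "of_real (y ^ a)"]
      show ?thesis by (simp add: mult_ac)
    qed
    have int: "((\<lambda>s. ((1 - s) ^ (Suc N - 1) / fact (Suc N - 1)) *\<^sub>R ?Df (Suc N) s) has_integral
        ?Df 0 1 - (\<Sum>a<Suc N. ((1 - 0) ^ a / fact a) *\<^sub>R ?Df a 0)) {0..1}"
      by (rule Taylor_has_integral) (use deriv in auto)
    have "norm (?Df 0 1 - (\<Sum>a<Suc N. ((1 - 0) ^ a / fact a) *\<^sub>R ?Df a 0))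
        \<le> C * weight q * \<bar>y\<bar> ^ Suc N * measure lborel {0..1::real}"
    proof (rule has_integral_bound_real[OF _ finite.emptyI int])
      show "0 \<le> C * weight q * \<bar>y\<bar> ^ Suc N" using C(1) weight_pos[of q] by simp
      fix s :: real assume "s \<in> {0..1} - {}"
      then have s: "s \<in> {0..1}" by simp
      have "norm (?Df (Suc N) s) = \<bar>y\<bar> ^ Suc N * cmod (slice_coeff (?D (Suc N)) q (x + s *\<^sub>R (y *\<^sub>R v)))"
        unfolding norm_mult norm_of_real power_abs ..
      also have "\<dots> \<le> \<bar>y\<bar> ^ Suc N * (C * weight q)"
        using path s by (intro mult_left_mono C(2)) auto
      finally have b: "norm (?Df (Suc N) s) \<le> C * weight q * \<bar>y\<bar> ^ Suc N" by (simp add: mult_ac)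
      have "\<bar>(1 - s) ^ (Suc N - 1) / fact (Suc N - 1)\<bar> \<le> 1"
        using s by (simp add: abs_mult power_abs divide_le_eq power_le_one order_trans[OF _ fact_ge_1])
      from mult_mono[OF this b]
      show "norm (((1 - s) ^ (Suc N - 1) / fact (Suc N - 1)) *\<^sub>R ?Df (Suc N) s) \<le> C * weight q * \<bar>y\<bar> ^ Suc N"
        unfolding norm_scaleR by simp
    qed
    moreover have "?Df 0 1 = slice_coeff G q (x + y *\<^sub>R v)" by simp
    moreover have "(\<Sum>a<Suc N. ((1 - 0) ^ a / fact a) *\<^sub>R ?Df a 0)
        = (\<Sum>a\<le>N. of_real (y ^ a / fact a) * slice_coeff (?D a) q x)"
      unfolding lessThan_Suc_atMost by (rule sum.cong) (simp_all add: scaleR_conv_of_real)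
    ultimately show ?thesis by simp
  qed
  then show ?thesis using C(1) by blast
qed

text \<open>The condition off \<open>A\<close> makes multi-indices on a subset of the coordinates into functions on all
  of them, so that a further coordinate can be added by a function update.\<close>

definition multi_indices :: "'i set \<Rightarrow> nat \<Rightarrow> ('i \<Rightarrow> nat) set" where
  "multi_indices A N = {I. (\<forall>i. i \<notin> A \<longrightarrow> I i = 0) \<and> sum I A \<le> N}"

lemma finite_multi_indices: "finite A \<Longrightarrow> finite (multi_indices A N)"
proof -
  assume A: "finite A"
  have "multi_indices A N \<subseteq> {I. \<forall>i. (i \<in> A \<longrightarrow> I i \<in> {..N}) \<and> (i \<notin> A \<longrightarrow> I i = 0)}"
  proof
    fix I assume I: "I \<in> multi_indices A N"
    have "I i \<le> N" if "i \<in> A" for i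
      using member_le_sum[OF that _ A, of I] I by (simp add: multi_indices_def)
    then show "I \<in> {I. \<forall>i. (i \<in> A \<longrightarrow> I i \<in> {..N}) \<and> (i \<notin> A \<longrightarrow> I i = 0)}"
      using I by (simp add: multi_indices_def)
  qed
  moreover have "finite {I. \<forall>i. (i \<in> A \<longrightarrow> I i \<in> {..N}) \<and> (i \<notin> A \<longrightarrow> I i = 0)}"
    using A by (intro finite_set_of_finite_funs) auto
  ultimately show ?thesis by (rule finite_subset)
qed

lemma sum_multi_indices_insert:
  fixes f :: "('i \<Rightarrow> nat) \<Rightarrow> 'a::comm_monoid_add"
  assumes A: "finite A" "i \<notin> A"
  shows "(\<Sum>I\<in>multi_indices A N. \<Sum>a\<le>N - sum I A. f (I(i := a))) = sum f (multi_indices (insert i A) N)"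
proof -
  have upd: "sum (I(i := a)) A = sum I A" for I :: "'i \<Rightarrow> nat" and a
    using A(2) by (intro sum.cong) auto
  have "(\<Sum>I\<in>multi_indices A N. \<Sum>a\<le>N - sum I A. f (I(i := a)))
      = (\<Sum>(I, a)\<in>Sigma (multi_indices A N) (\<lambda>I. {..N - sum I A}). f (I(i := a)))"
    using A(1) by (subst sum.Sigma) (auto simp: finite_multi_indices)
  also have "\<dots> = sum f (multi_indices (insert i A) N)"
  proof (rule sum.reindex_bij_witness[where i = "\<lambda>J. (J(i := 0), J i)" and j = "\<lambda>(I, a). I(i := a)"])
    fix J assume "J \<in> multi_indices (insert i A) N"
    then have "\<forall>j. j \<notin> insert i A \<longrightarrow> J j = 0" "J i + sum J A \<le> N"
      using A by (auto simp: multi_indices_def)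
    then show "(J(i := 0), J i) \<in> Sigma (multi_indices A N) (\<lambda>I. {..N - sum I A})"
      using upd[of J 0] by (auto simp: multi_indices_def)
  next
    fix P assume "P \<in> Sigma (multi_indices A N) (\<lambda>I. {..N - sum I A})"
    then obtain I a where P: "P = (I, a)" "\<forall>j. j \<notin> A \<longrightarrow> I j = 0" "sum I A \<le> N" "a \<le> N - sum I A"
      by (auto simp: multi_indices_def)
    then show "(case P of (I, a) \<Rightarrow> I(i := a)) \<in> multi_indices (insert i A) N"
      using upd[of I a] A by (auto simp: multi_indices_def)
    show "(((case P of (I, a) \<Rightarrow> I(i := a))(i := 0)), (case P of (I, a) \<Rightarrow> I(i := a)) i) = P"
      using P A(2) by (auto simp: fun_eq_iff)
  qed auto
  finally show ?thesis .
qed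

lemma foldr_pow_cong: "(\<And>i. i \<in> set xs \<Longrightarrow> I i = J i) \<Longrightarrow> foldr (\<lambda>i. D i ^^ I i) xs G = foldr (\<lambda>i. D i ^^ J i) xs G"
  by (induction xs) auto

text \<open>The expansion is carried out one coordinate after the other, in the order in which the
  iterated derivatives are taken; in this way partial derivatives are never interchanged. The box
  condition on \<open>K\<close> keeps the whole broken path from \<open>x\<close> to its end point inside \<open>K\<close>.\<close>

lemma slice_coeff_taylor:
  fixes G :: "'n::finite coords \<Rightarrow> complex"
  assumes U: "open U" "torus_smooth U G" and K: "compact K" "K \<subseteq> U" and xs: "distinct xs"
  defines "D \<equiv> \<lambda>i. pdiff (axis i 1, 0)"
  shows "\<exists>C\<ge>0. \<forall>q x y Y. (\<forall>i. \<bar>y $ i\<bar> \<le> Y) \<longrightarrow> (\<forall>z. (\<forall>i. \<bar>z $ i - x $ i\<bar> \<le> \<bar>y $ i\<bar>) \<longrightarrow> z \<in> K) \<longrightarrow>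
     cmod (slice_coeff G q (x + (\<Sum>i\<in>set xs. (y $ i) *\<^sub>R axis i 1))
       - (\<Sum>I\<in>multi_indices (set xs) N. of_real (\<Prod>i\<in>set xs. (y $ i) ^ I i / fact (I i)) *
           slice_coeff (foldr (\<lambda>i. D i ^^ I i) xs G) q x))
     \<le> C * weight q * Y ^ Suc N"
  using xs
proof (induction xs)
  case Nil
  have "multi_indices {} N = {\<lambda>_ :: 'n. 0}" by (auto simp: multi_indices_def)
  then show ?case
    using weight_pos by (intro exI[of _ 0]) simp
next
  case (Cons i xs)
  let ?A = "set xs"
  let ?H = "\<lambda>I. foldr (\<lambda>i. D i ^^ I i) xs G"
  let ?MI = "multi_indices ?A N"
  have iA: "i \<notin> ?A" and dxs: "distinct xs" using Cons.prems by auto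
  have fin: "finite ?MI" by (simp add: finite_multi_indices)
  define M where "M I y = (\<Prod>j\<in>?A. (y $ j) ^ I j / fact (I j))" for I :: "'n \<Rightarrow> nat" and y :: "real^'n"
  obtain C1 where C1: "C1 \<ge> 0" "\<And>q x y Y. (\<forall>i. \<bar>y $ i\<bar> \<le> Y) \<Longrightarrow> (\<forall>z. (\<forall>i. \<bar>z $ i - x $ i\<bar> \<le> \<bar>y $ i\<bar>) \<longrightarrow> z \<in> K) \<Longrightarrow>
     cmod (slice_coeff G q (x + (\<Sum>i\<in>?A. (y $ i) *\<^sub>R axis i 1))
       - (\<Sum>I\<in>?MI. of_real (M I y) * slice_coeff (?H I) q x)) \<le> C1 * weight q * Y ^ Suc N"
    unfolding M_def using Cons.IH[OF dxs] by blast
  have sm: "torus_smooth U (?H I)" for I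
    unfolding D_def by (rule torus_smooth_foldr_pdiff[OF U])
  have "\<forall>I. \<exists>C\<ge>0. \<forall>q x y. (\<forall>s\<in>{0..1}. x + s *\<^sub>R (y *\<^sub>R axis i 1) \<in> K) \<longrightarrow>
     cmod (slice_coeff (?H I) q (x + y *\<^sub>R axis i 1)
         - (\<Sum>a\<le>N - sum I ?A. of_real (y ^ a / fact a) * slice_coeff ((D i ^^ a) (?H I)) q x))
       \<le> C * weight q * \<bar>y\<bar> ^ Suc (N - sum I ?A)"
    unfolding D_def using slice_coeff_taylor_line[OF U(1) sm[unfolded D_def] K] by blast
  from choice[OF this] obtain CI where CI': "\<forall>I. 0 \<le> CI I \<and> (\<forall>q x y. (\<forall>s\<in>{0..1}. x + s *\<^sub>R (y *\<^sub>R axis i 1) \<in> K) \<longrightarrow>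
     cmod (slice_coeff (?H I) q (x + y *\<^sub>R axis i 1)
         - (\<Sum>a\<le>N - sum I ?A. of_real (y ^ a / fact a) * slice_coeff ((D i ^^ a) (?H I)) q x))
       \<le> CI I * weight q * \<bar>y\<bar> ^ Suc (N - sum I ?A))" ..
  have CI: "CI I \<ge> 0"
    "(\<forall>s\<in>{0..1}. x + s *\<^sub>R (y *\<^sub>R axis i 1) \<in> K) \<Longrightarrow>
     cmod (slice_coeff (?H I) q (x + y *\<^sub>R axis i 1)
         - (\<Sum>a\<le>N - sum I ?A. of_real (y ^ a / fact a) * slice_coeff ((D i ^^ a) (?H I)) q x))
       \<le> CI I * weight q * \<bar>y\<bar> ^ Suc (N - sum I ?A)" for I q x y
    using CI'[rule_format, of I] by simp_all
  show ?case
  proof (intro exI[of _ "C1 + sum CI ?MI"] conjI allI impI)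
    show "0 \<le> C1 + sum CI ?MI" using C1(1) CI(1) by (simp add: sum_nonneg)
    fix q :: "int^'n" and x y :: "real^'n" and Y :: real
    assume Y: "\<forall>i. \<bar>y $ i\<bar> \<le> Y" and near: "\<forall>z. (\<forall>i. \<bar>z $ i - x $ i\<bar> \<le> \<bar>y $ i\<bar>) \<longrightarrow> z \<in> K"
    have Y0: "0 \<le> Y" using Y abs_ge_zero order_trans by blast
    let ?x' = "x + (y $ i) *\<^sub>R axis i 1"
    define y' where "y' = (\<chi> j. if j = i then 0 else y $ j)"
    have y'A: "j \<in> ?A \<Longrightarrow> y' $ j = y $ j" for j using iA by (auto simp: y'_def)
    have M': "M I y' = M I y" for I unfolding M_def by (intro prod.cong) (auto simp: y'A)
    have S': "(\<Sum>j\<in>?A. (y' $ j) *\<^sub>R axis j (1::real)) = (\<Sum>j\<in>?A. (y $ j) *\<^sub>R axis j 1)"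
      by (intro sum.cong) (auto simp: y'A)
    have "cmod (slice_coeff G q (?x' + (\<Sum>j\<in>?A. (y' $ j) *\<^sub>R axis j 1))
       - (\<Sum>I\<in>?MI. of_real (M I y') * slice_coeff (?H I) q ?x')) \<le> C1 * weight q * Y ^ Suc N"
    proof (rule C1(2))
      show "\<forall>j. \<bar>y' $ j\<bar> \<le> Y" using Y Y0 by (simp add: y'_def)
      show "\<forall>z. (\<forall>j. \<bar>z $ j - ?x' $ j\<bar> \<le> \<bar>y' $ j\<bar>) \<longrightarrow> z \<in> K"
      proof (intro allI impI)
        fix z assume z: "\<forall>j. \<bar>z $ j - ?x' $ j\<bar> \<le> \<bar>y' $ j\<bar>"
        have "\<bar>z $ j - x $ j\<bar> \<le> \<bar>y $ j\<bar>" for j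
          using z[rule_format, of j] by (cases "j = i") (auto simp: y'_def axis_def)
        then show "z \<in> K" using near by blast
      qed
    qed
    then have 1: "cmod (slice_coeff G q (?x' + (\<Sum>j\<in>?A. (y $ j) *\<^sub>R axis j 1))
       - (\<Sum>I\<in>?MI. of_real (M I y) * slice_coeff (?H I) q ?x')) \<le> C1 * weight q * Y ^ Suc N"
      unfolding M' S' .
    let ?T = "\<lambda>I. \<Sum>a\<le>N - sum I ?A. of_real ((y $ i) ^ a / fact a) * slice_coeff ((D i ^^ a) (?H I)) q x"
    have 2: "cmod ((\<Sum>I\<in>?MI. of_real (M I y) * slice_coeff (?H I) q ?x') - (\<Sum>I\<in>?MI. of_real (M I y) * ?T I))
        \<le> sum CI ?MI * weight q * Y ^ Suc N"
    proof -
      have "cmod (of_real (M I y) * slice_coeff (?H I) q ?x' - of_real (M I y) * ?T I)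
          \<le> CI I * weight q * Y ^ Suc N" if I: "I \<in> ?MI" for I
      proof -
        have "\<forall>s\<in>{0..1}. x + s *\<^sub>R ((y $ i) *\<^sub>R axis i 1) \<in> K"
        proof
          fix s :: real assume s: "s \<in> {0..1}"
          have "\<bar>s * y $ i\<bar> \<le> \<bar>y $ i\<bar>" using s by (simp add: abs_mult mult_left_le_one_le)
          then show "x + s *\<^sub>R ((y $ i) *\<^sub>R axis i 1) \<in> K"
            using near by (auto simp: axis_def)
        qed
        note CI(2)[OF this, of I q]
        also have "CI I * weight q * \<bar>y $ i\<bar> ^ Suc (N - sum I ?A) \<le> CI I * weight q * Y ^ Suc (N - sum I ?A)"
          using CI(1) weight_pos[of q] Y by (intro mult_left_mono power_mono) (auto intro: less_imp_le)
        finally have T: "cmod (slice_coeff (?H I) q ?x' - ?T I) \<le> CI I * weight q * Y ^ Suc (N - sum I ?A)" .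
        have "\<bar>M I y\<bar> \<le> (\<Prod>j\<in>?A. Y ^ I j)"
          unfolding M_def abs_prod
        proof (rule prod_mono, intro conjI)
          fix j
          have "\<bar>y $ j\<bar> ^ I j / fact (I j) \<le> Y ^ I j / 1"
            using Y Y0 by (intro frac_le power_mono) (auto simp: fact_ge_1)
          then show "\<bar>(y $ j) ^ I j / fact (I j)\<bar> \<le> Y ^ I j" by (simp add: power_abs)
        qed simp
        then have M: "\<bar>M I y\<bar> \<le> Y ^ sum I ?A" by (simp add: power_sum)
        have "cmod (of_real (M I y) * slice_coeff (?H I) q ?x' - of_real (M I y) * ?T I)
            = \<bar>M I y\<bar> * cmod (slice_coeff (?H I) q ?x' - ?T I)"
          by (simp add: norm_mult flip: right_diff_distrib)
        also have "\<dots> \<le> Y ^ sum I ?A * (CI I * weight q * Y ^ Suc (N - sum I ?A))"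
          using M T Y0 by (intro mult_mono) auto
        also have "\<dots> = CI I * weight q * Y ^ (sum I ?A + Suc (N - sum I ?A))"
          by (simp add: power_add mult_ac)
        also have "sum I ?A + Suc (N - sum I ?A) = Suc N" using I by (simp add: multi_indices_def)
        finally show ?thesis .
      qed
      then have "cmod (\<Sum>I\<in>?MI. of_real (M I y) * slice_coeff (?H I) q ?x' - of_real (M I y) * ?T I)
          \<le> (\<Sum>I\<in>?MI. CI I * weight q * Y ^ Suc N)"
        by (rule sum_norm_le)
      then show ?thesis by (simp only: sum_subtractf sum_distrib_right)
    qed
    have 3: "(\<Sum>I\<in>?MI. of_real (M I y) * ?T I) = (\<Sum>I\<in>multi_indices (set (i # xs)) N.
        of_real (\<Prod>i\<in>set (i # xs). (y $ i) ^ I i / fact (I i)) *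
           slice_coeff (foldr (\<lambda>i. D i ^^ I i) (i # xs) G) q x)" (is "_ = (\<Sum>I\<in>_. ?f I)")
    proof -
      have f: "?f (I(i := a)) = of_real (M I y) * (of_real ((y $ i) ^ a / fact a) * slice_coeff ((D i ^^ a) (?H I)) q x)"
        for I a
      proof -
        have "(\<Prod>j\<in>?A. (y $ j) ^ (I(i := a)) j / fact ((I(i := a)) j)) = M I y"
          unfolding M_def using iA by (intro prod.cong) auto
        moreover have "?H (I(i := a)) = ?H I" using iA by (intro foldr_pow_cong) auto
        ultimately show ?thesis using iA by (simp add: mult_ac)
      qed
      have "(\<Sum>I\<in>?MI. of_real (M I y) * ?T I) = (\<Sum>I\<in>?MI. \<Sum>a\<le>N - sum I ?A. ?f (I(i := a)))"
        unfolding f sum_distrib_left ..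
      also have "\<dots> = (\<Sum>I\<in>multi_indices (insert i ?A) N. ?f I)"
        by (rule sum_multi_indices_insert) (use iA in auto)
      finally show ?thesis by simp
    qed
    have x: "x + (\<Sum>j\<in>set (i # xs). (y $ j) *\<^sub>R axis j 1) = ?x' + (\<Sum>j\<in>?A. (y $ j) *\<^sub>R axis j 1)"
      using iA by (simp add: add.assoc)
    show "cmod (slice_coeff G q (x + (\<Sum>j\<in>set (i # xs). (y $ j) *\<^sub>R axis j 1))
        - (\<Sum>I\<in>multi_indices (set (i # xs)) N. ?f I)) \<le> (C1 + sum CI ?MI) * weight q * Y ^ Suc N"
      unfolding x 3[symmetric]
      using norm_triangle_le[OF add_mono[OF 1 2]] by (simp add: distrib_right)
  qed
qed

section \<open>Trigonometric polynomials in the angles\<close>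

lemma torus_box_representative: "\<exists>\<theta>'\<in>torus_box. \<exists>t\<in>torus_lattice. \<theta> = \<theta>' + t" for \<theta> :: "real^'n"
proof -
  define z :: "int^'n" where "z = (\<chi> i. \<lfloor>\<theta> $ i / (2 * pi)\<rfloor>)"
  have "0 \<le> \<theta> $ i - 2 * pi * of_int (z $ i) \<and> \<theta> $ i - 2 * pi * of_int (z $ i) \<le> 2 * pi" for i
  proof -
    have "of_int (z $ i) \<le> \<theta> $ i / (2 * pi)" "\<theta> $ i / (2 * pi) \<le> of_int (z $ i) + 1"
      unfolding z_def by simp_all
    then show ?thesis by (simp add: field_simps)
  qed
  then have "\<theta> - (2 * pi) *\<^sub>R rvec z \<in> torus_box" by (simp add: torus_box_def mem_box_cart)
  then show ?thesis
    by (intro bexI[of _ "\<theta> - (2 * pi) *\<^sub>R rvec z"] bexI[of _ "(2 * pi) *\<^sub>R rvec z"])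
       (auto simp: torus_lattice_def)
qed

text \<open>The difference of the two sides has no Fourier coefficients, so it vanishes on the period box
  by uniqueness and everywhere else by periodicity.\<close>

lemma trig_expansion:
  fixes G :: "'n::finite coords \<Rightarrow> complex"
  assumes G: "torus_smooth U G" and x: "x \<in> U" and B: "finite B"
    and zero: "\<And>p. p \<notin> B \<Longrightarrow> slice_coeff G p x = 0"
  shows "G (x, \<theta>) = (\<Sum>p\<in>B. slice_coeff G p x * character p \<theta>)"
proof -
  define u where "u = (\<lambda>\<theta>. \<Sum>p\<in>B. slice_coeff G p x * character p \<theta>)"
  have contG: "continuous_on A (\<lambda>\<theta>. G (x, \<theta>))" for A
    by (rule torus_smooth_slice_continuous[OF G x])
  have contu: "continuous_on A u" for A
    unfolding u_def by (intro continuous_on_sum continuous_on_mult_left continuous_on_character)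
  have coeff: "torus_coeff u p = slice_coeff G p x" for p
  proof -
    have "torus_coeff u p = (\<Sum>r\<in>B. slice_coeff G r x * torus_coeff (character r) p)"
      using torus_coeff_sum[OF B, of character "\<lambda>r. slice_coeff G r x" p] continuous_on_character
      unfolding u_def by blast
    also have "\<dots> = (\<Sum>r\<in>B. if r = p then slice_coeff G p x else 0)"
      by (intro sum.cong refl) (simp add: torus_coeff_character)
    finally show ?thesis using B zero[of p] by (simp add: sum.delta')
  qed
  have eq: "G (x, \<theta>) - u \<theta> = 0" if "\<theta> \<in> torus_box" for \<theta>
  proof (rule torus_coeff_eq_0_imp_eq_0[OF _ _ that, where u = "\<lambda>\<theta>. G (x, \<theta>) - u \<theta>"])
    show "continuous_on torus_box (\<lambda>\<theta>. G (x, \<theta>) - u \<theta>)" by (intro continuous_on_diff contG contu)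
    fix p
    show "torus_coeff (\<lambda>\<theta>. G (x, \<theta>) - u \<theta>) p = 0"
      using torus_coeff_diff[OF contG contu, of p] coeff[of p] by (simp add: slice_coeff_def)
  qed
  obtain \<theta>' t where t: "\<theta>' \<in> torus_box" "t \<in> torus_lattice" "\<theta> = \<theta>' + t"
    using torus_box_representative by blast
  have "character p (\<theta>' + t) = character p \<theta>'" for p
    using periodic_character[of p] t(2) by (simp add: periodic_def)
  then have "u \<theta> = u \<theta>'" by (simp add: u_def t(3))
  moreover have "G (x, \<theta>) = G (x, \<theta>')"
    using torus_smooth_imp_periodic[OF G x] t by (simp add: periodic_def)
  ultimately show ?thesis using eq[OF t(1)] by (simp add: u_def)
qed

lemma trig_pdiff:
  fixes G :: "'n::finite coords \<Rightarrow> complex"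
  assumes G: "torus_smooth U G" and x: "x \<in> U"
    and trig: "\<And>\<theta>. G (x, \<theta>) = (\<Sum>p\<in>B. c p * character p \<theta>)"
  shows "pdiff (0, axis i 1) G (x, \<theta>) = (\<Sum>p\<in>B. (\<i> * of_int (p $ i) * c p) * character p \<theta>)"
proof -
  have "((\<lambda>t. G (x, \<theta> + t *\<^sub>R axis i 1)) has_vector_derivative pdiff (0, axis i 1) G (x, \<theta>)) (at 0)"
    using torus_smooth_line_derivative[OF G, of x 0 "(0, axis i 1)" \<theta>] x by simp
  moreover have "((\<lambda>t. G (x, \<theta> + t *\<^sub>R axis i 1)) has_vector_derivative
      (\<Sum>p\<in>B. c p * (\<i> * of_int (p $ i) * character p \<theta>))) (at 0)"
    unfolding trig
    by (intro has_vector_derivative_sum has_vector_derivative_mult_right character_has_vector_derivative)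
  ultimately have "pdiff (0, axis i 1) G (x, \<theta>) = (\<Sum>p\<in>B. c p * (\<i> * of_int (p $ i) * character p \<theta>))"
    by (rule vector_derivative_unique_at)
  then show ?thesis by (simp add: mult_ac)
qed

lemma trig_pdiff_pow:
  fixes G :: "'n::finite coords \<Rightarrow> complex"
  assumes U: "open U" "torus_smooth U G" and x: "x \<in> U"
    and trig: "\<And>\<theta>. G (x, \<theta>) = (\<Sum>p\<in>B. c p * character p \<theta>)"
  shows "(pdiff (0, axis i 1) ^^ a) G (x, \<theta>) = (\<Sum>p\<in>B. ((\<i> * of_int (p $ i)) ^ a * c p) * character p \<theta>)"
proof (induction a arbitrary: \<theta>)
  case (Suc a)
  show ?case
    using trig_pdiff[OF torus_smooth_pdiff_pow[OF U, of a "(0, axis i 1)"] x Suc.IH, of i \<theta>]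
    by (simp add: mult_ac)
qed (simp add: trig)

lemma trig_foldr_pdiff:
  fixes G :: "'n::finite coords \<Rightarrow> complex"
  assumes U: "open U" "torus_smooth U G" and x: "x \<in> U"
    and trig: "\<And>\<theta>. G (x, \<theta>) = (\<Sum>p\<in>B. c p * character p \<theta>)" and xs: "distinct xs"
  shows "foldr (\<lambda>i. pdiff (0, axis i 1) ^^ I i) xs G (x, \<theta>)
    = (\<Sum>p\<in>B. ((\<Prod>i\<in>set xs. (\<i> * of_int (p $ i)) ^ I i) * c p) * character p \<theta>)"
  using xs
proof (induction xs arbitrary: \<theta>)
  case (Cons i xs)
  have "\<And>\<theta>. foldr (\<lambda>i. pdiff (0, axis i 1) ^^ I i) xs G (x, \<theta>)
    = (\<Sum>p\<in>B. ((\<Prod>i\<in>set xs. (\<i> * of_int (p $ i)) ^ I i) * c p) * character p \<theta>)"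
    using Cons by simp
  from trig_pdiff_pow[OF U(1) torus_smooth_foldr_pdiff[OF U] x this, where i = i and a = "I i" and \<theta> = \<theta>] Cons.prems
  show ?case by (simp add: mult_ac)
qed (simp add: trig)

section \<open>The star product in action-angle coordinates\<close>

definition coord_list :: "'n::finite list" where
  "coord_list = (SOME is. distinct is \<and> set is = UNIV)"

lemma coord_list: "distinct (coord_list :: 'n::finite list)" "set (coord_list :: 'n list) = UNIV"
proof -
  have "\<exists>is :: 'n list. distinct is \<and> set is = UNIV"
    using finite_distinct_list[OF finite_class.finite_UNIV] by blast
  from someI_ex[OF this]
  show "distinct (coord_list :: 'n list)" "set (coord_list :: 'n list) = UNIV"
    unfolding coord_list_def by auto
qed

text \<open>Fixes the order of differentiation once and for all, so that iterated derivatives can be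
  treated by induction along the list of coordinates.\<close>

lemma multi_partial_eq: "multi_partial e I F = foldr (\<lambda>i. pdiff (e i) ^^ I i) coord_list F"
  by (simp add: multi_partial_def coord_list_def pdiff_def[abs_def])

lemma torus_smooth_multi_partial: "open U \<Longrightarrow> torus_smooth U F \<Longrightarrow> torus_smooth U (multi_partial e I F)"
  unfolding multi_partial_eq by (rule torus_smooth_foldr_pdiff)

definition torus_star_coeff ::
    "nat \<Rightarrow> ('n::finite coords \<Rightarrow> complex) \<Rightarrow> ('n coords \<Rightarrow> complex) \<Rightarrow> 'n coords \<Rightarrow> complex" where
  "torus_star_coeff r F G z =
     (1 / \<i> ^ r) * (\<Sum>I\<in>{I :: 'n \<Rightarrow> nat. (\<Sum>i\<in>UNIV. I i) = r}.
        (1 / (\<Prod>i\<in>UNIV. fact (I i))) *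
        multi_partial (\<lambda>i. (axis i 1, 0)) I F z * multi_partial (\<lambda>i. (0, axis i 1)) I G z)"

definition torus_star ::
    "real \<Rightarrow> nat \<Rightarrow> ('n::finite coords \<Rightarrow> complex) \<Rightarrow> ('n coords \<Rightarrow> complex) \<Rightarrow> 'n coords \<Rightarrow> complex" where
  "torus_star h N F G z = (\<Sum>r\<le>N. of_real h ^ r * torus_star_coeff r F G z)"

lemma torus_smooth_star:
  assumes "open U" "torus_smooth U F" "torus_smooth U G"
  shows "torus_smooth U (torus_star h N F G)"
  unfolding torus_star_def[abs_def] torus_star_coeff_def
  by (intro torus_smooth_sum torus_smooth_mult torus_smooth_const torus_smooth_multi_partial assms)

lemma multi_indices_level:
  "{I \<in> multi_indices UNIV N. sum I UNIV = r} = (if r \<le> N then {I :: 'n::finite \<Rightarrow> nat. (\<Sum>i\<in>UNIV. I i) = r} else {})"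
  by (auto simp: multi_indices_def)

lemma torus_star_eq:
  fixes F G :: "'n::finite coords \<Rightarrow> complex"
  shows "torus_star h N F G z = (\<Sum>I\<in>multi_indices UNIV N.
    ((of_real h / \<i>) ^ sum I UNIV / (\<Prod>i\<in>UNIV. fact (I i))) *
      (multi_partial (\<lambda>i. (axis i 1, 0)) I F z * multi_partial (\<lambda>i. (0, axis i 1)) I G z))"
proof -
  let ?f = "\<lambda>I. ((of_real h / \<i>) ^ sum I UNIV / (\<Prod>i\<in>UNIV. fact (I i))) *
      (multi_partial (\<lambda>i. (axis i 1, 0)) I F z * multi_partial (\<lambda>i. (0, axis i 1)) I G z)"
  have fin: "finite (multi_indices (UNIV :: 'n set) N)" by (rule finite_multi_indices) simp
  have "sum ?f (multi_indices UNIV N) = (\<Sum>r\<le>N. sum ?f {I \<in> multi_indices UNIV N. sum I UNIV = r})"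
    by (rule sum.group[symmetric, OF fin finite_atMost]) (auto simp: multi_indices_def)
  also have "\<dots> = torus_star h N F G z"
    unfolding torus_star_def torus_star_coeff_def
  proof (intro sum.cong refl)
    fix r assume "r \<in> {..N}"
    then have "sum ?f {I \<in> multi_indices UNIV N. sum I UNIV = r} = sum ?f {I :: 'n \<Rightarrow> nat. (\<Sum>i\<in>UNIV. I i) = r}"
      unfolding multi_indices_level by simp
    also have "\<dots> = of_real h ^ r * ((1 / \<i> ^ r) *
        (\<Sum>I\<in>{I :: 'n \<Rightarrow> nat. (\<Sum>i\<in>UNIV. I i) = r}. (1 / (\<Prod>i\<in>UNIV. fact (I i))) *
        multi_partial (\<lambda>i. (axis i 1, 0)) I F z * multi_partial (\<lambda>i. (0, axis i 1)) I G z))"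
      unfolding sum_distrib_left power_divide
      by (intro sum.cong refl) (simp only: mem_Collect_eq divide_inverse mult_1_left mult_ac)
    finally show "sum ?f {I \<in> multi_indices UNIV N. sum I UNIV = r} = of_real h ^ r * ((1 / \<i> ^ r) *
        (\<Sum>I\<in>{I :: 'n \<Rightarrow> nat. (\<Sum>i\<in>UNIV. I i) = r}. (1 / (\<Prod>i\<in>UNIV. fact (I i))) *
        multi_partial (\<lambda>i. (axis i 1, 0)) I F z * multi_partial (\<lambda>i. (0, axis i 1)) I G z))" .
  qed
  finally show ?thesis by simp
qed

text \<open>The Fourier coefficients of \<open>F \<star> G\<close> are exactly the Taylor polynomials that occur in the
  composition of the two operators: \<open>\<partial>\<^sub>\<theta>\<^sup>I\<close> acts on the mode \<open>p\<close> of \<open>G\<close> as \<open>(i p)\<^sup>I\<close>.\<close>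

lemma slice_coeff_star:
  fixes F G :: "'n::finite coords \<Rightarrow> complex"
  assumes U: "open U" and F: "torus_smooth U F" and G: "torus_smooth U G" and x: "x \<in> U" and B: "finite B"
    and zero: "\<And>p. p \<notin> B \<Longrightarrow> slice_coeff G p x = 0"
  shows "slice_coeff (torus_star h N F G) s x = (\<Sum>p\<in>B. slice_coeff G p x *
    (\<Sum>I\<in>multi_indices UNIV N. of_real (\<Prod>i\<in>UNIV. (h * of_int (p $ i)) ^ I i / fact (I i)) *
       slice_coeff (multi_partial (\<lambda>i. (axis i 1, 0)) I F) (s - p) x))"
proof -
  let ?F = "\<lambda>I. multi_partial (\<lambda>i. (axis i 1, 0)) I F" and ?G = "\<lambda>I. multi_partial (\<lambda>i. (0, axis i 1)) I G"
  let ?k = "\<lambda>I :: 'n \<Rightarrow> nat. (of_real h / \<i>) ^ sum I UNIV / (\<Prod>i\<in>UNIV. fact (I i)) :: complex"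
  let ?g = "\<lambda>p. slice_coeff G p x"
  have fin: "finite (multi_indices (UNIV :: 'n set) N)" by (rule finite_multi_indices) simp
  have smF: "torus_smooth U (?F I)" and smG: "torus_smooth U (?G I)" for I
    by (intro torus_smooth_multi_partial U F G)+
  have dG: "?G I (x, \<theta>) = (\<Sum>p\<in>B. ((\<Prod>i\<in>UNIV. (\<i> * of_int (p $ i)) ^ I i) * ?g p) * character p \<theta>)" for I \<theta>
    using trig_foldr_pdiff[OF U G x trig_expansion[OF G x B zero] coord_list(1), of I \<theta>]
    by (simp add: multi_partial_eq coord_list(2))
  have prod: "slice_coeff (\<lambda>z. ?F I z * ?G I z) s x
      = (\<Sum>p\<in>B. ((\<Prod>i\<in>UNIV. (\<i> * of_int (p $ i)) ^ I i) * ?g p) * slice_coeff (?F I) (s - p) x)" for I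
    using torus_coeff_trig_sum[OF torus_smooth_slice_continuous[OF smF x] B,
        of "\<lambda>p. (\<Prod>i\<in>UNIV. (\<i> * of_int (p $ i)) ^ I i) * ?g p" I s]
    by (simp add: slice_coeff_def dG sum_distrib_left mult_ac)
  have "slice_coeff (torus_star h N F G) s x = (\<Sum>I\<in>multi_indices UNIV N. ?k I * slice_coeff (\<lambda>z. ?F I z * ?G I z) s x)"
    unfolding slice_coeff_def torus_star_eq
    by (rule torus_coeff_sum[OF fin torus_smooth_slice_continuous[OF torus_smooth_mult[OF U smF smG] x]])
  also have "\<dots> = (\<Sum>I\<in>multi_indices UNIV N. \<Sum>p\<in>B. ?g p *
      (of_real (\<Prod>i\<in>UNIV. (h * of_int (p $ i)) ^ I i / fact (I i)) * slice_coeff (?F I) (s - p) x))"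
    unfolding prod sum_distrib_left
  proof (intro sum.cong refl)
    fix I :: "'n \<Rightarrow> nat" and p :: "int^'n"
    have "(of_real h / \<i>) ^ sum I UNIV * (\<Prod>i\<in>UNIV. (\<i> * of_int (p $ i)) ^ I i)
        = (\<Prod>i\<in>UNIV. (of_real h / \<i>) ^ I i * (\<i> * of_int (p $ i)) ^ I i)"
      by (simp add: power_sum prod.distrib)
    also have "\<dots> = of_real (\<Prod>i\<in>UNIV. (h * of_int (p $ i)) ^ I i)"
    proof -
      have "(of_real h / \<i>) * (\<i> * of_int (p $ i)) = complex_of_real (h * of_int (p $ i))" for i
        by (simp add: complex_eq_iff)
      then show ?thesis unfolding power_mult_distrib[symmetric] by simp
    qed
    finally have k: "(of_real h / \<i>) ^ sum I UNIV * (\<Prod>i\<in>UNIV. (\<i> * of_int (p $ i)) ^ I i)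
        = of_real (\<Prod>i\<in>UNIV. (h * of_int (p $ i)) ^ I i)" .
    have K: "?k I * (\<Prod>i\<in>UNIV. (\<i> * of_int (p $ i)) ^ I i) = of_real (\<Prod>i\<in>UNIV. (h * of_int (p $ i)) ^ I i / fact (I i))"
      using k by (simp add: prod_dividef)
    show "?k I * (((\<Prod>i\<in>UNIV. (\<i> * of_int (p $ i)) ^ I i) * ?g p) * slice_coeff (?F I) (s - p) x)
      = ?g p * (of_real (\<Prod>i\<in>UNIV. (h * of_int (p $ i)) ^ I i / fact (I i)) * slice_coeff (?F I) (s - p) x)"
      by (simp only: K[symmetric] mult_ac)
  qed
  also have "\<dots> = (\<Sum>p\<in>B. \<Sum>I\<in>multi_indices UNIV N. ?g p *
      (of_real (\<Prod>i\<in>UNIV. (h * of_int (p $ i)) ^ I i / fact (I i)) * slice_coeff (?F I) (s - p) x))"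
    by (rule sum.swap)
  finally show ?thesis by (simp only: sum_distrib_left)
qed

text \<open>The matrix entry of the composition differs from that of the star product by the Taylor
  remainders of the coefficients of \<open>F\<close>.\<close>

lemma star_remainder_bound:
  fixes F G :: "'n::finite coords \<Rightarrow> complex" and B :: "(int^'n) set" and l :: nat
  assumes U: "open U" and F: "torus_smooth U F" and G: "torus_smooth U G" and B: "finite B"
    and zero: "\<And>p x. p \<notin> B \<Longrightarrow> x \<in> U \<Longrightarrow> slice_coeff G p x = 0"
    and l: "\<And>p i. p \<in> B \<Longrightarrow> \<bar>p $ i\<bar> \<le> int l"
    and K: "compact K" "K \<subseteq> U"
  shows "\<exists>C\<ge>0. \<forall>h x s. 0 \<le> h \<longrightarrow> (\<forall>z. (\<forall>i. \<bar>z $ i - x $ i\<bar> \<le> h * real l) \<longrightarrow> z \<in> K) \<longrightarrow>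
    cmod ((\<Sum>p\<in>B. slice_coeff G p x * slice_coeff F (s - p) (x + h *\<^sub>R rvec p))
        - slice_coeff (torus_star h N F G) s x)
      \<le> C * h ^ Suc N * (\<Sum>p\<in>B. weight (s - p))"
proof -
  obtain Cg where Cg: "Cg \<ge> 0" "\<And>x q. x \<in> K \<Longrightarrow> cmod (slice_coeff G q x) \<le> Cg * weight q"
    using torus_coeff_decay[OF U G K] unfolding slice_coeff_def by blast
  let ?P = "\<lambda>I. multi_partial (\<lambda>i. (axis i 1, 0)) I F"
  obtain C where C: "C \<ge> 0" "\<And>q x y Y. (\<forall>i. \<bar>y $ i\<bar> \<le> Y) \<Longrightarrow> (\<forall>z. (\<forall>i. \<bar>z $ i - x $ i\<bar> \<le> \<bar>y $ i\<bar>) \<longrightarrow> z \<in> K) \<Longrightarrow>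
     cmod (slice_coeff F q (x + (\<Sum>i\<in>UNIV. (y $ i) *\<^sub>R axis i 1))
       - (\<Sum>I\<in>multi_indices UNIV N. of_real (\<Prod>i\<in>UNIV. (y $ i) ^ I i / fact (I i)) * slice_coeff (?P I) q x))
     \<le> C * weight q * Y ^ Suc N"
    using slice_coeff_taylor[OF U F K coord_list(1), of N] unfolding coord_list(2) multi_partial_eq by blast
  show ?thesis
  proof (intro exI[of _ "Cg * C * real l ^ Suc N"] conjI allI impI)
    show "0 \<le> Cg * C * real l ^ Suc N" using Cg C by simp
    fix h :: real and x :: "real^'n" and s :: "int^'n"
    assume h: "0 \<le> h" and near: "\<forall>z. (\<forall>i. \<bar>z $ i - x $ i\<bar> \<le> h * real l) \<longrightarrow> z \<in> K"
    have xK: "x \<in> K" using near h by auto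
    then have x: "x \<in> U" using K by auto
    let ?T = "\<lambda>p. \<Sum>I\<in>multi_indices UNIV N. of_real (\<Prod>i\<in>UNIV. (h * of_int (p $ i)) ^ I i / fact (I i)) *
       slice_coeff (?P I) (s - p) x"
    have taylor: "cmod (slice_coeff F (s - p) (x + h *\<^sub>R rvec p) - ?T p) \<le> C * weight (s - p) * (h * real l) ^ Suc N"
      if p: "p \<in> B" for p
    proof -
      define y where "y = h *\<^sub>R rvec p"
      have yi: "y $ i = h * of_int (p $ i)" for i by (simp add: y_def)
      have le: "\<bar>y $ i\<bar> \<le> h * real l" for i
      proof -
        have "\<bar>real_of_int (p $ i)\<bar> \<le> real l" using l[OF p, of i] by linarith
        then show ?thesis using h by (simp add: yi abs_mult mult_left_mono)
      qed
      have y: "(\<Sum>i\<in>UNIV. (y $ i) *\<^sub>R axis i 1) = y"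
        using basis_expansion[of y] by (simp add: scalar_mult_eq_scaleR)
      have "cmod (slice_coeff F (s - p) (x + (\<Sum>i\<in>UNIV. (y $ i) *\<^sub>R axis i 1))
         - (\<Sum>I\<in>multi_indices UNIV N. of_real (\<Prod>i\<in>UNIV. (y $ i) ^ I i / fact (I i)) * slice_coeff (?P I) (s - p) x))
         \<le> C * weight (s - p) * (h * real l) ^ Suc N"
      proof (rule C(2))
        show "\<forall>z. (\<forall>i. \<bar>z $ i - x $ i\<bar> \<le> \<bar>y $ i\<bar>) \<longrightarrow> z \<in> K"
          using near le order_trans by blast
      qed (use le in simp)
      then show ?thesis unfolding y unfolding yi unfolding y_def .
    qed
    have star: "slice_coeff (torus_star h N F G) s x = (\<Sum>p\<in>B. slice_coeff G p x * ?T p)"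
      by (rule slice_coeff_star[OF U F G x B]) (rule zero[OF _ x])
    have "(\<Sum>p\<in>B. slice_coeff G p x * slice_coeff F (s - p) (x + h *\<^sub>R rvec p))
        - slice_coeff (torus_star h N F G) s x
        = (\<Sum>p\<in>B. slice_coeff G p x * (slice_coeff F (s - p) (x + h *\<^sub>R rvec p) - ?T p))"
      unfolding star right_diff_distrib sum_subtractf ..
    also have "cmod \<dots> \<le> (\<Sum>p\<in>B. Cg * (C * weight (s - p) * (h * real l) ^ Suc N))"
    proof (rule sum_norm_le)
      fix p assume p: "p \<in> B"
      have "cmod (slice_coeff G p x) \<le> Cg * 1"
        using Cg(2)[OF xK, of p] mult_left_mono[OF weight_le_1 Cg(1)] by (rule order_trans)
      then show "cmod (slice_coeff G p x * (slice_coeff F (s - p) (x + h *\<^sub>R rvec p) - ?T p))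
          \<le> Cg * (C * weight (s - p) * (h * real l) ^ Suc N)"
        unfolding norm_mult using taylor[OF p] Cg(1) by (intro mult_mono) auto
    qed
    also have "\<dots> = Cg * C * real l ^ Suc N * h ^ Suc N * (\<Sum>p\<in>B. weight (s - p))"
      by (simp only: sum_distrib_left power_mult_distrib mult_ac)
    finally show "cmod ((\<Sum>p\<in>B. slice_coeff G p x * slice_coeff F (s - p) (x + h *\<^sub>R rvec p))
        - slice_coeff (torus_star h N F G) s x)
      \<le> Cg * C * real l ^ Suc N * h ^ Suc N * (\<Sum>p\<in>B. weight (s - p))" .
  qed
qed

section \<open>Schur test\<close>

text \<open>By Cauchy-Schwarz with respect to the weights \<open>\<omega> (m' - m)\<close>. Since these depend on the
  difference only, one bound \<open>W\<close> serves for rows and columns, whatever their number.\<close>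

lemma schur_test:
  fixes a :: "'a::ab_group_add \<Rightarrow> 'a \<Rightarrow> complex"
  assumes A: "finite A" "finite B" and C: "C \<ge> 0" and \<omega>: "\<And>d. \<omega> d \<ge> 0"
    and a: "\<And>m' m. m' \<in> A \<Longrightarrow> m \<in> B \<Longrightarrow> cmod (a m' m) \<le> C * \<omega> (m' - m)"
    and W: "\<And>D. finite D \<Longrightarrow> sum \<omega> D \<le> W"
  shows "(\<Sum>m'\<in>A. (cmod (\<Sum>m\<in>B. b m * a m' m))\<^sup>2) \<le> (C * W)\<^sup>2 * (\<Sum>m\<in>B. (cmod (b m))\<^sup>2)"
proof -
  have W0: "0 \<le> W" using W[of "{}"] by simp
  have row: "(\<Sum>m\<in>B. \<omega> (m' - m)) \<le> W" for m'
  proof -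
    have "sum \<omega> ((\<lambda>m. m' - m) ` B) = (\<Sum>m\<in>B. \<omega> (m' - m))"
      by (subst sum.reindex) (auto simp: inj_on_def)
    then show ?thesis using W[of "(\<lambda>m. m' - m) ` B"] A(2) by simp
  qed
  have col: "(\<Sum>m'\<in>A. \<omega> (m' - m)) \<le> W" for m
  proof -
    have "sum \<omega> ((\<lambda>m'. m' - m) ` A) = (\<Sum>m'\<in>A. \<omega> (m' - m))"
      by (subst sum.reindex) (auto simp: inj_on_def)
    then show ?thesis using W[of "(\<lambda>m'. m' - m) ` A"] A(1) by simp
  qed
  have each: "(cmod (\<Sum>m\<in>B. b m * a m' m))\<^sup>2 \<le> C\<^sup>2 * W * (\<Sum>m\<in>B. \<omega> (m' - m) * (cmod (b m))\<^sup>2)" if m': "m' \<in> A" for m'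
  proof -
    have "cmod (\<Sum>m\<in>B. b m * a m' m) \<le> (\<Sum>m\<in>B. C * (sqrt (\<omega> (m' - m)) * (sqrt (\<omega> (m' - m)) * cmod (b m))))"
    proof (rule sum_norm_le)
      fix m assume "m \<in> B"
      then have 1: "cmod (b m * a m' m) \<le> cmod (b m) * (C * \<omega> (m' - m))"
        using a[OF m'] unfolding norm_mult by (intro mult_left_mono) auto
      have "\<omega> (m' - m) = sqrt (\<omega> (m' - m)) * sqrt (\<omega> (m' - m))" using \<omega> by simp
      then have "cmod (b m) * (C * \<omega> (m' - m)) = C * (sqrt (\<omega> (m' - m)) * (sqrt (\<omega> (m' - m)) * cmod (b m)))"
        by (simp add: mult_ac)
      with 1 show "cmod (b m * a m' m) \<le> C * (sqrt (\<omega> (m' - m)) * (sqrt (\<omega> (m' - m)) * cmod (b m)))"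
        by simp
    qed
    also have "\<dots> = C * (\<Sum>m\<in>B. sqrt (\<omega> (m' - m)) * (sqrt (\<omega> (m' - m)) * cmod (b m)))"
      by (simp only: sum_distrib_left)
    finally have "(cmod (\<Sum>m\<in>B. b m * a m' m))\<^sup>2
        \<le> (C * (\<Sum>m\<in>B. sqrt (\<omega> (m' - m)) * (sqrt (\<omega> (m' - m)) * cmod (b m))))\<^sup>2"
      by (rule power_mono) simp
    also have "\<dots> = C\<^sup>2 * (\<Sum>m\<in>B. sqrt (\<omega> (m' - m)) * (sqrt (\<omega> (m' - m)) * cmod (b m)))\<^sup>2"
      by (rule power_mult_distrib)
    also have "\<dots> \<le> C\<^sup>2 * ((\<Sum>m\<in>B. (sqrt (\<omega> (m' - m)))\<^sup>2) * (\<Sum>m\<in>B. (sqrt (\<omega> (m' - m)) * cmod (b m))\<^sup>2))"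
      by (intro mult_left_mono Cauchy_Schwarz_ineq_sum) simp
    also have "\<dots> = C\<^sup>2 * ((\<Sum>m\<in>B. \<omega> (m' - m)) * (\<Sum>m\<in>B. \<omega> (m' - m) * (cmod (b m))\<^sup>2))"
      using \<omega> by (simp add: power_mult_distrib)
    also have "\<dots> \<le> C\<^sup>2 * (W * (\<Sum>m\<in>B. \<omega> (m' - m) * (cmod (b m))\<^sup>2))"
      using \<omega> by (intro mult_left_mono mult_right_mono row sum_nonneg) auto
    finally show ?thesis by (simp only: mult.assoc)
  qed
  have "(\<Sum>m'\<in>A. (cmod (\<Sum>m\<in>B. b m * a m' m))\<^sup>2)
      \<le> (\<Sum>m'\<in>A. C\<^sup>2 * W * (\<Sum>m\<in>B. \<omega> (m' - m) * (cmod (b m))\<^sup>2))"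
    by (intro sum_mono each)
  also have "\<dots> = C\<^sup>2 * W * (\<Sum>m'\<in>A. \<Sum>m\<in>B. \<omega> (m' - m) * (cmod (b m))\<^sup>2)"
    by (rule sum_distrib_left[symmetric])
  also have "(\<Sum>m'\<in>A. \<Sum>m\<in>B. \<omega> (m' - m) * (cmod (b m))\<^sup>2) = (\<Sum>m\<in>B. \<Sum>m'\<in>A. \<omega> (m' - m) * (cmod (b m))\<^sup>2)"
    by (rule sum.swap)
  also have "\<dots> = (\<Sum>m\<in>B. (\<Sum>m'\<in>A. \<omega> (m' - m)) * (cmod (b m))\<^sup>2)"
    by (simp only: sum_distrib_right)
  also have "C\<^sup>2 * W * \<dots> \<le> C\<^sup>2 * W * (\<Sum>m\<in>B. W * (cmod (b m))\<^sup>2)"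
    using W0 by (intro mult_left_mono sum_mono mult_right_mono col) auto
  also have "\<dots> = C\<^sup>2 * W * (W * (\<Sum>m\<in>B. (cmod (b m))\<^sup>2))"
    by (simp only: sum_distrib_left)
  also have "\<dots> = (C * W)\<^sup>2 * (\<Sum>m\<in>B. (cmod (b m))\<^sup>2)"
    by (simp only: power2_eq_square mult_ac)
  finally show ?thesis .
qed

section \<open>Smooth functions and sections over the open torus orbit\<close>

lemma fourier_coeff_eq: "fourier_coeff M f p x = slice_coeff (f \<circ> Bl M) p x"
  by (simp add: fourier_coeff_def slice_coeff_def torus_coeff_def torus_box_def character_def rvec_uminus)

abbreviation (input) inner_polytope :: "('x, 'n::finite) toric_data \<Rightarrow> (real^'n) set" where
  "inner_polytope M \<equiv> interior (polytope_of M)"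

context
  fixes M :: "('x::t2_space, 'n::finite) toric_data"
  assumes toric: "toric_manifold M"
begin

lemma Bl_image: "Bl M ` (inner_polytope M \<times> UNIV) = open_part M"
  using toric by (simp add: toric_manifold_def action_angle_def)

lemma Bl_in_open_part: "x \<in> inner_polytope M \<Longrightarrow> Bl M (x, \<theta>) \<in> open_part M"
  using Bl_image by blast

lemma Bl_eq_iff: "x \<in> inner_polytope M \<Longrightarrow> Bl M (x, \<theta>) = Bl M (x, \<theta>') \<longleftrightarrow> \<theta>' - \<theta> \<in> torus_lattice"
  using toric by (simp add: toric_manifold_def action_angle_def)

lemma moment_Bl: "x \<in> inner_polytope M \<Longrightarrow> moment M (Bl M (x, \<theta>)) = x"
  using toric interior_subset[of "polytope_of M"]
  by (auto simp: toric_manifold_def boundary_coordinates_def)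

text \<open>The chosen angle is one of many representatives; all periodic quantities are insensitive to
  the choice.\<close>

lemma angle_Bl:
  assumes "x \<in> inner_polytope M" shows "angle M (Bl M (x, \<theta>)) - \<theta> \<in> torus_lattice"
proof -
  have "Bl M (x, angle M (Bl M (x, \<theta>))) = Bl M (x, \<theta>)"
    using someI[of "\<lambda>\<theta>'. Bl M (moment M (Bl M (x, \<theta>)), \<theta>') = Bl M (x, \<theta>)" \<theta>]
    by (simp add: angle_def moment_Bl[OF assms])
  then show ?thesis using Bl_eq_iff[OF assms, of \<theta> "angle M (Bl M (x, \<theta>))"] by simp
qed

lemma periodic_at_angle:
  assumes "x \<in> inner_polytope M" "periodic u" shows "u (angle M (Bl M (x, \<theta>))) = u \<theta>"
proof -
  have "u (\<theta> + (angle M (Bl M (x, \<theta>)) - \<theta>)) = u \<theta>"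
    using assms(2) angle_Bl[OF assms(1)] unfolding periodic_def by blast
  then show ?thesis by simp
qed

lemma periodic_comp_Bl: "x \<in> inner_polytope M \<Longrightarrow> periodic (\<lambda>\<theta>. f (Bl M (x, \<theta>)))"
  unfolding periodic_def using Bl_eq_iff[of x] by (metis add_diff_cancel_left')

text \<open>The local inverses of \<open>Bl\<close> are smooth charts, so their transition maps to the charts of the
  atlas make both \<open>Bl\<close> and its local inverses smooth. The two properties serve to move smoothness
  from the manifold to the coordinates and back.\<close>

lemma Bl_chart:
  assumes "z \<in> inner_polytope M \<times> UNIV"
  obtains W where "open W" "z \<in> W" "W \<subseteq> inner_polytope M \<times> UNIV" "inj_on (Bl M) W"
    "open (Bl M ` W)" "continuous_on W (Bl M)"
    "\<forall>c\<in>atlas M. smooth_on {w \<in> W. Bl M w \<in> fst c} (\<lambda>w. snd c (Bl M w))"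
    "\<forall>c\<in>atlas M. smooth_on (snd c ` (fst c \<inter> Bl M ` W)) (\<lambda>y. inv_into W (Bl M) (chart_inv c y))"
proof -
  obtain W where W: "open W" "z \<in> W" "W \<subseteq> inner_polytope M \<times> UNIV" "inj_on (Bl M) W"
    and sc: "smooth_chart (atlas M) (Bl M ` W, inv_into W (Bl M))"
    using toric assms unfolding toric_manifold_def action_angle_def by meson
  let ?d = "(Bl M ` W, inv_into W (Bl M))"
  have image: "chart_image ?d = W"
    using W(4) by (auto simp: chart_image_def image_image)
  have inv: "chart_inv ?d w = Bl M w" if "w \<in> W" for w
  proof -
    have "inj_on (inv_into W (Bl M)) (Bl M ` W)" by (simp add: inj_on_inv_into)
    then have "inv_into (Bl M ` W) (inv_into W (Bl M)) (inv_into W (Bl M) (Bl M w)) = Bl M w"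
      using that by (intro inv_into_f_f) auto
    then show ?thesis using W(4) that by (simp add: chart_inv_def)
  qed
  have hom: "homeomorphism (Bl M ` W) W (inv_into W (Bl M)) (chart_inv ?d)" and op: "open (Bl M ` W)"
    using sc image by (auto simp: smooth_chart_def is_chart_def)
  have cont: "continuous_on W (Bl M)"
    using homeomorphism_cont2[OF hom] inv continuous_on_cong by fastforce
  have sm1: "smooth_on {w \<in> W. Bl M w \<in> fst c} (\<lambda>w. snd c (Bl M w))" if c: "c \<in> atlas M" for c
  proof -
    have "open (fst c)"
      using c toric by (auto simp: toric_manifold_def smooth_atlas_def is_chart_def)
    then have o: "open {w \<in> W. Bl M w \<in> fst c}"
      using continuous_open_preimage[OF cont W(1)] by (simp add: Int_def vimage_def)
    have "inv_into W (Bl M) ` (Bl M ` W \<inter> fst c) = {w \<in> W. Bl M w \<in> fst c}"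
      using W(4) by force
    then have "smooth_on {w \<in> W. Bl M w \<in> fst c} (transition ?d c)"
      using sc c by (auto simp: smooth_chart_def compatible_charts_def)
    then show ?thesis
      by (rule smooth_on_cong[OF o, rotated]) (simp add: transition_def inv)
  qed
  have sm2: "smooth_on (snd c ` (fst c \<inter> Bl M ` W)) (\<lambda>y. inv_into W (Bl M) (chart_inv c y))"
    if c: "c \<in> atlas M" for c
    using sc c unfolding smooth_chart_def compatible_charts_def transition_def
    by (auto simp: o_def Int_commute)
  show ?thesis using that[OF W op cont] sm1 sm2 by blast
qed

lemma atlas_chart:
  assumes "c \<in> atlas M"
  shows "open (fst c)" "open (chart_image c)" "continuous_on (chart_image c) (chart_inv c)"
    "\<And>q. q \<in> fst c \<Longrightarrow> chart_inv c (snd c q) = q"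
proof -
  have "is_chart c" using assms toric by (auto simp: toric_manifold_def smooth_atlas_def)
  then show "open (fst c)" "open (chart_image c)" "continuous_on (chart_image c) (chart_inv c)"
    "\<And>q. q \<in> fst c \<Longrightarrow> chart_inv c (snd c q) = q"
    by (auto simp: is_chart_def homeomorphism_def)
qed

lemma torus_smooth_pullback:
  assumes f: "smooth_fun (atlas M) UNIV f"
  shows "torus_smooth (inner_polytope M) (f \<circ> Bl M)"
  unfolding torus_smooth_def
proof (intro conjI ballI)
  show "periodic (\<lambda>\<theta>. (f \<circ> Bl M) (x, \<theta>))" if "x \<in> inner_polytope M" for x
    using periodic_comp_Bl[OF that, of f] by simp
  show "smooth_on (inner_polytope M \<times> UNIV) (f \<circ> Bl M)"
  proof (rule smooth_on_locally)
    fix z :: "'n coords" assume z: "z \<in> inner_polytope M \<times> UNIV"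
    obtain W where W: "open W" "z \<in> W" "W \<subseteq> inner_polytope M \<times> UNIV" "inj_on (Bl M) W"
      "open (Bl M ` W)" "continuous_on W (Bl M)"
      "\<forall>c\<in>atlas M. smooth_on {w \<in> W. Bl M w \<in> fst c} (\<lambda>w. snd c (Bl M w))"
      "\<forall>c\<in>atlas M. smooth_on (snd c ` (fst c \<inter> Bl M ` W)) (\<lambda>y. inv_into W (Bl M) (chart_inv c y))"
      by (rule Bl_chart[OF z])
    have "Bl M z \<in> (\<Union>c\<in>atlas M. fst c)"
      using toric unfolding toric_manifold_def smooth_atlas_def by blast
    then obtain c where c: "c \<in> atlas M" "Bl M z \<in> fst c" by blast
    let ?V = "{w \<in> W. Bl M w \<in> fst c}"
    have o: "open ?V"
      using continuous_open_preimage[OF W(6,1) atlas_chart(1)[OF c(1)]] by (simp add: Int_def vimage_def)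
    have "smooth_on (snd c ` (fst c \<inter> UNIV)) (f \<circ> chart_inv c)"
      using f c(1) by (simp add: smooth_fun_def)
    from smooth_on_compose[OF o this W(7)[rule_format, OF c(1)]]
    have "smooth_on ?V (\<lambda>w. (f \<circ> chart_inv c) (snd c (Bl M w)))" by auto
    then have "smooth_on ?V (f \<circ> Bl M)"
      by (rule smooth_on_cong[OF o, rotated]) (simp add: atlas_chart(4)[OF c(1)])
    then show "\<exists>V. open V \<and> z \<in> V \<and> smooth_on V (f \<circ> Bl M)" using o W(2) c(2) by blast
  qed
qed

lemma smooth_fun_open_part:
  assumes h: "smooth_on (inner_polytope M \<times> UNIV) (\<lambda>z. h (Bl M z))"
  shows "smooth_fun (atlas M) (open_part M) h"
  unfolding smooth_fun_def
proof
  fix c assume c: "c \<in> atlas M"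
  show "smooth_on (snd c ` (fst c \<inter> open_part M)) (h \<circ> chart_inv c)"
  proof (rule smooth_on_locally)
    fix y assume "y \<in> snd c ` (fst c \<inter> open_part M)"
    then obtain q where q: "q \<in> fst c" "q \<in> open_part M" "y = snd c q" by auto
    then obtain z where z: "z \<in> inner_polytope M \<times> UNIV" "q = Bl M z" using Bl_image by blast
    obtain W where W: "open W" "z \<in> W" "W \<subseteq> inner_polytope M \<times> UNIV" "inj_on (Bl M) W"
      "open (Bl M ` W)" "continuous_on W (Bl M)"
      "\<forall>c\<in>atlas M. smooth_on {w \<in> W. Bl M w \<in> fst c} (\<lambda>w. snd c (Bl M w))"
      "\<forall>c\<in>atlas M. smooth_on (snd c ` (fst c \<inter> Bl M ` W)) (\<lambda>y. inv_into W (Bl M) (chart_inv c y))"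
      by (rule Bl_chart[OF z(1)])
    let ?V = "snd c ` (fst c \<inter> Bl M ` W)"
    have "?V = chart_image c \<inter> chart_inv c -` (Bl M ` W)"
      using atlas_chart(4)[OF c] by (force simp: chart_image_def)
    then have o: "open ?V"
      using continuous_open_preimage[OF atlas_chart(3,2)[OF c] W(5)] by simp
    have "smooth_on ?V (\<lambda>y. h (Bl M (inv_into W (Bl M) (chart_inv c y))))"
    proof (rule smooth_on_compose[OF o h W(8)[rule_format, OF c]])
      show "(\<lambda>y. inv_into W (Bl M) (chart_inv c y)) ` ?V \<subseteq> inner_polytope M \<times> UNIV"
        using W(3,4) atlas_chart(4)[OF c] by force
    qed
    then have "smooth_on ?V (h \<circ> chart_inv c)"
      by (rule smooth_on_cong[OF o, rotated]) (use atlas_chart(4)[OF c] W(4) in auto)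
    moreover have "y \<in> ?V" using q z W(2) by auto
    ultimately show "\<exists>V. open V \<and> y \<in> V \<and> smooth_on V (h \<circ> chart_inv c)" using o by blast
  qed
qed

text \<open>The whole polytope is one of its faces through \<open>v\<close>.\<close>

lemma open_part_subset_vertex_nbhd:
  assumes "v \<in> vertices M" shows "open_part M \<subseteq> vertex_nbhd M v"
proof
  fix q assume q: "q \<in> open_part M"
  have "polytope (polytope_of M)"
    using toric unfolding toric_manifold_def moment_polytope_data_def by blast
  then have "convex (polytope_of M)" by (rule polytope_imp_convex)
  moreover have "v \<in> polytope_of M" using assms by (simp add: vertices_def extreme_point_of_def)
  ultimately have "rel_interior (polytope_of M) \<subseteq> vertex_star M v"
    unfolding vertex_star_def by (auto intro!: face_of_refl)
  then show "q \<in> vertex_nbhd M v"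
    using q interior_subset_rel_interior by (auto simp: vertex_nbhd_def open_part_def)
qed

lemma adj_facet: "v \<in> vertices M \<Longrightarrow> adj M v i \<in> facets M"
  using toric unfolding toric_manifold_def moment_polytope_data_def bij_betw_def by blast

text \<open>An inverse over the integers is also the inverse over the reals.\<close>

lemma matrix_inv_integer:
  assumes "v \<in> vertices M"
  obtains N :: "int^'n^'n" where "matrix_inv (vertex_matrix M v) = (\<chi> i j. of_int (N $ i $ j))"
proof -
  have "invertible (vertex_matrix_int M v)"
    using assms toric by (simp add: toric_manifold_def moment_polytope_data_def)
  then obtain N where N: "vertex_matrix_int M v ** N = mat 1" "N ** vertex_matrix_int M v = mat 1"
    unfolding invertible_def by blast
  let ?N = "\<chi> i j. of_int (N $ i $ j) :: real^'n^'n"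
  have entries: "vertex_matrix M v $ i $ j = of_int (vertex_matrix_int M v $ i $ j)" for i j
    by (simp add: vertex_matrix_def vertex_matrix_int_def)
  have "(vertex_matrix M v ** ?N) $ i $ j = of_int ((vertex_matrix_int M v ** N) $ i $ j)"
    and "(?N ** vertex_matrix M v) $ i $ j = of_int ((N ** vertex_matrix_int M v) $ i $ j)" for i j
    by (simp_all add: matrix_matrix_mult_def entries)
  then have 1: "vertex_matrix M v ** ?N = mat 1" and 2: "?N ** vertex_matrix M v = mat 1"
    by (simp_all add: N vec_eq_iff mat_def)
  then have "invertible (vertex_matrix M v)" unfolding invertible_def by blast
  then have "matrix_inv (vertex_matrix M v) ** vertex_matrix M v = mat 1"
    unfolding invertible_def matrix_inv_def by (rule someI2_ex) blast
  then have "matrix_inv (vertex_matrix M v) ** (vertex_matrix M v ** ?N) = ?N"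
    unfolding matrix_mul_assoc by simp
  then show ?thesis using that[of N] 1 by simp
qed

text \<open>Write \<open>\<lambda> = a + 1/2\<close> with an integer \<open>a\<close>; then \<open>k\<lambda> - 1/2 = ka + (k - 1)/2\<close>,
  which is an integer because \<open>k\<close> is odd.\<close>

lemma lamL_integer:
  assumes "moment_normalized M" "odd k" "F \<in> facets M" shows "lamL M k F \<in> \<int>"
proof -
  have "lam M F - 1 / 2 \<in> \<int>" using assms by (auto simp: moment_normalized_def)
  moreover obtain j where "k = 2 * j + 1" using assms(2) by (rule oddE)
  then have "lamL M k F = of_nat k * (lam M F - 1 / 2) + of_nat j"
    by (simp add: lamL_def field_simps)
  ultimately show ?thesis by simp
qed

lemma vertex_phase_linear: "bounded_linear (vertex_phase M k v)"
  unfolding vertex_phase_def[abs_def] vertex_theta_def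
  by (intro bounded_linear_inner_right_comp matrix_vector_mul_bounded_linear)

text \<open>The phase is linear in the angles and integral on \<open>\<int>\<^sup>n\<close>, so the transition function between
  the frames descends to the torus.\<close>

lemma cis_vertex_phase_periodic:
  assumes "moment_normalized M" "odd k" "v \<in> vertices M"
  shows "periodic (\<lambda>\<theta>. cis (vertex_phase M k v \<theta>))"
  unfolding periodic_def
proof (intro allI ballI)
  fix \<theta> t :: "real^'n" assume "t \<in> torus_lattice"
  then obtain z where t: "t = (2 * pi) *\<^sub>R rvec z" by (auto simp: torus_lattice_def)
  obtain N :: "int^'n^'n" where N: "matrix_inv (vertex_matrix M v) = (\<chi> i j. of_int (N $ i $ j))"
    by (rule matrix_inv_integer[OF assms(3)])
  interpret bounded_linear "vertex_phase M k v" by (rule vertex_phase_linear)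
  have "vertex_phase M k v (rvec z) \<in> \<int>"
    unfolding vertex_phase_def vertex_theta_def inner_vec_def N
    using lamL_integer[OF assms(1,2) adj_facet[OF assms(3)]]
    by (auto simp: matrix_vector_mult_def transpose_def intro!: Ints_sum Ints_mult)
  then have "cis (2 * pi * vertex_phase M k v (rvec z)) = 1" by (rule cis_multiple_2pi)
  then show "cis (vertex_phase M k v (\<theta> + t)) = cis (vertex_phase M k v \<theta>)"
    by (simp add: t add scaleR flip: cis_mult)
qed

text \<open>Distributions are set to zero off the space of sections, so every evaluation of a pairing
  below first needs this membership.\<close>

lemma frame_section_in_sections:
  assumes norm: "moment_normalized M" "odd k" and h: "torus_smooth (inner_polytope M) (h \<circ> Bl M)"
  shows "frame_section M k h \<in> sections_L M k (open_part M)"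
proof -
  let ?\<tau> = "frame_section M k h" and ?U = "inner_polytope M \<times> (UNIV :: (real^'n) set)"
  have oU: "open ?U" by (intro open_times_UNIV open_interior)
  have smh: "smooth_on ?U (\<lambda>z. h (Bl M z))"
    using torus_smooth_imp_smooth_on[OF h] by (simp add: o_def)
  have None: "?\<tau> None (Bl M (x, \<theta>)) = h (Bl M (x, \<theta>))" if "x \<in> inner_polytope M" for x \<theta>
    using Bl_in_open_part[OF that] by (simp add: frame_section_def frame_domain_def)
  have Some: "?\<tau> (Some v) (Bl M (x, \<theta>)) = cis (vertex_phase M k v \<theta>) * h (Bl M (x, \<theta>))"
    if "x \<in> inner_polytope M" "v \<in> vertices M" for x \<theta> v
    using Bl_in_open_part[OF that(1)] open_part_subset_vertex_nbhd[OF that(2)] that(2)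
      periodic_at_angle[OF that(1) cis_vertex_phase_periodic[OF norm that(2)]]
    by (auto simp: frame_section_def frame_domain_def)
  have "smooth_fun (atlas M) (open_part M \<inter> frame_domain M a) (?\<tau> a)" for a
  proof (cases a)
    case N: None
    have "smooth_on ?U (\<lambda>z. ?\<tau> None (Bl M z))"
      by (rule smooth_on_cong[OF oU _ smh]) (auto simp: None)
    then show ?thesis using smooth_fun_open_part N by (simp add: frame_domain_def)
  next
    case S: (Some v)
    show ?thesis
    proof (cases "v \<in> vertices M")
      case True
      have "bounded_linear (\<lambda>z :: 'n coords. \<i> * complex_of_real (vertex_phase M k v (snd z)))"
        by (intro bounded_linear_compose[OF bounded_linear_mult_right]
            bounded_linear_compose[OF bounded_linear_of_real]
            bounded_linear_compose[OF vertex_phase_linear] bounded_linear_snd)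
      then have "smooth_on ?U (\<lambda>z. exp (\<i> * complex_of_real (vertex_phase M k v (snd z))) * h (Bl M z))"
        by (intro smooth_on_mult oU smh smooth_on_exp)
      then have "smooth_on ?U (\<lambda>z. ?\<tau> (Some v) (Bl M z))"
        by (rule smooth_on_cong[OF oU, rotated]) (auto simp: Some True cis_conv_exp)
      then have "smooth_fun (atlas M) (open_part M) (?\<tau> (Some v))"
        by (rule smooth_fun_open_part)
      moreover have "open_part M \<inter> frame_domain M a = open_part M"
        using S True open_part_subset_vertex_nbhd[OF True] by (auto simp: frame_domain_def)
      ultimately show ?thesis using S by simp
    next
      case False
      have "Ck_on r {} f" for r and f :: "'n coords \<Rightarrow> complex" by (induction r arbitrary: f) simp_all
      then show ?thesis using S False by (simp add: frame_domain_def smooth_fun_def smooth_on_def)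
    qed
  qed
  moreover have "?\<tau> a q = 0" if "q \<notin> open_part M \<inter> frame_domain M a" for a q
    using that by (auto simp: frame_section_def)
  ultimately show ?thesis
    unfolding sections_L_def by (simp add: None Some cis_mult flip: mult.assoc)
qed

section \<open>Lattice points\<close>

definition facet_function :: "(real^'n) set \<Rightarrow> real^'n \<Rightarrow> real" where
  "facet_function F x = x \<bullet> rvec (normal M F) + lam M F"

lemma polytope_facts:
  shows "polytope (polytope_of M)" "finite (facets M)"
    "polytope_of M = {x. \<forall>F\<in>facets M. facet_function F x \<ge> 0}"
    "\<And>F. F \<in> facets M \<Longrightarrow> F = {x \<in> polytope_of M. facet_function F x = 0}"
proof -
  have mpd: "moment_polytope_data M" using toric by (simp add: toric_manifold_def)
  then show P: "polytope (polytope_of M)" unfolding moment_polytope_data_def by blast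
  then show "finite (facets M)" unfolding facets_def by (rule finite_polytope_facets)
  show "polytope_of M = {x. \<forall>F\<in>facets M. facet_function F x \<ge> 0}"
    using mpd unfolding moment_polytope_data_def facet_function_def by blast
  show "\<And>F. F \<in> facets M \<Longrightarrow> F = {x \<in> polytope_of M. facet_function F x = 0}"
    using mpd unfolding moment_polytope_data_def facet_function_def by blast
qed

lemma continuous_on_facet_function: "continuous_on A (facet_function F)"
  unfolding facet_function_def[abs_def] by (intro continuous_intros)

text \<open>A facet is a proper face and so misses the interior; conversely the strict inequalities define
  an open subset of the polytope, there being finitely many facets.\<close>

lemma inner_polytope_iff: "x \<in> inner_polytope M \<longleftrightarrow> (\<forall>F\<in>facets M. facet_function F x > 0)"
proof
  assume x: "x \<in> inner_polytope M"
  show "\<forall>F\<in>facets M. facet_function F x > 0"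
  proof
    fix F assume F: "F \<in> facets M"
    then have "F face_of polytope_of M" "F \<noteq> polytope_of M"
      by (auto simp: facets_def facet_of_def)
    then have "x \<notin> F" using face_of_disjoint_interior x by blast
    moreover have "x \<in> polytope_of M" using x interior_subset by blast
    moreover have "facet_function F x \<ge> 0"
      using \<open>x \<in> polytope_of M\<close> F polytope_facts(3) by blast
    ultimately show "facet_function F x > 0" using polytope_facts(4)[OF F] by force
  qed
next
  assume x: "\<forall>F\<in>facets M. facet_function F x > 0"
  have "open (\<Inter>F\<in>facets M. {x. 0 < facet_function F x})"
    by (intro open_INT polytope_facts(2) ballI open_Collect_less continuous_on_const continuous_on_facet_function)
  moreover have "(\<Inter>F\<in>facets M. {x. 0 < facet_function F x}) \<subseteq> polytope_of M"
    unfolding polytope_facts(3) by force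
  ultimately have "(\<Inter>F\<in>facets M. {x. 0 < facet_function F x}) \<subseteq> inner_polytope M"
    by (rule interior_maximal[rotated])
  then show "x \<in> inner_polytope M" using x by auto
qed

text \<open>The half-integral shift in the line bundle keeps the points \<open>m/k\<close> away from the boundary.\<close>

lemma Lambda_iff:
  assumes "k > 0"
  shows "m \<in> Lambda M k \<longleftrightarrow> (\<forall>F\<in>facets M. facet_function F ((1 / real k) *\<^sub>R rvec m) \<ge> 1 / (2 * real k))"
proof -
  have "rvec m \<bullet> rvec (normal M F) + lamL M k F \<ge> 0 \<longleftrightarrow> facet_function F ((1 / real k) *\<^sub>R rvec m) \<ge> 1 / (2 * real k)" for F
    using assms by (simp add: lamL_def facet_function_def field_simps)
  then show ?thesis by (simp add: Lambda_def)
qed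

lemma Lambda_interior:
  assumes "k > 0" "m \<in> Lambda M k" shows "(1 / real k) *\<^sub>R rvec m \<in> inner_polytope M"
proof -
  have "1 / (2 * real k) > 0" using assms by simp
  then show ?thesis using assms Lambda_iff[OF assms(1)] inner_polytope_iff order_less_le_trans by blast
qed

lemma finite_Lambda:
  assumes "k > 0" shows "finite (Lambda M k)"
proof -
  have "bounded (polytope_of M)" using polytope_facts(1) by (rule polytope_imp_bounded)
  then obtain B where B: "\<And>x. x \<in> polytope_of M \<Longrightarrow> norm x \<le> B" by (auto simp: bounded_iff)
  have "\<bar>m $ i\<bar> \<le> \<lceil>real k * B\<rceil>" if m: "m \<in> Lambda M k" for m i
  proof -
    have "norm ((1 / real k) *\<^sub>R rvec m) \<le> B"
      using Lambda_interior[OF assms m] interior_subset B by blast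
    then have "norm (rvec m) \<le> real k * B" using assms by (simp add: field_simps)
    then have "\<bar>rvec m $ i\<bar> \<le> real k * B" using component_le_norm_cart order_trans by blast
    then show ?thesis by simp linarith
  qed
  then have "Lambda M k \<subseteq> {m. \<forall>i. \<bar>m $ i\<bar> \<le> \<lceil>real k * B\<rceil>}" by blast
  then show ?thesis using finite_bounded_lattice finite_subset by blast
qed

section \<open>Matrix entries of Toeplitz operators\<close>

definition pairing_const :: "nat \<Rightarrow> real" where
  "pairing_const k = real k powr (real CARD('n) / 2) / pi powr (real CARD('n) / 4)"

text \<open>The factors in the definitions of \<open>\<sigma>\<close>, of the dual frame and of the half-form pairing
  cancel; so the matrix entries of Toeplitz operators are Fourier coefficients on the nose.\<close>

lemma pairing_const_normalization:
  assumes "k > 0"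
  shows "(2 * real k) powr (- real CARD('n) / 2) * (4 * pi) powr (real CARD('n) / 4) * pairing_const k = 1"
proof -
  have 4: "(4::real) powr (real CARD('n) / 4) = 2 powr (real CARD('n) / 2)"
    using powr_powr[of 2 2 "real CARD('n) / 4"] by simp
  have k: "2 powr (- real CARD('n) / 2) * 2 powr (real CARD('n) / 2) = (1::real)"
    "real k powr (- real CARD('n) / 2) * real k powr (real CARD('n) / 2) = 1"
    using assms by (simp_all flip: powr_add)
  have "(2 * real k) powr (- real CARD('n) / 2) * (4 * pi) powr (real CARD('n) / 4) * pairing_const k
      = (2 powr (- real CARD('n) / 2) * 2 powr (real CARD('n) / 2))
        * (real k powr (- real CARD('n) / 2) * real k powr (real CARD('n) / 2))"
    using assms by (simp add: pairing_const_def powr_mult 4)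
  then show ?thesis unfolding k by simp
qed

text \<open>As \<open>f\<close> acts on a distribution by transposition, it is absorbed into the test section; its
  conjugate appears because distributions pair with conjugated sections.\<close>

definition test_fun :: "nat \<Rightarrow> ('x \<Rightarrow> complex) \<Rightarrow> int^'n \<Rightarrow> 'x \<Rightarrow> complex" where
  "test_fun k f m = (\<lambda>q. cnj (f q) * (of_real (pairing_const k) * exp (\<i> * of_real (rvec m \<bullet> angle M q))))"

lemma test_fun_Bl:
  "x \<in> inner_polytope M \<Longrightarrow> test_fun k f m (Bl M (x, \<theta>))
     = cnj (f (Bl M (x, \<theta>))) * (of_real (pairing_const k) * character m \<theta>)"
  using periodic_at_angle[OF _ periodic_character[of m]]
  by (simp add: test_fun_def flip: character_def)

lemma torus_smooth_test_fun:
  assumes "torus_smooth (inner_polytope M) (f \<circ> Bl M)"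
  shows "torus_smooth (inner_polytope M) (test_fun k f m \<circ> Bl M)"
proof (rule torus_smooth_cong)
  show "torus_smooth (inner_polytope M) (\<lambda>z. cnj ((f \<circ> Bl M) z) * (of_real (pairing_const k) * character m (snd z)))"
    by (intro torus_smooth_mult torus_smooth_cnj torus_smooth_const torus_smooth_character assms open_interior)
qed (simp_all add: test_fun_Bl)

lemma fun_times_conj_frame_section:
  "(\<lambda>a q. f q * conj_section (frame_section M k h) a q) = conj_section (frame_section M k (\<lambda>q. cnj (f q) * h q))"
  by (auto simp: fun_eq_iff conj_section_def frame_section_def split: option.split)

lemma conj_sigma_check: "conj_section (sigma_check M k m) = conj_section (frame_section M k (test_fun k (\<lambda>_. 1) m))"
  by (simp add: sigma_check_def test_fun_def pairing_const_def)

lemma fun_times_conj_sigma_check: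
  "(\<lambda>a q. f q * conj_section (sigma_check M k m) a q) = conj_section (frame_section M k (test_fun k f m))"
  unfolding conj_sigma_check fun_times_conj_frame_section by (simp add: test_fun_def)

lemma sigma_test_section:
  assumes norm: "moment_normalized M" "odd k" and f: "torus_smooth (inner_polytope M) (f \<circ> Bl M)"
    and m: "m \<in> Lambda M k"
  shows "sigma M k m (conj_section (frame_section M k (test_fun k f m'))) =
    of_real ((4 * pi) powr (real CARD('n) / 4) * pairing_const k) * fourier_coeff M f (m' - m) ((1 / real k) *\<^sub>R rvec m)"
proof -
  have "k > 0" using norm(2) by (cases k) auto
  define x where "x = (1 / real k) *\<^sub>R rvec m"
  have x: "x \<in> inner_polytope M" unfolding x_def by (rule Lambda_interior[OF \<open>k > 0\<close> m])
  let ?\<rho> = "conj_section (frame_section M k (test_fun k f m'))"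
  have "?\<rho> \<in> sections_Lbar M k (open_part M)"
    unfolding sections_Lbar_def
    by (intro imageI frame_section_in_sections[OF norm] torus_smooth_test_fun f)
  then have "delta M k m ?\<rho> = (1 / (2 * pi) ^ CARD('n)) *
       integral torus_box (\<lambda>\<theta>. character m \<theta> * ?\<rho> None (Bl M (x, \<theta>)))"
    by (simp add: delta_def torus_box_def character_def x_def)
  also have "(\<lambda>\<theta>. character m \<theta> * ?\<rho> None (Bl M (x, \<theta>)))
      = (\<lambda>\<theta>. of_real (pairing_const k) * ((f \<circ> Bl M) (x, \<theta>) * character (- (m' - m)) \<theta>))"
  proof
    fix \<theta>
    have "cnj (character m' \<theta>) = character (- m') \<theta>" by (simp add: character_def exp_cnj rvec_uminus)
    moreover have "?\<rho> None (Bl M (x, \<theta>)) = cnj (test_fun k f m' (Bl M (x, \<theta>)))"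
      using Bl_in_open_part[OF x] by (simp add: conj_section_def frame_section_def frame_domain_def)
    ultimately have "?\<rho> None (Bl M (x, \<theta>)) = f (Bl M (x, \<theta>)) * (of_real (pairing_const k) * character (- m') \<theta>)"
      by (simp add: test_fun_Bl[OF x])
    moreover have "character (- (m' - m)) \<theta> = character m \<theta> * character (- m') \<theta>"
      using character_add[of m "- m'" \<theta>] by simp
    ultimately show "character m \<theta> * ?\<rho> None (Bl M (x, \<theta>))
        = of_real (pairing_const k) * ((f \<circ> Bl M) (x, \<theta>) * character (- (m' - m)) \<theta>)"
      by (simp add: mult_ac)
  qed
  finally have "delta M k m ?\<rho> = of_real (pairing_const k) * slice_coeff (f \<circ> Bl M) (m' - m) x"
    by (simp add: slice_coeff_def torus_coeff_def)
  then show ?thesis by (simp add: sigma_def fourier_coeff_eq x_def)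
qed

text \<open>Pairing a state with the sections for \<open>f = 1\<close> reads off its coefficients, by orthogonality of
  the characters; hence the \<open>\<sigma>\<^sup>m\<close> are linearly independent.\<close>

lemma sigma_coord_sum:
  assumes norm: "moment_normalized M" "odd k" and c: "\<And>m. m \<notin> Lambda M k \<Longrightarrow> c m = 0"
  shows "sigma_coord M k (\<lambda>\<rho>. \<Sum>m\<in>Lambda M k. c m * sigma M k m \<rho>) = c"
proof -
  have k: "k > 0" using norm(2) by (cases k) auto
  let ?\<kappa> = "complex_of_real ((4 * pi) powr (real CARD('n) / 4) * pairing_const k)"
  have \<kappa>: "?\<kappa> \<noteq> 0" using k by (simp add: pairing_const_def)
  let ?\<rho> = "\<lambda>m'. conj_section (frame_section M k (test_fun k (\<lambda>_. 1) m'))"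
  have one: "torus_smooth (inner_polytope M) ((\<lambda>_. 1) \<circ> Bl M)"
    unfolding o_def by (rule torus_smooth_const[OF open_interior])
  have pair: "sigma M k m (?\<rho> m') = (if m = m' then ?\<kappa> else 0)" if "m \<in> Lambda M k" for m m'
  proof -
    have "slice_coeff ((\<lambda>_. 1) \<circ> Bl M) (m' - m) ((1 / real k) *\<^sub>R rvec m) = torus_coeff (character 0) (m' - m)"
      by (simp add: slice_coeff_def fun_eq_iff[symmetric] o_def torus_coeff_def)
    then show ?thesis
      unfolding sigma_test_section[OF norm one that] by (simp add: fourier_coeff_eq torus_coeff_character)
  qed
  have coeff: "(\<Sum>m\<in>Lambda M k. b m * sigma M k m (?\<rho> m')) = b m' * ?\<kappa>" if "m' \<in> Lambda M k" for b m'
  proof -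
    have "(\<Sum>m\<in>Lambda M k. b m * sigma M k m (?\<rho> m')) = (\<Sum>m\<in>Lambda M k. if m = m' then b m' * ?\<kappa> else 0)"
      by (intro sum.cong refl) (simp add: pair)
    also have "\<dots> = b m' * ?\<kappa>" using finite_Lambda[OF k] that by simp
    finally show ?thesis .
  qed
  show ?thesis
    unfolding sigma_coord_def
  proof (rule the_equality)
    fix b assume b: "(\<forall>m. m \<notin> Lambda M k \<longrightarrow> b m = 0) \<and>
      (\<lambda>\<rho>. \<Sum>m\<in>Lambda M k. c m * sigma M k m \<rho>) = (\<lambda>\<rho>. \<Sum>m\<in>Lambda M k. b m * sigma M k m \<rho>)"
    show "b = c"
    proof
      fix m show "b m = c m"
      proof (cases "m \<in> Lambda M k")
        case True
        have "(\<Sum>m'\<in>Lambda M k. c m' * sigma M k m' (?\<rho> m)) = (\<Sum>m'\<in>Lambda M k. b m' * sigma M k m' (?\<rho> m))"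
          using b by meson
        then have "c m * ?\<kappa> = b m * ?\<kappa>" unfolding coeff[OF True] .
        then show ?thesis using \<kappa> by simp
      next
        case False
        then show ?thesis using b c by simp
      qed
    qed
  qed (use c in auto)
qed

lemma state_norm_sum:
  assumes norm: "moment_normalized M" "odd k" and c: "\<And>m. m \<notin> Lambda M k \<Longrightarrow> c m = 0"
  shows "state_norm M k (\<lambda>\<rho>. \<Sum>m\<in>Lambda M k. c m * sigma M k m \<rho>) = sqrt (\<Sum>m\<in>Lambda M k. (cmod (c m))\<^sup>2)"
  by (simp add: state_norm_def sigma_coord_sum[OF norm c])

text \<open>On the fibre over \<open>m/k\<close>, multiplication by \<open>f\<close> is convolution with the Fourier coefficients of
  \<open>f\<close> at that point; the projection keeps the modes in \<open>\<Lambda>\<^sub>\<hbar>\<close>.\<close>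

lemma toeplitz_sum:
  assumes norm: "moment_normalized M" "odd k" and f: "torus_smooth (inner_polytope M) (f \<circ> Bl M)"
  shows "toeplitz M k f (\<lambda>\<rho>. \<Sum>m\<in>Lambda M k. c m * sigma M k m \<rho>) =
    (\<lambda>\<rho>. \<Sum>m'\<in>Lambda M k. (\<Sum>m\<in>Lambda M k. c m * fourier_coeff M f (m' - m) ((1 / real k) *\<^sub>R rvec m)) * sigma M k m' \<rho>)"
proof -
  have k: "k > 0" using norm(2) by (cases k) auto
  let ?s = "\<lambda>\<rho>. \<Sum>m\<in>Lambda M k. c m * sigma M k m \<rho>"
  let ?a = "(2 * real k) powr (- real CARD('n) / 2)"
  let ?b = "(4 * pi) powr (real CARD('n) / 4) * pairing_const k"
  have one: "torus_smooth (inner_polytope M) ((\<lambda>_. 1) \<circ> Bl M)"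
    unfolding o_def by (rule torus_smooth_const[OF open_interior])
  have "hf_pairing k (fun_times M k f ?s) (sigma_check M k m')
      = (\<Sum>m\<in>Lambda M k. c m * fourier_coeff M f (m' - m) ((1 / real k) *\<^sub>R rvec m))" for m'
  proof -
    have "conj_section (sigma_check M k m') \<in> sections_Lbar M k (open_part M)"
      unfolding conj_sigma_check sections_Lbar_def
      by (intro imageI frame_section_in_sections[OF norm] torus_smooth_test_fun one)
    then have "hf_pairing k (fun_times M k f ?s) (sigma_check M k m')
        = of_real ?a * ?s (conj_section (frame_section M k (test_fun k f m')))"
      by (simp add: hf_pairing_def fun_times_def fun_times_conj_sigma_check)
    also have "\<dots> = (\<Sum>m\<in>Lambda M k. of_real (?a * ?b) * (c m * fourier_coeff M f (m' - m) ((1 / real k) *\<^sub>R rvec m)))"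
      unfolding sum_distrib_left
    proof (rule sum.cong[OF refl])
      fix m assume "m \<in> Lambda M k"
      from sigma_test_section[OF norm f this, of m']
      show "of_real ?a * (c m * sigma M k m (conj_section (frame_section M k (test_fun k f m'))))
        = of_real (?a * ?b) * (c m * fourier_coeff M f (m' - m) ((1 / real k) *\<^sub>R rvec m))"
        by (simp only: of_real_mult mult_ac)
    qed
    also have "?a * ?b = 1" using pairing_const_normalization[OF k] by (simp add: mult.assoc)
    finally show ?thesis by simp
  qed
  then show ?thesis by (simp add: toeplitz_def projection_def)
qed

text \<open>The star product on the manifold is evaluated at an arbitrary representative of the angle,
  which is harmless since the expression in the coordinates is periodic.\<close>

lemma star_product_Bl:
  assumes f: "torus_smooth (inner_polytope M) (f \<circ> Bl M)" and g: "torus_smooth (inner_polytope M) (g \<circ> Bl M)"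
    and x: "x \<in> inner_polytope M"
  shows "star_product M h N f g (Bl M (x, \<theta>)) = torus_star h N (f \<circ> Bl M) (g \<circ> Bl M) (x, \<theta>)"
proof -
  have "star_product M h N f g q = torus_star h N (f \<circ> Bl M) (g \<circ> Bl M) (moment M q, angle M q)" for q
    by (simp add: star_product_def torus_star_def star_coeff_def torus_star_coeff_def)
  then have "star_product M h N f g (Bl M (x, \<theta>))
      = (\<lambda>\<theta>. torus_star h N (f \<circ> Bl M) (g \<circ> Bl M) (x, \<theta>)) (angle M (Bl M (x, \<theta>)))"
    by (simp add: moment_Bl[OF x])
  also have "\<dots> = (\<lambda>\<theta>. torus_star h N (f \<circ> Bl M) (g \<circ> Bl M) (x, \<theta>)) \<theta>"
    by (rule periodic_at_angle[OF x torus_smooth_imp_periodic[OF torus_smooth_star[OF open_interior f g] x]])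
  finally show ?thesis .
qed

section \<open>Composition of Toeplitz operators\<close>

lemma toeplitz_composition_minus_star:
  fixes c :: "int^'n \<Rightarrow> complex"
  assumes norm: "moment_normalized M" "odd k"
    and f: "torus_smooth (inner_polytope M) (f \<circ> Bl M)" and g: "torus_smooth (inner_polytope M) (g \<circ> Bl M)"
  defines "pt \<equiv> \<lambda>m :: int^'n. (1 / real k) *\<^sub>R rvec m"
  defines "s \<equiv> (\<lambda>\<rho>. \<Sum>m\<in>Lambda M k. c m * sigma M k m \<rho>)"
  shows "(\<lambda>\<rho>. toeplitz M k f (toeplitz M k g s) \<rho> - toeplitz M k (star_product M h N f g) s \<rho>) =
    (\<lambda>\<rho>. \<Sum>m'\<in>Lambda M k. (\<Sum>m\<in>Lambda M k. c m *
       ((\<Sum>m1\<in>Lambda M k. slice_coeff (g \<circ> Bl M) (m1 - m) (pt m) * slice_coeff (f \<circ> Bl M) (m' - m1) (pt m1))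
        - slice_coeff (torus_star h N (f \<circ> Bl M) (g \<circ> Bl M)) (m' - m) (pt m))) * sigma M k m' \<rho>)"
proof -
  have k: "k > 0" using norm(2) by (cases k) auto
  let ?F = "f \<circ> Bl M" and ?G = "g \<circ> Bl M" and ?L = "Lambda M k"
  let ?S = "torus_star h N ?F ?G"
  have starBl: "(star_product M h N f g \<circ> Bl M) (x, \<theta>) = ?S (x, \<theta>)" if "x \<in> inner_polytope M" for x \<theta>
    using star_product_Bl[OF f g that] by simp
  have star: "torus_smooth (inner_polytope M) (star_product M h N f g \<circ> Bl M)"
    by (rule torus_smooth_cong[OF open_interior _ torus_smooth_star[OF open_interior f g, of h N]])
       (rule starBl[symmetric])
  have fc: "fourier_coeff M (star_product M h N f g) q (pt m) = slice_coeff ?S q (pt m)" if "m \<in> ?L" for q m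
    unfolding fourier_coeff_eq slice_coeff_def pt_def
    by (simp only: starBl[OF Lambda_interior[OF k that]])
  have sum: "(\<Sum>m1\<in>?L. (\<Sum>m\<in>?L. c m * fourier_coeff M g (m1 - m) (pt m)) * fourier_coeff M f (m' - m1) (pt m1))
      - (\<Sum>m\<in>?L. c m * fourier_coeff M (star_product M h N f g) (m' - m) (pt m))
      = (\<Sum>m\<in>?L. c m * ((\<Sum>m1\<in>?L. slice_coeff ?G (m1 - m) (pt m) * slice_coeff ?F (m' - m1) (pt m1))
         - slice_coeff ?S (m' - m) (pt m)))" for m'
  proof -
    have "(\<Sum>m1\<in>?L. (\<Sum>m\<in>?L. c m * fourier_coeff M g (m1 - m) (pt m)) * fourier_coeff M f (m' - m1) (pt m1))
        = (\<Sum>m1\<in>?L. \<Sum>m\<in>?L. c m * (slice_coeff ?G (m1 - m) (pt m) * slice_coeff ?F (m' - m1) (pt m1)))"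
      by (simp only: fourier_coeff_eq sum_distrib_right mult.assoc)
    also have "\<dots> = (\<Sum>m\<in>?L. \<Sum>m1\<in>?L. c m * (slice_coeff ?G (m1 - m) (pt m) * slice_coeff ?F (m' - m1) (pt m1)))"
      by (rule sum.swap)
    also have "\<dots> = (\<Sum>m\<in>?L. c m * (\<Sum>m1\<in>?L. slice_coeff ?G (m1 - m) (pt m) * slice_coeff ?F (m' - m1) (pt m1)))"
      by (simp only: sum_distrib_left)
    finally have 1: "(\<Sum>m1\<in>?L. (\<Sum>m\<in>?L. c m * fourier_coeff M g (m1 - m) (pt m)) * fourier_coeff M f (m' - m1) (pt m1))
        = (\<Sum>m\<in>?L. c m * (\<Sum>m1\<in>?L. slice_coeff ?G (m1 - m) (pt m) * slice_coeff ?F (m' - m1) (pt m1)))" .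
    have 2: "(\<Sum>m\<in>?L. c m * fourier_coeff M (star_product M h N f g) (m' - m) (pt m))
        = (\<Sum>m\<in>?L. c m * slice_coeff ?S (m' - m) (pt m))"
      by (intro sum.cong refl) (simp only: fc)
    show ?thesis unfolding 1 2 by (simp only: right_diff_distrib sum_subtractf)
  qed
  have fg: "toeplitz M k f (toeplitz M k g s) = (\<lambda>\<rho>. \<Sum>m'\<in>?L.
      (\<Sum>m1\<in>?L. (\<Sum>m\<in>?L. c m * fourier_coeff M g (m1 - m) (pt m)) * fourier_coeff M f (m' - m1) (pt m1)) * sigma M k m' \<rho>)"
    unfolding s_def pt_def toeplitz_sum[OF norm g] by (rule toeplitz_sum[OF norm f])
  have st: "toeplitz M k (star_product M h N f g) s = (\<lambda>\<rho>. \<Sum>m'\<in>?L.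
      (\<Sum>m\<in>?L. c m * fourier_coeff M (star_product M h N f g) (m' - m) (pt m)) * sigma M k m' \<rho>)"
    unfolding s_def pt_def by (rule toeplitz_sum[OF norm star])
  show ?thesis
    unfolding fg st sum[symmetric] left_diff_distrib sum_subtractf ..
qed

text \<open>The finitely many facet functions attain positive minima over \<open>K\<close>. By \<open>Lambda_iff\<close> a gap
  \<open>\<epsilon> \<ge> 1/2k\<close> puts every lattice point of \<open>k K\<close> into \<open>\<Lambda>\<^sub>\<hbar>\<close>.\<close>

lemma compact_facet_gap:
  assumes "compact K" "K \<subseteq> inner_polytope M"
  shows "\<exists>\<epsilon>>0. \<forall>x\<in>K. \<forall>F\<in>facets M. facet_function F x \<ge> \<epsilon>"
proof -
  have "\<exists>\<epsilon>>0. \<forall>x\<in>K. facet_function F x \<ge> \<epsilon>" if F: "F \<in> facets M" for F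
  proof (cases "K = {}")
    case True
    then show ?thesis by (intro exI[of _ 1]) auto
  next
    case False
    obtain x where x: "x \<in> K" "\<forall>y\<in>K. facet_function F x \<le> facet_function F y"
      using continuous_attains_inf[OF assms(1) False continuous_on_facet_function] by blast
    then have "facet_function F x > 0" using inner_polytope_iff assms(2) F by blast
    then show ?thesis using x by blast
  qed
  then obtain \<epsilon> where \<epsilon>: "\<And>F. F \<in> facets M \<Longrightarrow> \<epsilon> F > 0 \<and> (\<forall>x\<in>K. facet_function F x \<ge> \<epsilon> F)" by metis
  let ?m = "Min (insert 1 (\<epsilon> ` facets M))"
  have fin: "finite (insert 1 (\<epsilon> ` facets M))" using polytope_facts(2) by simp
  have "?m > 0" using fin \<epsilon> by simp
  moreover have "facet_function F x \<ge> ?m" if "x \<in> K" "F \<in> facets M" for x F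
    using Min_le[OF fin, of "\<epsilon> F"] \<epsilon>[OF that(2)] that by force
  ultimately show ?thesis by blast
qed

lemma slice_coeff_zero_outside:
  assumes "g \<in> smooth_le M l" "x \<in> inner_polytope M" "p \<notin> {p. \<forall>i. \<bar>p $ i\<bar> \<le> int l}"
  shows "slice_coeff (g \<circ> Bl M) p x = 0"
proof -
  obtain i where "\<not> \<bar>p $ i\<bar> \<le> int l" using assms(3) by blast
  then have "int l < \<bar>p $ i\<bar>" by simp
  also have "\<bar>p $ i\<bar> \<le> (MAX i. \<bar>p $ i\<bar>)" by (rule Max_ge) auto
  finally have "fourier_coeff M g p x = 0"
    using assms(1,2) interior_subset unfolding smooth_le_def by blast
  then show ?thesis by (simp add: fourier_coeff_eq)
qed

text \<open>The truncation of the mode sum to \<open>\<Lambda>\<^sub>\<hbar>\<close> drops no term near \<open>V\<close>, so there the entries of the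
  difference are exactly the remainders of \<open>star_remainder_bound\<close>.\<close>

lemma toeplitz_composition_bound:
  assumes norm: "moment_normalized M" and f: "smooth_fun (atlas M) UNIV f" and g: "g \<in> smooth_finite M"
    and V: "compact (closure V)" "closure V \<subseteq> inner_polytope M"
  shows "\<exists>\<delta>>0. \<forall>N. \<exists>K>0. \<forall>k. odd k \<and> 1 / real k < \<delta> \<longrightarrow>
    local_opnorm M k V
      (\<lambda>s \<rho>. toeplitz M k f (toeplitz M k g s) \<rho> - toeplitz M k (star_product M (1 / real k) N f g) s \<rho>)
    \<le> K * (1 / real k) ^ (N + 1)"
proof -
  let ?U = "inner_polytope M"
  define F where "F = f \<circ> Bl M"
  define G where "G = g \<circ> Bl M"
  obtain l where gl: "g \<in> smooth_le M l" using g by (auto simp: smooth_finite_def)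
  have F: "torus_smooth ?U F" unfolding F_def by (rule torus_smooth_pullback[OF f])
  have G: "torus_smooth ?U G"
    unfolding G_def by (rule torus_smooth_pullback) (use gl in \<open>simp add: smooth_le_def\<close>)
  define B :: "(int^'n) set" where "B = {p. \<forall>i. \<bar>p $ i\<bar> \<le> int l}"
  have B: "finite B" unfolding B_def by (rule finite_bounded_lattice)
  have zero: "slice_coeff G p x = 0" if "p \<notin> B" "x \<in> ?U" for p x
    unfolding G_def by (rule slice_coeff_zero_outside[OF gl that(2)]) (use that(1) in \<open>simp add: B_def\<close>)
  have lB: "\<bar>p $ i\<bar> \<le> int l" if "p \<in> B" for p i using that by (simp add: B_def)
  obtain e where e: "e > 0" "(\<Union>x\<in>closure V. cball x e) \<subseteq> ?U"
    by (rule compact_subset_open_imp_cball_epsilon_subset[OF V(1) open_interior V(2)])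
  define K where "K = (\<Union>x\<in>closure V. \<Union>y\<in>cball 0 e. {x + y})"
  have K: "compact K" unfolding K_def by (intro compact_sums' V(1) compact_cball)
  have KU: "K \<subseteq> ?U"
  proof
    fix z assume "z \<in> K"
    then obtain x y where "x \<in> closure V" "norm y \<le> e" "z = x + y" by (auto simp: K_def)
    then have "z \<in> (\<Union>x\<in>closure V. cball x e)" by (auto simp: dist_norm intro!: bexI[of _ x])
    then show "z \<in> ?U" using e(2) by blast
  qed
  from compact_facet_gap[OF K KU] obtain \<epsilon> where
    "0 < \<epsilon> \<and> (\<forall>x\<in>K. \<forall>F\<in>facets M. \<epsilon> \<le> facet_function F x)" ..
  then have \<epsilon>: "\<epsilon> > 0" "x \<in> K \<Longrightarrow> F \<in> facets M \<Longrightarrow> facet_function F x \<ge> \<epsilon>" for x F by simp_all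
  define n where "n = real CARD('n)"
  have n: "n > 0" by (simp add: n_def)
  \<comment> \<open>The first bound makes the gap sufficient for membership in \<open>\<Lambda>\<^sub>\<hbar>\<close>, the second keeps the
    points \<open>x + hp\<close> in \<open>K\<close>; \<open>l + 1\<close> instead of \<open>l\<close> only avoids a division by zero.\<close>
  define \<delta> where "\<delta> = min (2 * \<epsilon>) (e / (n * (real l + 1)))"
  have \<delta>: "\<delta> > 0" using \<epsilon>(1) e(1) n by (simp add: \<delta>_def)
  have near: "z \<in> K" if x: "x \<in> V" and h: "0 \<le> h" "h < \<delta>" and z: "\<And>i. \<bar>z $ i - x $ i\<bar> \<le> h * real l" for x z h
  proof -
    have "norm (z - x) \<le> (\<Sum>i\<in>UNIV. \<bar>(z - x) $ i\<bar>)" by (rule norm_le_l1_cart)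
    also have "\<dots> \<le> (\<Sum>i\<in>(UNIV::'n set). h * real l)" using z by (intro sum_mono) simp
    also have "\<dots> \<le> h * (n * (real l + 1))" using h(1) n by (simp add: n_def algebra_simps)
    also have "\<dots> \<le> e"
    proof -
      have "n * (real l + 1) > 0" using n by simp
      moreover have "h < e / (n * (real l + 1))" using h(2) by (simp add: \<delta>_def)
      ultimately show ?thesis using pos_less_divide_eq less_imp_le by blast
    qed
    finally have "z - x \<in> cball 0 e" by simp
    moreover have "x \<in> closure V" using x closure_subset[of V] by blast
    ultimately show "z \<in> K" unfolding K_def by (intro UN_I[of x] UN_I[of "z - x"]) auto
  qed
  obtain W where W: "\<And>A :: (int^'n) set. finite A \<Longrightarrow> sum weight A \<le> W" using weight_sum_bound by blast
  define \<omega> where "\<omega> d = (\<Sum>p\<in>B. weight (d - p))" for d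
  have \<omega>: "\<omega> d \<ge> 0" for d unfolding \<omega>_def by (intro sum_nonneg less_imp_le weight_pos)
  have \<omega>W: "sum \<omega> D \<le> real (card B) * W" if D: "finite D" for D
  proof -
    have "(\<Sum>d\<in>D. weight (d - p)) \<le> W" for p
    proof -
      have "sum weight ((\<lambda>d. d - p) ` D) = (\<Sum>d\<in>D. weight (d - p))"
        by (subst sum.reindex) (auto simp: inj_on_def)
      then show ?thesis using W[of "(\<lambda>d. d - p) ` D"] D by simp
    qed
    then have "(\<Sum>p\<in>B. \<Sum>d\<in>D. weight (d - p)) \<le> of_nat (card B) * W"
      by (intro sum_bounded_above)
    then show ?thesis unfolding \<omega>_def by (subst sum.swap) simp
  qed
  have W0: "W \<ge> 0" using W[of "{}"] by simp
  show ?thesis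
  proof (rule exI[of _ \<delta>], intro conjI \<delta> allI)
    fix N
    obtain C where C: "C \<ge> 0" "\<And>h x s. 0 \<le> h \<Longrightarrow> \<forall>z. (\<forall>i. \<bar>z $ i - x $ i\<bar> \<le> h * real l) \<longrightarrow> z \<in> K \<Longrightarrow>
      cmod ((\<Sum>p\<in>B. slice_coeff G p x * slice_coeff F (s - p) (x + h *\<^sub>R rvec p))
        - slice_coeff (torus_star h N F G) s x) \<le> C * h ^ Suc N * (\<Sum>p\<in>B. weight (s - p))"
      using star_remainder_bound[OF open_interior F G B zero lB K KU, of N] by blast
    \<comment> \<open>The summand 1 only serves to make the constant positive.\<close>
    let ?K = "C * (real (card B) * W) + 1"
    have K0: "?K > 0" using C(1) W0 by (simp add: add_nonneg_pos)
    show "\<exists>K>0. \<forall>k. odd k \<and> 1 / real k < \<delta> \<longrightarrow> local_opnorm M k V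
      (\<lambda>s \<rho>. toeplitz M k f (toeplitz M k g s) \<rho> - toeplitz M k (star_product M (1 / real k) N f g) s \<rho>)
      \<le> K * (1 / real k) ^ (N + 1)"
    proof (rule exI[of _ ?K], intro conjI K0 allI impI)
      fix k :: nat assume k: "odd k \<and> 1 / real k < \<delta>"
      then have k0: "k > 0" by (cases k) auto
      define h where "h = 1 / real k"
      have h: "0 \<le> h" "h < \<delta>" using k by (auto simp: h_def)
      let ?L = "Lambda M k" and ?S = "{m \<in> Lambda M k. rvec m \<in> (\<lambda>x. real k *\<^sub>R x) ` V}"
      let ?A = "\<lambda>s \<rho>. toeplitz M k f (toeplitz M k g s) \<rho> - toeplitz M k (star_product M h N f g) s \<rho>"
      let ?pt = "\<lambda>m. h *\<^sub>R rvec m"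
      define a where "a m' m = (\<Sum>m1\<in>?L. slice_coeff G (m1 - m) (?pt m) * slice_coeff F (m' - m1) (?pt m1))
        - slice_coeff (torus_star h N F G) (m' - m) (?pt m)" for m' m
      have finL: "finite ?L" by (rule finite_Lambda[OF k0])
      have ptV: "?pt m \<in> V" if "m \<in> ?S" for m using that k0 by (auto simp: h_def)
      have nearV: "\<forall>z. (\<forall>i. \<bar>z $ i - ?pt m $ i\<bar> \<le> h * real l) \<longrightarrow> z \<in> K" if "m \<in> ?S" for m
        using near[OF ptV[OF that] h] by blast
      have shift: "m + p \<in> ?L" if m: "m \<in> ?S" and p: "p \<in> B" for m p
      proof -
        have "\<bar>real_of_int (p $ i)\<bar> \<le> real l" for i using lB[OF p, of i] by linarith
        then have "\<bar>?pt (m + p) $ i - ?pt m $ i\<bar> \<le> h * real l" for i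
          using h(1) by (simp add: abs_mult mult_left_mono distrib_left)
        then have "?pt (m + p) \<in> K" using nearV[OF m] by blast
        then have "facet_function F (?pt (m + p)) \<ge> 1 / (2 * real k)" if "F \<in> facets M" for F
          using \<epsilon>(2)[OF _ that] h(2) by (fastforce simp: h_def \<delta>_def)
        then show ?thesis unfolding Lambda_iff[OF k0] by (simp add: h_def)
      qed
      have a: "cmod (a m' m) \<le> C * h ^ Suc N * \<omega> (m' - m)" if m: "m \<in> ?S" for m' m
      proof -
        have "(\<Sum>m1\<in>?L. slice_coeff G (m1 - m) (?pt m) * slice_coeff F (m' - m1) (?pt m1))
            = (\<Sum>m1\<in>(\<lambda>p. m + p) ` B. slice_coeff G (m1 - m) (?pt m) * slice_coeff F (m' - m1) (?pt m1))"
        proof (rule sum.mono_neutral_right[OF finL])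
          show "(\<lambda>p. m + p) ` B \<subseteq> ?L" using shift[OF m] by blast
          show "\<forall>m1\<in>?L - (\<lambda>p. m + p) ` B. slice_coeff G (m1 - m) (?pt m) * slice_coeff F (m' - m1) (?pt m1) = 0"
          proof
            fix m1 assume m1: "m1 \<in> ?L - (\<lambda>p. m + p) ` B"
            have "m1 - m \<notin> B"
            proof
              assume "m1 - m \<in> B"
              then have "m + (m1 - m) \<in> (\<lambda>p. m + p) ` B" by (rule imageI)
              then show False using m1 by simp
            qed
            moreover have "?pt m \<in> ?U" using ptV[OF m] V(2) closure_subset by blast
            ultimately show "slice_coeff G (m1 - m) (?pt m) * slice_coeff F (m' - m1) (?pt m1) = 0"
              using zero by simp
          qed
        qed
        also have "\<dots> = (\<Sum>p\<in>B. slice_coeff G p (?pt m) * slice_coeff F (m' - m - p) (?pt m + h *\<^sub>R rvec p))"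
          by (subst sum.reindex) (auto simp: inj_on_def rvec_add scaleR_add_right diff_diff_eq)
        finally show ?thesis
          using C(2)[OF h(1) nearV[OF m], of "m' - m"] unfolding a_def \<omega>_def by simp
      qed
      have bound: "state_norm M k (?A s) \<le> ?K * h ^ (N + 1)"
        if s: "s \<in> local_space M k V" "state_norm M k s \<le> 1" for s
      proof -
        obtain b where b: "s = (\<lambda>\<rho>. \<Sum>m\<in>?S. b m * sigma M k m \<rho>)"
          using s(1) by (auto simp: local_space_def states_on_def)
        define c where "c m = (if m \<in> ?S then b m else 0)" for m
        have sub: "(\<Sum>m\<in>?L. c m * t m) = (\<Sum>m\<in>?S. c m * t m)" for t
          by (rule sum.mono_neutral_right[OF finL]) (auto simp: c_def)
        have sc: "s = (\<lambda>\<rho>. \<Sum>m\<in>?L. c m * sigma M k m \<rho>)"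
          unfolding b sub by (simp add: c_def)
        have cL: "c m = 0" if "m \<notin> ?L" for m using that by (simp add: c_def)
        have "state_norm M k s = sqrt (\<Sum>m\<in>?L. (cmod (c m))\<^sup>2)"
          unfolding sc by (rule state_norm_sum[OF norm _ cL]) (use k in simp_all)
        then have c1: "(\<Sum>m\<in>?L. (cmod (c m))\<^sup>2) \<le> 1" using s(2) by simp
        define d where "d m' = (if m' \<in> ?L then \<Sum>m\<in>?S. c m * a m' m else 0)" for m'
        have "?A s = (\<lambda>\<rho>. \<Sum>m'\<in>?L. (\<Sum>m\<in>?L. c m * a m' m) * sigma M k m' \<rho>)"
          unfolding sc a_def F_def G_def h_def
          by (rule toeplitz_composition_minus_star[OF norm]) (use k F G in \<open>simp_all add: F_def G_def\<close>)
        also have "\<dots> = (\<lambda>\<rho>. \<Sum>m'\<in>?L. d m' * sigma M k m' \<rho>)"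
          unfolding sub by (simp add: d_def)
        finally have "state_norm M k (?A s) = sqrt (\<Sum>m'\<in>?L. (cmod (d m'))\<^sup>2)"
          by (simp only:) (rule state_norm_sum[OF norm], use k in \<open>simp_all add: d_def\<close>)
        also have "(\<Sum>m'\<in>?L. (cmod (d m'))\<^sup>2) = (\<Sum>m'\<in>?L. (cmod (\<Sum>m\<in>?S. c m * a m' m))\<^sup>2)"
          by (simp add: d_def)
        also have "sqrt \<dots> \<le> sqrt ((C * h ^ Suc N * (real (card B) * W))\<^sup>2 * (\<Sum>m\<in>?S. (cmod (c m))\<^sup>2))"
          by (intro real_sqrt_le_mono schur_test[of _ _ _ \<omega>])
             (use finL C(1) h(1) \<omega> a \<omega>W in auto)
        also have "\<dots> \<le> sqrt ((C * h ^ Suc N * (real (card B) * W))\<^sup>2 * 1)"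
        proof (intro real_sqrt_le_mono mult_left_mono)
          have "(\<Sum>m\<in>?S. (cmod (c m))\<^sup>2) \<le> (\<Sum>m\<in>?L. (cmod (c m))\<^sup>2)"
            by (rule sum_mono2[OF finL]) auto
          then show "(\<Sum>m\<in>?S. (cmod (c m))\<^sup>2) \<le> 1" using c1 by linarith
        qed simp
        also have "\<dots> = C * (real (card B) * W) * h ^ Suc N"
          using C(1) W0 h(1) by (simp add: mult_ac)
        also have "\<dots> \<le> ?K * h ^ (N + 1)" using h(1) by (simp add: distrib_right)
        finally show ?thesis .
      qed
      have "(\<lambda>\<rho>. \<Sum>m\<in>?S. 0 * sigma M k m \<rho>) \<in> local_space M k V"
        unfolding local_space_def states_on_def by (intro CollectI exI[of _ "\<lambda>_. 0"]) simp
      moreover have "state_norm M k (\<lambda>\<rho>. \<Sum>m\<in>?S. 0 * sigma M k m \<rho>) \<le> 1"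
        using state_norm_sum[OF norm, of k "\<lambda>_. 0"] k by simp
      ultimately have "{state_norm M k (?A s) | s. s \<in> local_space M k V \<and> state_norm M k s \<le> 1} \<noteq> {}"
        by blast
      then have "local_opnorm M k V ?A \<le> ?K * h ^ (N + 1)"
        unfolding local_opnorm_def by (rule cSup_least) (use bound in blast)
      then show "local_opnorm M k V
        (\<lambda>s \<rho>. toeplitz M k f (toeplitz M k g s) \<rho> - toeplitz M k (star_product M (1 / real k) N f g) s \<rho>)
        \<le> ?K * (1 / real k) ^ (N + 1)"
        unfolding h_def .
    qed
  qed
qed

end

theorem theorem1p1:
  fixes M :: "('x::t2_space, 'n::finite) toric_data"
    and k0 :: nat
    and f g :: "'x \<Rightarrow> complex"
    and V :: "(real^'n) set"
  assumes "toric_manifold M"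
    and "half_form_integrality M"
    and "moment_normalized M"
    and "k0 \<ge> 1" and "positive_from M k0"
    and "smooth_fun (atlas M) UNIV f"
    and "g \<in> smooth_finite M"
    and "open V" and "compact (closure V)" and "closure V \<subseteq> interior (polytope_of M)"
  shows "\<exists>\<delta>>0. \<forall>N::nat. \<exists>K>0. \<forall>k::nat. odd k \<and> k \<ge> k0 \<and> 1 / real k < \<delta> \<longrightarrow>
    local_opnorm M k V
      (\<lambda>s \<rho>. toeplitz M k f (toeplitz M k g s) \<rho> - toeplitz M k (star_product M (1 / real k) N f g) s \<rho>)
    \<le> K * (1 / real k) ^ (N + 1)"
  using toeplitz_composition_bound[OF assms(1,3,6,7,9,10)] by meson

end
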